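(* Let $M$ be a closed connected oriented Riemannian manifold, let $k\in\mathbb{N}$, and let $f_1,\dots,f_k\colon M\to M$ be $C^2$-expanding endomorphisms with $\{x\in M: f_j(x)=f_{j'}(x)\}=\emptyset$ for all $1\le j\neq j'\le k$. Let $T$ be the correspondence $T(x)=\{f_1(x),\dots,f_k(x)\}$ on $M$, and let $\phi\colon\mathcal{O}_2(T)\to\mathbb{R}$ be defined by $\phi(x_1,x_2)=-\log \mathrm{Jac}(f_j(x_1))$ if $x_2=f_j(x_1)$, $1\le j\le k$. Then the topological pressure of $T$ with respect to $\phi$ satisfies $$P(T,\phi)=\log k.$$
   Context: Closed means compact without boundary; $d$ is the distance on $M$ induced by the Riemannian metric and $|\cdot|$ the norm on $TM$. A map $f\colon M\to M$ is expanding if there are $\lambda_0>1$, $c_0>0$ with $|Df^n(x)v|\ge c_0\lambda_0^n|v|$ for all $x\in M$, $v\in T_xM$, $n\ge 0$. Standing assumption: the Riemannian metric on $M$ is such that $c_0=1$ for every $f_j$. $\mathrm{Jac}(f(x))>0$ denotes the Jacobian (absolute value of the determinant with respect to the Riemannian metric) of the linear map $Df(x)\colon T_xM\to T_{f(x)}M$. A correspondence on a compact metric space $(X,d)$ is an upper semi-continuous map $T$ from $X$ to the nonempty closed subsets of $X$. For $n\in\mathbb{N}$, $\mathcal{O}_n(T)=\{(x_1,\dots,x_n)\in X^n: x_{i+1}\in T(x_i),\ 1\le i\le n-1\}$, with metric $d_n(\underline{x},\underline{y})=\max_{1\le i\le n}d(x_i,y_i)$. For continuous $\phi\colon\mathcal{O}_2(T)\to\mathbb{R}$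 put $S_n\phi(x_1,\dots,x_{n+1})=\sum_{i=1}^n\phi(x_i,x_{i+1})$. A subset $E$ of $\mathcal{O}_{n+1}(T)$ is $(d_{n+1},\varepsilon)$-separated if $d_{n+1}(\underline{x},\underline{y})>\varepsilon$ for all distinct $\underline{x},\underline{y}\in E$. The topological pressure is $$P(T,\phi)=\lim_{\varepsilon\to0}\limsup_{n\to+\infty}\frac1n\log\sup_E\sum_{\underline{x}\in E}\exp(S_n\phi(\underline{x})),$$ where $E$ ranges over all $(d_{n+1},\varepsilon)$-separated subsets of $\mathcal{O}_{n+1}(T)$. *)

theory Defs
  imports "HOL-Analysis.Analysis"
begin

section \<open>Maps of class \<open>C\<^sup>k\<close> on open sets\<close>

text \<open>Only meant for finite-dimensional spaces and open \<open>S\<close>: the \<open>k\<close>-th derivative is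
  required to be continuous after evaluation at each vector, which is equivalent to operator-norm
  continuity in finite dimension.\<close>

primrec C_on :: "nat \<Rightarrow> ('a::euclidean_space \<Rightarrow> 'b::real_normed_vector) \<Rightarrow> 'a set \<Rightarrow> bool" where
  "C_on 0 f S \<longleftrightarrow> continuous_on S f"
| "C_on (Suc k) f S \<longleftrightarrow>
     (\<forall>x\<in>S. f differentiable (at x)) \<and> (\<forall>v. C_on k (\<lambda>x. frechet_derivative f (at x) v) S)"

definition smooth_on :: "('a::euclidean_space \<Rightarrow> 'b::real_normed_vector) \<Rightarrow> 'a set \<Rightarrow> bool" where
  "smooth_on f S \<longleftrightarrow> (\<forall>k. C_on k f S)"


section \<open>Charts and tangent vectors\<close>

text \<open>A chart is a domain together with a coordinate map whose values outside the domain are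
  irrelevant.\<close>

type_synonym ('m, 'n) chart = "'m set \<times> ('m \<Rightarrow> real ^ 'n)"

abbreviation cdom :: "('m, 'n) chart \<Rightarrow> 'm set" where
  "cdom c \<equiv> fst c"

abbreviation coord :: "('m, 'n) chart \<Rightarrow> 'm \<Rightarrow> real ^ 'n" where
  "coord c \<equiv> snd c"

definition param :: "('m, 'n) chart \<Rightarrow> real ^ 'n \<Rightarrow> 'm" where
  "param c = inv_into (cdom c) (coord c)"

definition is_chart :: "('m::topological_space, 'n::finite) chart \<Rightarrow> bool" where
  "is_chart c \<longleftrightarrow> open (cdom c) \<and> open (coord c ` cdom c) \<and>
     homeomorphism (cdom c) (coord c ` cdom c) (coord c) (param c)"

definition transition :: "('m, 'n) chart \<Rightarrow> ('m, 'n) chart \<Rightarrow> real ^ 'n \<Rightarrow> real ^ 'n" where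
  "transition c c' = coord c' \<circ> param c"

text \<open>One chart of the atlas \<open>A\<close> is chosen around every point \<open>x\<close>. A tangent vector at \<open>x\<close> is
  represented by its coordinates in \<open>chart_at A x\<close>, so the tangent space at every point is the type
  \<open>real ^ 'n\<close>; coordinates in another chart are related to these by the derivative of the transition
  map.\<close>

definition chart_at :: "('m, 'n) chart set \<Rightarrow> 'm \<Rightarrow> ('m, 'n) chart" where
  "chart_at A x = (SOME c. c \<in> A \<and> x \<in> cdom c)"

text \<open>The tangent vector at \<open>x\<close> whose coordinates in the chart \<open>c\<close> are \<open>u\<close>.\<close>

definition chart_vector ::
    "('m, 'n::finite) chart set \<Rightarrow> ('m, 'n) chart \<Rightarrow> 'm \<Rightarrow> real ^ 'n \<Rightarrow> real ^ 'n" where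
  "chart_vector A c x u = frechet_derivative (transition c (chart_at A x)) (at (coord c x)) u"

text \<open>The tangent map \<open>Df(x)\<close>, from the tangent space at \<open>x\<close> to the one at \<open>f x\<close>.\<close>

definition tangent_map ::
    "('m, 'n::finite) chart set \<Rightarrow> ('m \<Rightarrow> 'm) \<Rightarrow> 'm \<Rightarrow> real ^ 'n \<Rightarrow> real ^ 'n" where
  "tangent_map A f x =
     frechet_derivative (coord (chart_at A (f x)) \<circ> f \<circ> param (chart_at A x))
       (at (coord (chart_at A x) x))"

definition C_map ::
    "nat \<Rightarrow> ('m::topological_space, 'n::finite) chart set \<Rightarrow> ('m \<Rightarrow> 'm) \<Rightarrow> bool" where
  "C_map k A f \<longleftrightarrow> continuous_on UNIV f \<and>
     (\<forall>c\<in>A. \<forall>c'\<in>A.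
        C_on k (coord c' \<circ> f \<circ> param c) (coord c ` (cdom c \<inter> f -` cdom c')))"


section \<open>Riemannian manifolds\<close>

text \<open>The manifold is the whole type \<open>'m\<close>, the metric at \<open>x\<close> is a form \<open>g x\<close> on the tangent space
  at \<open>x\<close>.\<close>

locale riemannian_manifold =
  fixes A :: "('m::t2_space, 'n::finite) chart set"
    and g :: "'m \<Rightarrow> real ^ 'n \<Rightarrow> real ^ 'n \<Rightarrow> real"
  assumes charts: "c \<in> A \<Longrightarrow> is_chart c"
    and cover: "(\<Union>c\<in>A. cdom c) = UNIV"
    and smooth_transition: "c \<in> A \<Longrightarrow> c' \<in> A \<Longrightarrow>
          smooth_on (transition c c') (coord c ` (cdom c \<inter> cdom c'))"
    and metric_bilinear: "bilinear (g x)"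
    and metric_sym: "g x v w = g x w v"
    and metric_pos: "v \<noteq> 0 \<Longrightarrow> g x v v > 0"
    and metric_smooth: "c \<in> A \<Longrightarrow>
          smooth_on (\<lambda>y. g (param c y) (chart_vector A c (param c y) u) (chart_vector A c (param c y) w))
            (coord c ` cdom c)"

text \<open>Second countability is not listed: it follows from compactness. The orientation is the one
  for which all charts of the atlas are positive.\<close>

locale closed_connected_oriented_riemannian_manifold = riemannian_manifold A g
  for A :: "('m::t2_space, 'n::finite) chart set"
    and g :: "'m \<Rightarrow> real ^ 'n \<Rightarrow> real ^ 'n \<Rightarrow> real" +
  assumes closed_manifold: "compact (UNIV :: 'm set)"
    and connected_manifold: "connected (UNIV :: 'm set)"
    and oriented_atlas: "c \<in> A \<Longrightarrow> c' \<in> A \<Longrightarrow> x \<in> cdom c \<inter> cdom c' \<Longrightarrow>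
          det (matrix (frechet_derivative (transition c c') (at (coord c x)))) > 0"

definition tnorm :: "('m \<Rightarrow> real ^ 'n \<Rightarrow> real ^ 'n \<Rightarrow> real) \<Rightarrow> 'm \<Rightarrow> real ^ 'n \<Rightarrow> real" where
  "tnorm g x v = sqrt (g x v v)"

definition C1_curve_on ::
    "('m::topological_space, 'n::finite) chart set \<Rightarrow> (real \<Rightarrow> 'm) \<Rightarrow> real \<Rightarrow> real \<Rightarrow> bool" where
  "C1_curve_on A \<gamma> a b \<longleftrightarrow> continuous_on {a..b} \<gamma> \<and>
     (\<forall>c\<in>A. \<exists>D. continuous_on {t\<in>{a..b}. \<gamma> t \<in> cdom c} D \<and>
        (\<forall>t\<in>{a..b}. \<gamma> t \<in> cdom c \<longrightarrow>
           ((coord c \<circ> \<gamma>) has_vector_derivative D t) (at t within {a..b})))"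

text \<open>The one-sided velocities exist at the break points, unlike for
  \<^const>\<open>piecewise_C1_differentiable_on\<close>; hence the speed is bounded and integrable.\<close>

definition piecewise_C1_curve ::
    "('m::topological_space, 'n::finite) chart set \<Rightarrow> (real \<Rightarrow> 'm) \<Rightarrow> bool" where
  "piecewise_C1_curve A \<gamma> \<longleftrightarrow>
     (\<exists>S. finite S \<and> {0, 1} \<subseteq> S \<and> S \<subseteq> {0..1} \<and>
        (\<forall>a\<in>S. \<forall>b\<in>S. a < b \<and> {a<..<b} \<inter> S = {} \<longrightarrow> C1_curve_on A \<gamma> a b))"

definition velocity :: "('m, 'n::finite) chart set \<Rightarrow> (real \<Rightarrow> 'm) \<Rightarrow> real \<Rightarrow> real ^ 'n" where
  "velocity A \<gamma> t = vector_derivative (coord (chart_at A (\<gamma> t)) \<circ> \<gamma>) (at t)"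

definition curve_length ::
    "('m, 'n::finite) chart set \<Rightarrow> ('m \<Rightarrow> real ^ 'n \<Rightarrow> real ^ 'n \<Rightarrow> real) \<Rightarrow> (real \<Rightarrow> 'm) \<Rightarrow> real" where
  "curve_length A g \<gamma> = integral {0..1} (\<lambda>t. tnorm g (\<gamma> t) (velocity A \<gamma> t))"

definition riemannian_dist ::
    "('m::topological_space, 'n::finite) chart set \<Rightarrow> ('m \<Rightarrow> real ^ 'n \<Rightarrow> real ^ 'n \<Rightarrow> real)
      \<Rightarrow> 'm \<Rightarrow> 'm \<Rightarrow> real" where
  "riemannian_dist A g x y =
     Inf {curve_length A g \<gamma> | \<gamma>. piecewise_C1_curve A \<gamma> \<and> \<gamma> 0 = x \<and> \<gamma> 1 = y}"

definition orthonormal_frame ::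
    "('m \<Rightarrow> real ^ 'n \<Rightarrow> real ^ 'n \<Rightarrow> real) \<Rightarrow> 'm \<Rightarrow> 'n::finite \<Rightarrow> real ^ 'n" where
  "orthonormal_frame g x = (SOME e. \<forall>i j. g x (e i) (e j) = (if i = j then 1 else 0))"

text \<open>The matrix below represents \<open>Df(x)\<close> in orthonormal bases of the two tangent spaces; the
  absolute value of its determinant does not depend on their choice.\<close>

definition Jac ::
    "('m, 'n::finite) chart set \<Rightarrow> ('m \<Rightarrow> real ^ 'n \<Rightarrow> real ^ 'n \<Rightarrow> real) \<Rightarrow> ('m \<Rightarrow> 'm) \<Rightarrow> 'm \<Rightarrow> real" where
  "Jac A g f x =
     \<bar>det (\<chi> i j. g (f x) (orthonormal_frame g (f x) i)
                           (tangent_map A f x (orthonormal_frame g x j)))\<bar>"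

definition expanding ::
    "('m, 'n::finite) chart set \<Rightarrow> ('m \<Rightarrow> real ^ 'n \<Rightarrow> real ^ 'n \<Rightarrow> real) \<Rightarrow> real \<Rightarrow> ('m \<Rightarrow> 'm) \<Rightarrow> bool" where
  "expanding A g c0 f \<longleftrightarrow> c0 > 0 \<and>
     (\<exists>lam>1. \<forall>x v. \<forall>n::nat.
        tnorm g ((f ^^ n) x) (tangent_map A (f ^^ n) x v) \<ge> c0 * lam ^ n * tnorm g x v)"


section \<open>Topological pressure of a correspondence\<close>

text \<open>The compact metric space is the whole type with the distance function \<open>d\<close>, and \<open>(x\<^sub>1, \<dots>, x\<^sub>n)\<close> is a
  list, indexed from \<open>0\<close>.\<close>

definition orbits :: "nat \<Rightarrow> ('a \<Rightarrow> 'a set) \<Rightarrow> 'a list set" where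
  "orbits n T = {xs. length xs = n \<and> (\<forall>i. Suc i < n \<longrightarrow> xs ! Suc i \<in> T (xs ! i))}"

definition orbit_dist :: "('a \<Rightarrow> 'a \<Rightarrow> real) \<Rightarrow> nat \<Rightarrow> 'a list \<Rightarrow> 'a list \<Rightarrow> real" where
  "orbit_dist d n xs ys = Max {d (xs ! i) (ys ! i) | i. i < n}"

definition birkhoff_sum :: "('a \<times> 'a \<Rightarrow> real) \<Rightarrow> nat \<Rightarrow> 'a list \<Rightarrow> real" where
  "birkhoff_sum \<phi> n xs = (\<Sum>i<n. \<phi> (xs ! i, xs ! Suc i))"

definition separated :: "('a \<Rightarrow> 'a \<Rightarrow> real) \<Rightarrow> nat \<Rightarrow> real \<Rightarrow> 'a list set \<Rightarrow> bool" where
  "separated d n \<epsilon> E \<longleftrightarrow> (\<forall>xs\<in>E. \<forall>ys\<in>E. xs \<noteq> ys \<longrightarrow> orbit_dist d n xs ys > \<epsilon>)"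

definition ln_ennreal :: "ennreal \<Rightarrow> ereal" where
  "ln_ennreal x = (if x = 0 then -\<infinity> else if x = top then \<infinity> else ereal (ln (enn2real x)))"

text \<open>The sum is taken in \<^typ>\<open>ennreal\<close> so that it is meaningful for infinite \<open>E\<close> as well. The limit
  for \<open>\<epsilon> \<rightarrow> 0\<close> always exists in \<^typ>\<open>ereal\<close>, by monotonicity in \<open>\<epsilon>\<close>.\<close>

definition topological_pressure ::
    "('a \<Rightarrow> 'a \<Rightarrow> real) \<Rightarrow> ('a \<Rightarrow> 'a set) \<Rightarrow> ('a \<times> 'a \<Rightarrow> real) \<Rightarrow> ereal" where
  "topological_pressure d T \<phi> =
     Lim (at_right 0) (\<lambda>\<epsilon>. limsup (\<lambda>n.
       ln_ennreal (SUP E \<in> {E. E \<subseteq> orbits (n + 1) T \<and> separated d (n + 1) \<epsilon> E}.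
          (\<Sum>\<^sub>\<infinity>xs\<in>E. ennreal (exp (birkhoff_sum \<phi> n xs)))) / ereal (real n)))"

end

theory Submission
  imports Defs
begin

text \<open>
  In the pressure the sum over an \<open>\<epsilon>\<close>-separated set splits according to the words \<open>w\<close> of length \<open>n\<close> in
  the letters \<open>1, \<dots>, k\<close>. There are \<open>k\<^sup>n\<close> of them, and since the maps have no coincidences,
  orbits along different words are separated for small \<open>\<epsilon>\<close>. For a fixed word, the
  composition \<open>F\<close> of the \<open>n\<close> maps sends the Bowen ball around \<open>x\<close> onto a set of volume bounded above and
  below, and its Jacobian on that ball is the Jacobian \<open>J(x)\<close> of \<open>F\<close> at \<open>x\<close> up to a
  factor \<open>exp (n \<eta>)\<close>. So \<open>1 / J(x)\<close> is comparable to the volume of the Bowen ball, and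
  the sum of \<open>exp (S\<^sub>n \<phi>) = 1 / J\<close> over a separated set, respectively over the centres of a cover by
  Bowen balls, is at most \<open>K exp (n \<eta>)\<close>, respectively at least \<open>\<kappa> exp (- n \<eta>)\<close>.

  As errors \<open>exp (n \<eta>)\<close> with arbitrarily small \<open>\<eta>\<close> are harmless, only the continuity of the Jacobians is
  needed, and volumes are needed only up to bounded factors: Lebesgue measure in finitely many charts
  replaces the Riemannian volume. Besides invertible derivatives, expansion only provides that the image of
  a small ball under each of the maps contains the ball of the same radius around the image of the centre,
  because short curves can be lifted through local inverses without becoming longer.
\<close>

section \<open>Volume in coordinates\<close>

text \<open>All constants have to be independent of \<open>n\<close>. This works because a single
  map covers a ball by a ball of the same radius (\<open>expanding_ball\<close>, for every radius
  below a common bound): an induction along a word loses nothing, and each composition maps a Bowen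
  ball onto the full ball of its radius. They vanish in the limsup over \<open>n\<close>, which
  leaves \<open>ln k\<close> up to \<eta>, and \<eta> tends to 0 last. The distance is merely an
  infimum of lengths and no geodesics are used. What is known about it comes from two comparisons
  with a chart: a short curve cannot leave a coordinate ball, and a short coordinate segment has
  small length.\<close>

text \<open>The change of variables estimates of the library require a well-ordered index type.\<close>

typedef (overloaded) ('a::finite) wo = "{..<CARD('a)}"
  by (rule exI[of _ 0]) (simp add: zero_less_card_finite)

instantiation wo :: (finite) "{finite, wellorder}"
begin
definition less_eq_wo :: "'a wo \<Rightarrow> 'a wo \<Rightarrow> bool" where "less_eq_wo a b \<longleftrightarrow> Rep_wo a \<le> Rep_wo b"
definition less_wo :: "'a wo \<Rightarrow> 'a wo \<Rightarrow> bool" where "less_wo a b \<longleftrightarrow> Rep_wo a < Rep_wo b"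
instance
proof
  fix x y z :: "'a wo"
  show "(x < y) = (x \<le> y \<and> \<not> y \<le> x)" by (auto simp: less_eq_wo_def less_wo_def)
  show "x \<le> x" by (auto simp: less_eq_wo_def)
  show "x \<le> y \<Longrightarrow> y \<le> z \<Longrightarrow> x \<le> z" by (auto simp: less_eq_wo_def)
  show "x \<le> y \<Longrightarrow> y \<le> x \<Longrightarrow> x = y" by (auto simp: less_eq_wo_def Rep_wo_inject)
  show "x \<le> y \<or> y \<le> x" by (auto simp: less_eq_wo_def)
  show "finite (UNIV :: 'a wo set)"
    unfolding type_definition.univ[OF type_definition_wo] by simp
  fix P :: "'a wo \<Rightarrow> bool" and a
  assume step: "\<And>x. (\<And>y. y < x \<Longrightarrow> P y) \<Longrightarrow> P x"
  show "P a"
    by (rule measure_induct_rule[of Rep_wo]) (rule step, simp add: less_wo_def)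
qed
end

lemma ex_bij_wo: "\<exists>h::'n::finite wo \<Rightarrow> 'n. bij h"
proof -
  have "card (UNIV :: 'n wo set) = CARD('n)"
    using type_definition.card[OF type_definition_wo[where 'a='n]] by simp
  then show ?thesis
    using finite_same_card_bij[of "UNIV::'n wo set" "UNIV::'n set"] by auto
qed

definition of_wo :: "'n::finite wo \<Rightarrow> 'n" where "of_wo = (SOME h. bij h)"

lemma bij_of_wo: "bij of_wo"
  unfolding of_wo_def by (rule someI_ex[OF ex_bij_wo])

definition reindex :: "real ^ 'n::finite \<Rightarrow> real ^ 'n wo" where
  "reindex x = (\<chi> i. x $ of_wo i)"

definition unreindex :: "real ^ 'n::finite wo \<Rightarrow> real ^ 'n" where
  "unreindex x = (\<chi> i. x $ inv of_wo i)"

lemma reindex_unreindex [simp]: "reindex (unreindex x) = x"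
  by (simp add: reindex_def unreindex_def vec_eq_iff bij_is_inj[OF bij_of_wo])

lemma unreindex_reindex [simp]: "unreindex (reindex x) = x"
  by (simp add: reindex_def unreindex_def vec_eq_iff surj_f_inv_f[OF bij_is_surj[OF bij_of_wo]])

lemma linear_reindex: "linear reindex" and linear_unreindex: "linear unreindex"
  by (auto intro!: linearI simp: reindex_def unreindex_def vec_eq_iff)

lemmas bounded_linear_reindex = linear_reindex[unfolded linear_conv_bounded_linear]
lemmas bounded_linear_unreindex = linear_unreindex[unfolded linear_conv_bounded_linear]

lemma reindex_image_eq: "reindex ` S = unreindex -` S"
  by (auto intro: image_eqI[where x="unreindex _"])

lemma open_reindex: "open S \<Longrightarrow> open (reindex ` S)"
  unfolding reindex_image_eq
  using bounded_linear_unreindex linear_continuous_on by (metis open_vimage)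

lemma bounded_reindex: "bounded S \<Longrightarrow> bounded (reindex ` S)"
  using bounded_linear_reindex bounded_linear_image by blast

section \<open>Determinants under a relabelling of the index set\<close>

lemma evenperm_conj:
  fixes h :: "'a::finite \<Rightarrow> 'b::finite"
  assumes "bij h" "permutation p"
  shows "permutation (h \<circ> p \<circ> inv h) \<and> sign (h \<circ> p \<circ> inv h) = sign p"
proof -
  have sw: "swapidseq n p \<Longrightarrow> swapidseq n (h \<circ> p \<circ> inv h)" for n p
  proof (induction rule: swapidseq.induct)
    case id
    have "h \<circ> id \<circ> inv h = id" using assms(1) by (metis bij_is_surj comp_id surj_iff)
    then show ?case using swapidseq.id by metis
  next
    case (comp_Suc n p a b)
    \<comment> \<open>Conjugating a transposition by \<open>h\<close> gives the transposition of the
      image points, so a product of \<open>n\<close> transpositions remains one and the parity is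
      kept.\<close>
    have 1: "h \<circ> (Transposition.transpose a b \<circ> p) \<circ> inv h
        = Transposition.transpose (h a) (h b) \<circ> (h \<circ> p \<circ> inv h)"
    proof
      fix x
      show "(h \<circ> (Transposition.transpose a b \<circ> p) \<circ> inv h) x
        = (Transposition.transpose (h a) (h b) \<circ> (h \<circ> p \<circ> inv h)) x"
        using bij_is_inj[OF assms(1)] by (auto simp: Transposition.transpose_def inj_eq)
    qed
    have "h a \<noteq> h b" using comp_Suc.hyps bij_is_inj[OF assms(1)] by (auto simp: inj_eq)
    with comp_Suc show ?case unfolding 1 by (intro swapidseq.comp_Suc)
  qed
  obtain n where n: "swapidseq n p" using assms(2) by (auto simp: permutation_def)
  have n': "swapidseq n (h \<circ> p \<circ> inv h)" using sw[OF n] .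
  then show ?thesis
    using evenperm_unique[OF n refl] evenperm_unique[OF n' refl]
    by (auto simp: permutation_def sign_def)
qed

text \<open>Conjugation by \<open>h\<close> is a sign-preserving bijection between the permutations
  of the two index sets, and it matches the Leibniz sums term by term.\<close>

lemma det_reindex:
  fixes M :: "real ^ 'n::finite ^ 'n" and h :: "'k::finite \<Rightarrow> 'n"
  assumes h: "bij h"
  shows "det ((\<chi> i j. M $ h i $ h j) :: real ^ 'k ^ 'k) = det M"
proof -
  have hi: "bij (inv h)" using h by (simp add: bij_imp_bij_inv)
  have inj: "inj h" and sur: "surj h" using h by (auto simp: bij_def)
  define c where "c = (\<lambda>p. h \<circ> p \<circ> inv h)"
  have bc: "bij_betw c {p. p permutes (UNIV::'k set)} {p. p permutes (UNIV::'n set)}"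
  proof (rule bij_betw_byWitness[where f' = "\<lambda>p. inv h \<circ> p \<circ> h"])
    show "\<forall>p\<in>{p. p permutes (UNIV::'k set)}. inv h \<circ> c p \<circ> h = p"
      by (auto simp: c_def fun_eq_iff inj)
    show "\<forall>p\<in>{p. p permutes (UNIV::'n set)}. c (inv h \<circ> p \<circ> h) = p"
      by (auto simp: c_def fun_eq_iff surj_f_inv_f[OF sur])
    show "c ` {p. p permutes (UNIV::'k set)} \<subseteq> {p. p permutes (UNIV::'n set)}"
      using h hi by (auto simp: c_def permutes_bij intro!: bij_imp_permutes bij_comp)
    show "(\<lambda>p. inv h \<circ> p \<circ> h) ` {p. p permutes (UNIV::'n set)} \<subseteq> {p. p permutes (UNIV::'k set)}"
      using h hi by (auto simp: permutes_bij intro!: bij_imp_permutes bij_comp)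
  qed
  have "det M = (\<Sum>p\<in>{p. p permutes (UNIV::'k set)}. of_int (sign (c p)) * (\<Prod>i\<in>UNIV. M $ i $ c p i))"
    unfolding det_def by (rule sum.reindex_bij_betw[OF bc, symmetric])
  also have "\<dots> = det ((\<chi> i j. M $ h i $ h j) :: real ^ 'k ^ 'k)"
    unfolding det_def
  proof (rule sum.cong[OF refl])
    fix p :: "'k \<Rightarrow> 'k" assume "p \<in> {p. p permutes UNIV}"
    then have "permutation p" by (simp add: permutation_permutes) blast
    then have s: "sign (c p) = sign p" using evenperm_conj[OF h] by (simp add: c_def)
    have "(\<Prod>i\<in>UNIV. M $ i $ c p i) = (\<Prod>i\<in>UNIV. M $ h i $ c p (h i))"
      by (rule prod.reindex_bij_betw[OF h, symmetric])
    then show "of_int (sign (c p)) * (\<Prod>i\<in>UNIV. M $ i $ c p i) =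
      of_int (sign p) * (\<Prod>i\<in>UNIV. ((\<chi> i j. M $ h i $ h j) :: real ^ 'k ^ 'k) $ i $ p i)"
      by (subst s) (simp add: c_def inj)
  qed
  finally show ?thesis by simp
qed

lemma det_matrix_reindex:
  fixes L :: "real ^ 'n::finite \<Rightarrow> real ^ 'n"
  assumes "linear L"
  shows "det (matrix (reindex \<circ> L \<circ> unreindex)) = det (matrix L)"
proof -
  have ax: "unreindex (axis j (1::real)) = axis (of_wo j) 1" for j :: "'n wo"
    by (auto simp: unreindex_def vec_eq_iff axis_def bij_is_inj[OF bij_of_wo]
        surj_f_inv_f[OF bij_is_surj[OF bij_of_wo]])
  have "matrix (reindex \<circ> L \<circ> unreindex) = (\<chi> i j. matrix L $ of_wo i $ of_wo j)"
    by (simp add: matrix_def vec_eq_iff ax reindex_def)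
  then show ?thesis using det_reindex[OF bij_of_wo] by simp
qed

text \<open>Lebesgue measure of \<open>S\<close> itself up to the names of the coordinates.
  \<open>measure\<close> has the default value 0 on sets of infinite measure and on nonmeasurable
  ones, hence the assumptions of openness and boundedness below.\<close>

definition vol :: "(real ^ 'n::finite) set \<Rightarrow> real" where
  "vol S = measure lebesgue (reindex ` S)"

lemma vol_nonneg [simp]: "vol S \<ge> 0"
  by (simp add: vol_def)

lemma lmeasurable_reindex: "open S \<Longrightarrow> bounded S \<Longrightarrow> reindex ` S \<in> lmeasurable"
  by (simp add: lmeasurable_open open_reindex bounded_reindex)

lemma vol_mono:
  assumes "S \<subseteq> W" "open S" "open W" "bounded W"
  shows "vol S \<le> vol W"
  unfolding vol_def
  using assms lmeasurable_reindex[of W] lmeasurable_reindex[of S] bounded_subset[of W S]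
  by (intro measure_mono_fmeasurable) (auto intro: fmeasurableD)

lemma vol_pos:
  assumes "open S" "bounded S" "S \<noteq> {}"
  shows "vol S > 0"
proof -
  have "\<not> negligible (reindex ` S)"
    using open_not_negligible[OF open_reindex[OF assms(1)]] assms(3) by simp
  then show ?thesis
    unfolding vol_def using lmeasurable_reindex[OF assms(1,2)]
    by (metis measure_nonneg negligible_iff_measure order_le_less)
qed

lemma sum_vol_le:
  assumes "finite I" "\<And>i. i \<in> I \<Longrightarrow> open (S i) \<and> S i \<subseteq> W" "open W" "bounded W"
    and "disjoint_family_on S I"
  shows "(\<Sum>i\<in>I. vol (S i)) \<le> vol W"
proof -
  have m: "reindex ` S i \<in> lmeasurable" if "i \<in> I" for i
    using assms that by (intro lmeasurable_reindex) (auto intro: bounded_subset)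
  have "(\<Sum>i\<in>I. vol (S i)) = measure lebesgue (\<Union>i\<in>I. reindex ` S i)"
    unfolding vol_def
  proof (rule measure_finite_Union[symmetric])
    show "disjoint_family_on (\<lambda>i. reindex ` S i) I"
      using assms(5) unfolding disjoint_family_on_def reindex_image_eq by blast
  qed (use m assms(1) fmeasurableD fmeasurableD2[OF m] in \<open>auto simp del: emeasure_completion\<close>)
  also have "\<dots> \<le> vol W"
    unfolding vol_def using assms lmeasurable_reindex[of W] m
    by (intro measure_mono_fmeasurable) (auto intro!: fmeasurableD sets.finite_UN)
  finally show ?thesis .
qed

lemma vol_le_sum:
  assumes "finite I" "\<And>i. i \<in> I \<Longrightarrow> open (S i) \<and> bounded (S i)" "open W" "W \<subseteq> (\<Union>i\<in>I. S i)"
  shows "vol W \<le> (\<Sum>i\<in>I. vol (S i))"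
proof -
  have "vol W \<le> vol (\<Union>i\<in>I. S i)"
    using assms by (intro vol_mono) auto
  also have "\<dots> \<le> (\<Sum>i\<in>I. vol (S i))"
    unfolding vol_def image_UN
    using assms by (intro measure_UNION_le) (auto intro!: fmeasurableD lmeasurable_reindex)
  finally show ?thesis .
qed

section \<open>Change of variables inequalities\<close>

lemma measure_image_le:
  fixes f :: "real ^ 'n::{finite,wellorder} \<Rightarrow> real ^ 'n::_"
  assumes S: "S \<in> lmeasurable"
    and d: "\<And>x. x \<in> S \<Longrightarrow> (f has_derivative f' x) (at x)"
    and b: "\<And>x. x \<in> S \<Longrightarrow> \<bar>det (matrix (f' x))\<bar> \<le> B"
  shows "f ` S \<in> lmeasurable" "measure lebesgue (f ` S) \<le> B * measure lebesgue S"
proof -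
  have d': "\<And>x. x \<in> S \<Longrightarrow> (f has_derivative f' x) (at x within S)"
    using d has_derivative_at_withinI by blast
  have i: "(\<lambda>x. \<bar>det (matrix (f' x))\<bar>) integrable_on S"
  proof (rule measurable_bounded_by_integrable_imp_integrable)
    show "(\<lambda>x. \<bar>det (matrix (f' x))\<bar>) \<in> borel_measurable (lebesgue_on S)"
      by (rule borel_measurable_abs[OF borel_measurable_det_Jacobian[OF _ d']]) (use S in auto)
    show "(\<lambda>x. B) integrable_on S" using S by (simp add: integrable_on_const)
  qed (use b S in auto)
  show "f ` S \<in> lmeasurable" "measure lebesgue (f ` S) \<le> B * measure lebesgue S"
    using measurable_bounded_differentiable_image[OF S d' i b]
      measure_bounded_differentiable_image[OF S d' i b] by auto
qed

lemma has_derivative_reindex: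
  assumes "(G has_derivative L) (at x)"
  shows "(reindex \<circ> G \<circ> unreindex has_derivative reindex \<circ> L \<circ> unreindex) (at (reindex x))"
proof -
  have 1: "(unreindex has_derivative unreindex) (at (reindex x))"
    using bounded_linear_imp_has_derivative[OF bounded_linear_unreindex] .
  have 2: "(G has_derivative L) (at (unreindex (reindex x)))" using assms by simp
  have 3: "(G \<circ> unreindex has_derivative L \<circ> unreindex) (at (reindex x))"
    using diff_chain_at[OF 1 2] .
  have 4: "(reindex has_derivative reindex) (at ((G \<circ> unreindex) (reindex x)))"
    using bounded_linear_imp_has_derivative[OF bounded_linear_reindex] .
  show ?thesis using diff_chain_at[OF 3 4] by (simp only: comp_assoc)
qed

text \<open>\<open>G\<close> may cover points several times, so the image is bounded from above
  only. \<open>U\<close> is an open set known to be covered, in the application a ball.\<close>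

lemma vol_le_of_subset_image:
  fixes G :: "real ^ 'n::finite \<Rightarrow> real ^ 'n"
  assumes S: "open S" "bounded S"
    and d: "\<And>x. x \<in> S \<Longrightarrow> (G has_derivative L x) (at x)"
    and b: "\<And>x. x \<in> S \<Longrightarrow> \<bar>det (matrix (L x))\<bar> \<le> B"
    and U: "U \<subseteq> G ` S" "open U"
  shows "vol U \<le> B * vol S"
proof -
  let ?G = "reindex \<circ> G \<circ> unreindex"
  let ?L = "\<lambda>x. reindex \<circ> L (unreindex x) \<circ> unreindex"
  have d': "(?G has_derivative ?L x) (at x)" if "x \<in> reindex ` S" for x
    using that has_derivative_reindex[OF d] by auto
  have b': "\<bar>det (matrix (?L x))\<bar> \<le> B" if "x \<in> reindex ` S" for x
    using that b det_matrix_reindex[OF has_derivative_linear[OF d]] by auto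
  note m = measure_image_le[OF lmeasurable_reindex[OF S] d' b']
  have e: "?G ` reindex ` S = reindex ` G ` S"
    by (simp add: image_comp comp_def)
  have "vol U \<le> measure lebesgue (reindex ` G ` S)"
    unfolding vol_def using m(1)[unfolded e] U open_reindex[OF U(2)]
    by (intro measure_mono_fmeasurable) auto
  also have "\<dots> \<le> B * vol S" using m(2)[unfolded e] by (simp add: vol_def)
  finally show ?thesis .
qed

text \<open>The upper bound applied to the inverse of \<open>G\<close>: the image of
  \<open>S\<close> is open by invariance of domain, and the derivative of the inverse, a right
  inverse of \<open>L x\<close>, has determinant at most \<open>1 / m\<close> in absolute
  value.\<close>

lemma vol_ge_of_inj:
  fixes G :: "real ^ 'n::finite \<Rightarrow> real ^ 'n"
  assumes S: "open S"
    and d: "\<And>x. x \<in> S \<Longrightarrow> (G has_derivative L x) (at x)"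
    and b: "\<And>x. x \<in> S \<Longrightarrow> m \<le> \<bar>det (matrix (L x))\<bar>" and "m > 0"
    and inj: "inj_on G S"
    and W: "G ` S \<subseteq> W" "open W" "bounded W"
  shows "m * vol S \<le> vol W"
proof -
  define h where "h = inv_into S G"
  have h: "h (G x) = x" if "x \<in> S" for x using that inj by (simp add: h_def)
  have cont: "continuous_on S G"
    using d has_derivative_continuous continuous_at_imp_continuous_on by blast
  have oG: "open (G ` S)"
    using invariance_of_domain[OF cont S inj] by simp
  have bG: "bounded (G ` S)" using W bounded_subset by blast
  have inv: "\<exists>L'. linear L' \<and> L x \<circ> L' = id" if "x \<in> S" for x
  proof -
    have l: "linear (L x)" using d[OF that] has_derivative_linear by blast
    have "invertible (matrix (L x))"
      using b[OF that] \<open>m > 0\<close> by (simp add: invertible_det_nz)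
    then obtain A where "matrix (L x) ** A = mat 1" by (auto simp: invertible_def)
    then have "L x (A *v v) = v" for v
      using matrix_vector_mul(2)[OF l] by (metis matrix_vector_mul_assoc matrix_vector_mul_lid)
    then show ?thesis by (intro exI[of _ "(*v) A"]) (auto simp: fun_eq_iff)
  qed
  then obtain L' where L': "\<And>x. x \<in> S \<Longrightarrow> linear (L' x) \<and> L x \<circ> L' x = id" by metis
  have dh: "(h has_derivative L' (h y)) (at y)" if yS: "y \<in> G ` S" for y
  proof -
    obtain x where x: "x \<in> S" "y = G x" using yS by auto
    have "(h has_derivative L' x) (at (G x))"
      using has_derivative_inverse_strong[OF S x(1) cont h d[OF x(1)]] L'[OF x(1)] by auto
    then show ?thesis using x h by simp
  qed
  have bh: "\<bar>det (matrix (L' (h y)))\<bar> \<le> 1 / m" if yS: "y \<in> G ` S" for y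
  proof -
    obtain x where x: "x \<in> S" "y = G x" using yS by auto
    have l: "linear (L x)" using d[OF x(1)] has_derivative_linear by blast
    have "det (matrix (L x)) * det (matrix (L' x)) = det (matrix (L x \<circ> L' x))"
      using L'[OF x(1)] l det_mul matrix_compose by metis
    then have "\<bar>det (matrix (L x))\<bar> * \<bar>det (matrix (L' x))\<bar> = 1"
      using L'[OF x(1)] by (simp flip: abs_mult add: matrix_id)
    moreover have "m * \<bar>det (matrix (L' x))\<bar> \<le> \<bar>det (matrix (L x))\<bar> * \<bar>det (matrix (L' x))\<bar>"
      using b[OF x(1)] by (intro mult_right_mono) auto
    ultimately show ?thesis using x h \<open>m > 0\<close> by (simp add: field_simps)
  qed
  have "vol S \<le> 1 / m * vol (G ` S)"
    by (rule vol_le_of_subset_image[OF oG bG dh bh]) (use h S in \<open>force+\<close>)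
  also have "\<dots> \<le> 1 / m * vol W"
    using \<open>m > 0\<close> by (intro mult_left_mono vol_mono W oG) auto
  finally show ?thesis using \<open>m > 0\<close> by (simp add: field_simps)
qed

section \<open>Derivatives in charts\<close>

lemma C_on_imp_continuous_on: "C_on k f S \<Longrightarrow> continuous_on S f"
  by (cases k) (auto intro!: differentiable_imp_continuous_on
      simp: differentiable_on_def differentiable_at_withinI)

lemma C_on_differentiable: "C_on k f S \<Longrightarrow> k \<noteq> 0 \<Longrightarrow> x \<in> S \<Longrightarrow> f differentiable (at x)"
  by (cases k) auto

lemma C_on_derivative_continuous:
  "C_on k f S \<Longrightarrow> k \<noteq> 0 \<Longrightarrow> continuous_on S (\<lambda>x. frechet_derivative f (at x) v)"
  by (cases k) (auto intro: C_on_imp_continuous_on)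

text \<open>A relation rather than a value, so that differentiability is part of it. With
  \<open>F = id\<close> it is the derivative of the change of coordinates, and one chain rule serves
  maps, transitions and mixtures of them.\<close>

definition chart_deriv ::
    "('m, 'n::finite) chart \<Rightarrow> ('m, 'n) chart \<Rightarrow> ('m \<Rightarrow> 'm) \<Rightarrow> 'm \<Rightarrow> (real ^ 'n \<Rightarrow> real ^ 'n) \<Rightarrow> bool" where
  "chart_deriv c c' F x L \<longleftrightarrow> (coord c' \<circ> F \<circ> param c has_derivative L) (at (coord c x))"

lemma chart_deriv_unique: "chart_deriv c c' F x L \<Longrightarrow> chart_deriv c c' F x L' \<Longrightarrow> L = L'"
  unfolding chart_deriv_def using has_derivative_unique by blast

lemma chart_deriv_linear: "chart_deriv c c' F x L \<Longrightarrow> linear L"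
  unfolding chart_deriv_def by (rule has_derivative_linear)

lemma det_matrix_comp:
  fixes L L' :: "real ^ 'n::finite \<Rightarrow> real ^ 'n"
  shows "linear L \<Longrightarrow> linear L' \<Longrightarrow> det (matrix (L' \<circ> L)) = det (matrix L') * det (matrix L)"
  by (simp add: matrix_compose det_mul)

text \<open>Expansion of both arguments in the standard basis. It yields every relation between Gram
  determinants below: for orthonormal frames, for changes of chart and for the Jacobian.\<close>

lemma bilinear_matrix:
  fixes B :: "real ^ 'n::finite \<Rightarrow> real ^ 'n \<Rightarrow> real" and P Q :: "'n \<Rightarrow> real ^ 'n"
  assumes B: "bilinear B"
  shows "(\<chi> i j. B (P i) (Q j)) =
    transpose (\<chi> i j. P j $ i) ** (\<chi> i j. B (axis i 1) (axis j 1)) ** (\<chi> i j. Q j $ i)"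
proof -
  have "B u w = (\<Sum>k\<in>UNIV. \<Sum>l\<in>UNIV. u $ k * (w $ l * B (axis k 1) (axis l 1)))" for u w
  proof -
    have e: "v = (\<Sum>i\<in>UNIV. (v $ i) *\<^sub>R axis i 1)" for v :: "real ^ 'n"
      using basis_expansion[of v] by (simp add: scalar_mult_eq_scaleR)
    have l: "linear (\<lambda>u. B u w)" and r: "\<And>u. linear (B u)" for w
      using B by (auto simp: bilinear_def)
    have "B u w = (\<Sum>k\<in>UNIV. u $ k *\<^sub>R B (axis k 1) w)"
      by (subst e[of u]) (simp add: linear_sum[OF l] linear_cmul[OF l])
    also have "\<dots> = (\<Sum>k\<in>UNIV. u $ k *\<^sub>R (\<Sum>l\<in>UNIV. w $ l *\<^sub>R B (axis k 1) (axis l 1)))"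
      by (subst e[of w]) (simp add: linear_sum[OF r] linear_cmul[OF r])
    finally show ?thesis by (simp add: sum_distrib_left)
  qed
  note 1 = this
  have "B (P i) (Q j) = (\<Sum>l\<in>UNIV. (\<Sum>k\<in>UNIV. P i $ k * B (axis k 1) (axis l 1)) * Q j $ l)" for i j
    unfolding 1[of "P i" "Q j"] by (subst sum.swap) (simp add: sum_distrib_right sum_distrib_left mult_ac)
  then show ?thesis
    by (simp only: vec_eq_iff matrix_matrix_mult_def transpose_def vec_lambda_beta) simp
qed

section \<open>Changes of chart and tangent vectors\<close>

context riemannian_manifold
begin

lemma chart_at: "chart_at A x \<in> A" "x \<in> cdom (chart_at A x)"
proof -
  have "x \<in> (\<Union>c\<in>A. cdom c)" using cover by simp
  then have "\<exists>c. c \<in> A \<and> x \<in> cdom c" by blast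
  then have "chart_at A x \<in> A \<and> x \<in> cdom (chart_at A x)"
    unfolding chart_at_def by (rule someI_ex)
  then show "chart_at A x \<in> A" "x \<in> cdom (chart_at A x)" by auto
qed

lemma
  assumes "c \<in> A"
  shows open_cdom: "open (cdom c)"
    and open_coord: "open (coord c ` cdom c)"
    and chart_homeo: "homeomorphism (cdom c) (coord c ` cdom c) (coord c) (param c)"
  using charts[OF assms] by (auto simp: is_chart_def)

lemma param_coord: "c \<in> A \<Longrightarrow> x \<in> cdom c \<Longrightarrow> param c (coord c x) = x"
  using chart_homeo by (auto simp: homeomorphism_def)

lemma
  assumes "c \<in> A" "y \<in> coord c ` cdom c"
  shows coord_param: "coord c (param c y) = y" and param_cdom: "param c y \<in> cdom c"
  using chart_homeo[OF assms(1)] assms(2) by (auto simp: homeomorphism_def)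

lemma open_coord_image:
  assumes "c \<in> A" "open S" "S \<subseteq> cdom c"
  shows "open (coord c ` S)"
proof -
  have "coord c ` S = coord c ` cdom c \<inter> param c -` S"
  proof (intro equalityI subsetI)
    fix y assume "y \<in> coord c ` cdom c \<inter> param c -` S"
    then show "y \<in> coord c ` S" using coord_param[OF assms(1), of y] by (metis IntD1 IntD2 image_eqI vimageD)
  next
    fix y assume "y \<in> coord c ` S"
    then show "y \<in> coord c ` cdom c \<inter> param c -` S" using assms by (auto simp: param_coord subset_iff)
  qed
  moreover have "continuous_on (coord c ` cdom c) (param c)"
    using chart_homeo[OF assms(1)] by (simp add: homeomorphism_def)
  ultimately show ?thesis
    using continuous_open_preimage[OF _ open_coord[OF assms(1)] assms(2)] by metis
qed

lemma open_param_image: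
  assumes "c \<in> A" "open S" "S \<subseteq> coord c ` cdom c"
  shows "open (param c ` S)"
proof -
  have "param c ` S = cdom c \<inter> coord c -` S"
  proof (intro equalityI subsetI)
    fix x assume "x \<in> cdom c \<inter> coord c -` S"
    then show "x \<in> param c ` S" using param_coord[OF assms(1), of x] by (metis IntD1 IntD2 image_eqI vimageD)
  next
    fix x assume "x \<in> param c ` S"
    then show "x \<in> cdom c \<inter> coord c -` S"
      using assms coord_param[OF assms(1)] param_cdom[OF assms(1)] by (auto simp: subset_iff)
  qed
  moreover have "continuous_on (cdom c) (coord c)"
    using chart_homeo[OF assms(1)] by (simp add: homeomorphism_def)
  ultimately show ?thesis
    using continuous_open_preimage[OF _ open_cdom[OF assms(1)] assms(2)] by metis
qed

text \<open>The intermediate coordinates cancel only where \<open>F\<close> lands in the domain of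
  \<open>c'\<close>; continuity of \<open>F\<close> makes this an open set around the point, which
  is all that a derivative sees.\<close>

lemma chart_deriv_comp:
  assumes c: "c \<in> A" "c' \<in> A" and F: "continuous_on UNIV F"
    and x: "x \<in> cdom c" "F x \<in> cdom c'"
    and L: "chart_deriv c c' F x L" and L': "chart_deriv c' c'' G (F x) L'"
  shows "chart_deriv c c'' (G \<circ> F) x (L' \<circ> L)"
proof -
  let ?S = "coord c ` (cdom c \<inter> F -` cdom c')"
  have o: "open ?S"
    using F c by (intro open_coord_image open_Int open_cdom open_vimage) auto
  have 0: "(coord c' \<circ> F \<circ> param c) (coord c x) = coord c' (F x)"
    using c x by (simp add: param_coord)
  have 1: "((coord c'' \<circ> G \<circ> param c') \<circ> (coord c' \<circ> F \<circ> param c) has_derivative L' \<circ> L) (at (coord c x))"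
    using L L' 0 unfolding chart_deriv_def by (intro diff_chain_at) auto
  show ?thesis
    unfolding chart_deriv_def
    by (rule has_derivative_transform_within_open[OF 1 o])
      (use c x in \<open>auto simp: param_coord\<close>)
qed

lemma chart_deriv_id: "c \<in> A \<Longrightarrow> x \<in> cdom c \<Longrightarrow> chart_deriv c c id x id"
  unfolding chart_deriv_def
  by (rule has_derivative_transform_within_open[OF has_derivative_id open_coord])
    (auto simp: param_coord)

lemma chart_deriv_transition:
  assumes "c \<in> A" "c' \<in> A" "x \<in> cdom c" "x \<in> cdom c'"
  shows "chart_deriv c c' id x (frechet_derivative (transition c c') (at (coord c x)))"
proof -
  have "C_on 1 (transition c c') (coord c ` (cdom c \<inter> cdom c'))"
    using smooth_transition[OF assms(1,2)] by (simp only: smooth_on_def)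
  then have "transition c c' differentiable (at (coord c x))"
    by (rule C_on_differentiable) (use assms in auto)
  then show ?thesis
    by (simp add: chart_deriv_def transition_def frechet_derivative_works)
qed

lemma chart_deriv_chart_vector:
  "c \<in> A \<Longrightarrow> x \<in> cdom c \<Longrightarrow> chart_deriv c (chart_at A x) id x (chart_vector A c x)"
  using chart_deriv_transition[of c "chart_at A x" x] chart_at[of x]
  by (simp add: chart_vector_def[abs_def])

lemma chart_deriv_inverse:
  assumes c: "c \<in> A" "c' \<in> A" "x \<in> cdom c" "x \<in> cdom c'"
    and "chart_deriv c c' id x L" "chart_deriv c' c id x L'"
  shows "L' \<circ> L = id"
proof -
  have "chart_deriv c c (id \<circ> id) x (L' \<circ> L)"
    using assms by (intro chart_deriv_comp[where c'=c']) (auto simp: continuous_on_id)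
  then show ?thesis
    using chart_deriv_unique chart_deriv_id[OF c(1,3)] by fastforce
qed

lemma linear_chart_vector: "c \<in> A \<Longrightarrow> x \<in> cdom c \<Longrightarrow> linear (chart_vector A c x)"
  by (rule chart_deriv_linear[OF chart_deriv_chart_vector])

lemma chart_vector_comp:
  assumes c: "c \<in> A" "c' \<in> A" "x \<in> cdom c" "x \<in> cdom c'" and L: "chart_deriv c c' id x L"
  shows "chart_vector A c' x (L u) = chart_vector A c x u"
proof -
  have "chart_deriv c (chart_at A x) (id \<circ> id) x (chart_vector A c' x \<circ> L)"
    using assms chart_deriv_chart_vector[of c' x]
    by (intro chart_deriv_comp[where c'=c']) (auto simp: continuous_on_id)
  then show ?thesis
    using chart_deriv_unique chart_deriv_chart_vector[OF c(1,3)] by (metis comp_apply id_comp)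
qed

lemma chart_vector_inverse:
  assumes c: "c \<in> A" "x \<in> cdom c"
  obtains L where "linear L" "L \<circ> chart_vector A c x = id"
  using chart_deriv_transition[of "chart_at A x" c x] chart_at[of x] assms
    chart_deriv_inverse chart_deriv_linear chart_deriv_chart_vector by metis

lemma det_chart_vector: "c \<in> A \<Longrightarrow> x \<in> cdom c \<Longrightarrow> det (matrix (chart_vector A c x)) \<noteq> 0"
proof (rule chart_vector_inverse)
  fix L assume c: "c \<in> A" "x \<in> cdom c" and L: "linear L" "L \<circ> chart_vector A c x = id"
  have "det (matrix L) * det (matrix (chart_vector A c x)) = 1"
    using L linear_chart_vector[OF c] by (simp flip: det_matrix_comp add: matrix_id)
  then show ?thesis by auto
qed

lemma chart_vector_nonzero:
  assumes "c \<in> A" "x \<in> cdom c" "u \<noteq> 0" shows "chart_vector A c x u \<noteq> 0"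
proof (rule chart_vector_inverse[OF assms(1,2)])
  fix L assume L: "linear L" "L \<circ> chart_vector A c x = id"
  then have "L (chart_vector A c x u) = u" by (metis comp_apply id_apply)
  then show ?thesis using assms(3) linear_0[OF L(1)] by auto
qed

lemma C_map_chart_deriv:
  assumes f: "C_map k A f" "k \<noteq> 0" and c: "c \<in> A" "c' \<in> A" "x \<in> cdom c" "f x \<in> cdom c'"
  shows "chart_deriv c c' f x (frechet_derivative (coord c' \<circ> f \<circ> param c) (at (coord c x)))"
proof -
  have "C_on k (coord c' \<circ> f \<circ> param c) (coord c ` (cdom c \<inter> f -` cdom c'))"
    using f c by (auto simp: C_map_def)
  then have "coord c' \<circ> f \<circ> param c differentiable (at (coord c x))"
    by (rule C_on_differentiable) (use c f in auto)
  then show ?thesis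
    by (simp add: chart_deriv_def frechet_derivative_works)
qed

lemma tangent_map_chart_deriv:
  assumes f: "C_map k A f" "k \<noteq> 0"
  shows "chart_deriv (chart_at A x) (chart_at A (f x)) f x (tangent_map A f x)"
  using C_map_chart_deriv[OF f, of "chart_at A x" "chart_at A (f x)" x] chart_at
  by (simp add: tangent_map_def)

text \<open>Both sides are the derivative of \<open>f\<close> read from \<open>c\<close> to the
  chart chosen at \<open>f x\<close>, once through the chart chosen at \<open>x\<close> and once
  through \<open>c'\<close>.\<close>

lemma tangent_map_chart_vector:
  assumes f: "C_map k A f" "k \<noteq> 0" and c: "c \<in> A" "c' \<in> A" "x \<in> cdom c" "f x \<in> cdom c'"
    and L: "chart_deriv c c' f x L"
  shows "tangent_map A f x \<circ> chart_vector A c x = chart_vector A c' (f x) \<circ> L"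
proof -
  have cf: "continuous_on UNIV f" using f by (simp add: C_map_def)
  have "chart_deriv c (chart_at A (f x)) (f \<circ> id) x (tangent_map A f x \<circ> chart_vector A c x)"
    using c chart_at[of x] tangent_map_chart_deriv[OF f, of x] chart_deriv_chart_vector[OF c(1,3)]
    by (intro chart_deriv_comp[where c'="chart_at A x"]) (auto simp: continuous_on_id)
  moreover have "chart_deriv c (chart_at A (f x)) (id \<circ> f) x (chart_vector A c' (f x) \<circ> L)"
    using c L cf chart_deriv_chart_vector[OF c(2,4)]
    by (intro chart_deriv_comp[where c'=c']) auto
  ultimately show ?thesis using chart_deriv_unique by fastforce
qed


section \<open>The Jacobian in charts\<close>

text \<open>Gram-Schmidt, one vector at a time: fewer than \<open>CARD('n)\<close> vectors do not
  span, and a vector outside their span minus its projection can be normalised.\<close>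

lemma ex_orthonormal:
  "m \<le> CARD('n) \<Longrightarrow> \<exists>B. finite B \<and> card B = m \<and> (\<forall>a\<in>B. \<forall>b\<in>B. g x a b = (if a = b then 1 else 0))"
proof (induction m)
  case 0
  show ?case by (rule exI[of _ "{}"]) simp
next
  case (Suc m)
  then obtain B where B: "finite B" "card B = m" "\<And>a b. a \<in> B \<Longrightarrow> b \<in> B \<Longrightarrow> g x a b = (if a = b then 1 else 0)"
    by auto
  have "dim B < CARD('n)" using dim_le_card'[OF B(1)] B(2) Suc.prems by simp
  then have "span B \<noteq> UNIV" using dim_span[of B] by (metis dim_UNIV DIM_cart DIM_real mult_1_right nat_neq_iff)
  then obtain v where v: "v \<notin> span B" by auto
  define w where "w = v - (\<Sum>b\<in>B. g x v b *\<^sub>R b)"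
  have "(\<Sum>b\<in>B. g x v b *\<^sub>R b) \<in> span B" by (intro span_sum span_scale span_base)
  then have "w \<noteq> 0" using v by (auto simp: w_def)
  then have w: "g x w w > 0" by (rule metric_pos)
  note bl = metric_bilinear[of x]
  have lr: "linear (g x u)" for u using bl by (simp add: bilinear_def)
  have wb: "g x w b = 0" if "b \<in> B" for b
  proof -
    have "g x b w = g x b v - (\<Sum>b'\<in>B. g x v b' * g x b b')"
      by (simp add: w_def linear_diff[OF lr] linear_sum[OF lr] linear_cmul[OF lr])
    also have "(\<Sum>b'\<in>B. g x v b' * g x b b') = (\<Sum>b'\<in>B. if b' = b then g x v b' else 0)"
      using B(3) that by (intro sum.cong) auto
    also have "\<dots> = g x v b" using B(1) that by simp
    finally show ?thesis using metric_sym[of x] by auto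
  qed
  define w' where "w' = (1 / sqrt (g x w w)) *\<^sub>R w"
  have w'w': "g x w' w' = 1"
    using w by (simp add: w'_def bilinear_lmul[OF bl] bilinear_rmul[OF bl] field_simps)
  have w'b: "g x w' b = 0" "g x b w' = 0" if "b \<in> B" for b
    using wb[OF that] metric_sym[of x b w'] by (simp_all add: w'_def bilinear_lmul[OF bl])
  have "w' \<notin> B" using w'b w'w' by auto
  then show ?case
    by (intro exI[of _ "insert w' B"]) (use B w'w' w'b in auto)
qed

lemma orthonormal_frame:
  "g x (orthonormal_frame g x i) (orthonormal_frame g x j) = (if i = j then 1 else 0)"
proof -
  obtain B where B: "finite B" "card B = CARD('n)" "\<And>a b. a \<in> B \<Longrightarrow> b \<in> B \<Longrightarrow> g x a b = (if a = b then 1 else 0)"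
    using ex_orthonormal[OF order_refl] by metis
  then obtain h where h: "bij_betw h (UNIV::'n set) B"
    using finite_same_card_bij[of "UNIV::'n set" B] by auto
  have "\<forall>i j. g x (h i) (h j) = (if i = j then 1 else 0)"
    using B(3) h by (auto simp: bij_betw_def inj_eq)
  then have "\<exists>e::'n \<Rightarrow> real ^ 'n. \<forall>i j. g x (e i) (e j) = (if i = j then 1 else 0)" by blast
  then show ?thesis unfolding orthonormal_frame_def by (rule someI2_ex) blast
qed

section \<open>The Riemannian volume density in coordinates\<close>

definition metric_in :: "('m, 'n) chart \<Rightarrow> 'm \<Rightarrow> real ^ 'n \<Rightarrow> real ^ 'n \<Rightarrow> real" where
  "metric_in c x u w = g x (chart_vector A c x u) (chart_vector A c x w)"

definition gram :: "(real ^ 'n \<Rightarrow> real ^ 'n \<Rightarrow> real) \<Rightarrow> real ^ 'n ^ 'n" where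
  "gram B = (\<chi> i j. B (axis i 1) (axis j 1))"

definition vol_density :: "('m, 'n) chart \<Rightarrow> 'm \<Rightarrow> real" where
  "vol_density c x = sqrt (det (gram (metric_in c x)))"

text \<open>By \<open>det_gram_frame\<close> the reciprocal of the square root of
  \<open>det (gram (g x))\<close>; it serves to eliminate the chosen frames from
  \<open>Jac\<close>.\<close>

definition frame_det :: "'m \<Rightarrow> real" where
  "frame_det x = \<bar>det (\<chi> i j. orthonormal_frame g x j $ i)\<bar>"

text \<open>Orthonormality of the frame with matrix \<open>E\<close> says
  \<open>transpose E ** gram (g x) ** E = mat 1\<close>; take determinants.\<close>

lemma det_gram_frame: "det (gram (g x)) * frame_det x ^ 2 = 1" "det (gram (g x)) > 0" "frame_det x > 0"
proof -
  let ?E = "(\<chi> i j. orthonormal_frame g x j $ i) :: real ^ 'n ^ 'n"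
  have "(\<chi> i j. g x (orthonormal_frame g x i) (orthonormal_frame g x j)) = mat 1"
    by (simp add: orthonormal_frame mat_def)
  then have "transpose ?E ** gram (g x) ** ?E = mat 1"
    using bilinear_matrix[OF metric_bilinear, of x "orthonormal_frame g x" "orthonormal_frame g x"]
    by (simp add: gram_def)
  then have "det (transpose ?E ** gram (g x) ** ?E) = 1" by simp
  then have "det ?E * det (gram (g x)) * det ?E = 1"
    by (simp add: det_mul det_transpose)
  then show 1: "det (gram (g x)) * frame_det x ^ 2 = 1"
    by (simp add: frame_det_def power2_eq_square mult_ac flip: abs_mult)
  then have "0 < det (gram (g x)) * frame_det x ^ 2" by simp
  then show "det (gram (g x)) > 0" by (simp add: zero_less_mult_iff not_less)
  show "frame_det x > 0" using 1 by (auto simp: frame_det_def)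
qed

text \<open>Passing from the chosen chart to \<open>c\<close> is a congruence of Gram matrices by
  the matrix of \<open>chart_vector\<close>, which enters the determinant squared.\<close>

lemma vol_density_eq:
  assumes c: "c \<in> A" "x \<in> cdom c"
  shows "vol_density c x * frame_det x = \<bar>det (matrix (chart_vector A c x))\<bar>"
proof -
  let ?V = "matrix (chart_vector A c x)"
  have "gram (metric_in c x) = transpose ?V ** gram (g x) ** ?V"
    using bilinear_matrix[OF metric_bilinear, of x "\<lambda>i. chart_vector A c x (axis i 1)"
        "\<lambda>i. chart_vector A c x (axis i 1)"]
    by (simp add: gram_def metric_in_def matrix_def)
  then have "det (gram (metric_in c x)) = (det ?V)\<^sup>2 * det (gram (g x))"
    by (simp add: det_mul det_transpose power2_eq_square)
  then have "vol_density c x * frame_det x = \<bar>det ?V\<bar> * sqrt (det (gram (g x)) * frame_det x ^ 2)"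
    using det_gram_frame(3)[of x] by (simp add: vol_density_def real_sqrt_mult)
  then show ?thesis by (simp add: det_gram_frame)
qed

lemma vol_density_pos: "c \<in> A \<Longrightarrow> x \<in> cdom c \<Longrightarrow> vol_density c x > 0"
  using vol_density_eq[of c x] det_chart_vector[of c x] det_gram_frame(3)[of x]
  by (metis zero_less_abs_iff zero_less_mult_pos2)

text \<open>Frees the Jacobian from frames and chosen charts: it is the coordinate determinant
  corrected by the densities at the two ends. The product form lets the densities at intermediate
  points of an orbit cancel.\<close>

lemma Jac_density:
  assumes f: "C_map k A f" "k \<noteq> 0" and c: "c \<in> A" "c' \<in> A" "x \<in> cdom c" "f x \<in> cdom c'"
    and L: "chart_deriv c c' f x L"
  shows "Jac A g f x * vol_density c x = \<bar>det (matrix L)\<bar> * vol_density c' (f x)"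
proof -
  let ?D = "tangent_map A f x" and ?e = "orthonormal_frame g x" and ?e' = "orthonormal_frame g (f x)"
  let ?E = "(\<chi> i j. ?e j $ i) :: real ^ 'n ^ 'n" and ?E' = "(\<chi> i j. ?e' j $ i) :: real ^ 'n ^ 'n"
  have lD: "linear ?D" by (rule chart_deriv_linear[OF tangent_map_chart_deriv[OF f]])
  have DE: "(\<chi> i j. ?D (?e j) $ i) = matrix ?D ** ?E"
  proof -
    have "?D (?e j) = matrix ?D *v ?e j" for j
      using matrix_vector_mul(2)[OF lD] by metis
    then show ?thesis by (simp add: vec_eq_iff matrix_matrix_mult_def matrix_vector_mult_def)
  qed
  have "(\<chi> i j. g (f x) (?e' i) (?D (?e j))) = transpose ?E' ** gram (g (f x)) ** (matrix ?D ** ?E)"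
    using bilinear_matrix[OF metric_bilinear, of "f x" ?e' "\<lambda>j. ?D (?e j)"] by (simp add: gram_def DE)
  then have "Jac A g f x = frame_det (f x) * det (gram (g (f x))) * \<bar>det (matrix ?D)\<bar> * frame_det x"
    using det_gram_frame(2)[of "f x"]
    by (simp add: Jac_def det_mul det_transpose abs_mult frame_det_def)
  then have 1: "Jac A g f x * frame_det (f x) = \<bar>det (matrix ?D)\<bar> * frame_det x"
    using det_gram_frame(1)[of "f x"] by (simp add: power2_eq_square mult_ac)
  have "matrix ?D ** matrix (chart_vector A c x) = matrix (chart_vector A c' (f x)) ** matrix L"
    using tangent_map_chart_vector[OF f c L] lD chart_deriv_linear[OF L] c
    by (metis linear_chart_vector matrix_compose)
  then have 2: "\<bar>det (matrix ?D)\<bar> * (vol_density c x * frame_det x) = \<bar>det (matrix L)\<bar> * (vol_density c' (f x) * frame_det (f x))"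
    using c by (simp add: vol_density_eq) (metis abs_mult det_mul mult.commute)
  have "(Jac A g f x * vol_density c x) * frame_det (f x) = (\<bar>det (matrix L)\<bar> * vol_density c' (f x)) * frame_det (f x)"
    using 1 2 by algebra
  then show ?thesis using det_gram_frame(3)[of "f x"] by simp
qed

section \<open>Continuity of the metric in coordinates and comparison with the Euclidean
  norm\<close>

lemma continuous_metric_in:
  "c \<in> A \<Longrightarrow> continuous_on (coord c ` cdom c) (\<lambda>y. metric_in c (param c y) u w)"
  using metric_smooth[of c u w] by (auto simp: smooth_on_def metric_in_def dest!: spec[of _ 0])

lemma continuous_on_density: "c \<in> A \<Longrightarrow> continuous_on (coord c ` cdom c) (\<lambda>y. vol_density c (param c y))"
  unfolding vol_density_def gram_def det_def
  by (auto intro!: continuous_intros continuous_metric_in)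

lemma metric_in_pos: "c \<in> A \<Longrightarrow> x \<in> cdom c \<Longrightarrow> u \<noteq> 0 \<Longrightarrow> metric_in c x u u > 0"
  by (simp add: metric_in_def metric_pos chart_vector_nonzero)

lemma bilinear_metric_in: "c \<in> A \<Longrightarrow> x \<in> cdom c \<Longrightarrow> bilinear (metric_in c x)"
  using linear_compose[OF linear_chart_vector, of c x "g x _"]
    linear_compose[OF linear_chart_vector, of c x "\<lambda>v. g x v _"] metric_bilinear[of x]
  by (simp add: bilinear_def metric_in_def comp_def)

lemma metric_in_sum:
  assumes "c \<in> A" "x \<in> cdom c"
  shows "metric_in c x u u = (\<Sum>i\<in>UNIV. \<Sum>j\<in>UNIV. u $ i * u $ j * metric_in c x (axis i 1) (axis j 1))"
proof -
  have "metric_in c x u u = (\<chi> i j. metric_in c x u u :: real ^ 'n ^ 'n) $ i $ i" for i by simp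
  have "(\<chi> i j. metric_in c x u u :: real ^ 'n ^ 'n) $ k $ l = (\<Sum>i\<in>UNIV. \<Sum>j\<in>UNIV. u $ i * u $ j * metric_in c x (axis i 1) (axis j 1))" for k l :: 'n
    using bilinear_matrix[OF bilinear_metric_in[OF assms], of "\<lambda>_. u" "\<lambda>_. u"]
    by (subst sum.swap) (simp add: vec_eq_iff matrix_matrix_mult_def transpose_def
        sum_distrib_right sum_distrib_left mult_ac)
  then show ?thesis by simp
qed

text \<open>Smoothness of the metric is stated for fixed vectors; expansion in the basis turns it
  into continuity jointly in point and vector, as needed on a product with the unit sphere and along
  curves.\<close>

lemma continuous_metric_in_diag:
  assumes "c \<in> A"
  shows "continuous_on (coord c ` cdom c \<times> UNIV) (\<lambda>(y, u). metric_in c (param c y) u u)"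
proof -
  have "continuous_on (coord c ` cdom c \<times> UNIV) (\<lambda>z. metric_in c (param c (fst z)) (axis i 1) (axis j 1))" for i j
    by (rule continuous_on_compose2[OF continuous_metric_in[OF assms, of "axis i 1" "axis j 1"]])
      (auto intro!: continuous_intros)
  then have "continuous_on (coord c ` cdom c \<times> UNIV) (\<lambda>z. \<Sum>i\<in>UNIV. \<Sum>j\<in>UNIV. snd z $ i * snd z $ j * metric_in c (param c (fst z)) (axis i 1) (axis j 1))"
    by (auto intro!: continuous_intros)
  then show ?thesis
    by (rule continuous_on_eq) (auto simp: metric_in_sum[OF assms param_cdom[OF assms]])
qed

definition norm_in :: "('m, 'n) chart \<Rightarrow> 'm \<Rightarrow> real ^ 'n \<Rightarrow> real" where
  "norm_in c x u = tnorm g x (chart_vector A c x u)"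

lemma norm_in_sqrt: "norm_in c x u = sqrt (metric_in c x u u)"
  by (simp add: norm_in_def tnorm_def metric_in_def)

lemma norm_in_scale: "c \<in> A \<Longrightarrow> x \<in> cdom c \<Longrightarrow> norm_in c x (r *\<^sub>R u) = \<bar>r\<bar> * norm_in c x u"
  using bilinear_metric_in[of c x]
  by (simp add: norm_in_sqrt bilinear_lmul bilinear_rmul real_sqrt_mult flip: mult.assoc power2_eq_square)

text \<open>Extrema over the compact product of \<open>K\<close> with the unit sphere, extended to
  all vectors by homogeneity.\<close>

lemma norm_in_bounds:
  assumes c: "c \<in> A" and K: "compact K" "K \<subseteq> coord c ` cdom c"
  obtains m M where "m > 0" "M > 0"
    "\<And>y u. y \<in> K \<Longrightarrow> m * norm u \<le> norm_in c (param c y) u \<and> norm_in c (param c y) u \<le> M * norm u"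
proof (cases "K = {}")
  case True
  then show ?thesis using that[of 1 1] by auto
next
  case False
  let ?S = "K \<times> sphere (0 :: real ^ 'n) 1" and ?h = "\<lambda>(y, u). norm_in c (param c y) u"
  have comp: "compact ?S" using K by (intro compact_Times) auto
  have "axis undefined 1 \<in> sphere (0 :: real ^ 'n) 1" by simp
  then have ne: "?S \<noteq> {}" using False by blast
  have cont: "continuous_on ?S ?h"
    unfolding norm_in_sqrt case_prod_beta
    using continuous_metric_in_diag[OF c] K
    by (intro continuous_intros) (auto simp: case_prod_beta elim!: continuous_on_subset)
  have pos: "?h z > 0" if zS: "z \<in> ?S" for z
  proof -
    obtain y u where z: "z = (y, u)" "y \<in> K" "norm u = 1" using zS by auto
    then have "u \<noteq> 0" by auto
    then show ?thesis using z K metric_in_pos[OF c param_cdom[OF c]] by (auto simp: norm_in_sqrt)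
  qed
  obtain z1 where z1: "z1 \<in> ?S" "\<And>z. z \<in> ?S \<Longrightarrow> ?h z1 \<le> ?h z"
    using continuous_attains_inf[OF comp ne cont] by blast
  obtain z2 where z2: "z2 \<in> ?S" "\<And>z. z \<in> ?S \<Longrightarrow> ?h z \<le> ?h z2"
    using continuous_attains_sup[OF comp ne cont] by blast
  show ?thesis
  proof (rule that[of "?h z1" "?h z2"])
    fix y :: "real ^ 'n" and u :: "real ^ 'n" assume y: "y \<in> K"
    have p: "param c y \<in> cdom c" using K y param_cdom[OF c] by auto
    show "?h z1 * norm u \<le> norm_in c (param c y) u \<and> norm_in c (param c y) u \<le> ?h z2 * norm u"
    proof (cases "u = 0")
      case True
      then show ?thesis using norm_in_scale[OF c p, of 0 0] by simp
    next
      case False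
      define v where "v = (1 / norm u) *\<^sub>R u"
      have "(y, v) \<in> ?S" using y False by (simp add: v_def)
      then have "?h z1 \<le> ?h (y, v)" "?h (y, v) \<le> ?h z2" using z1 z2 by blast+
      then show ?thesis using False by (simp add: v_def norm_in_scale[OF c p] field_simps)
    qed
  qed (use pos z1 z2 in auto)
qed

end

section \<open>Lengths of curves\<close>

text \<open>Replaces the finite set of break points in \<open>piecewise_C1_curve\<close> by
  concatenation on arbitrary intervals, so that restriction, reparametrisation and lifting of curves
  go by induction.\<close>

inductive pw_C1 :: "('m::topological_space, 'n::finite) chart set \<Rightarrow> (real \<Rightarrow> 'm) \<Rightarrow> real \<Rightarrow> real \<Rightarrow> bool"
  for A \<gamma> where
  base: "a < b \<Longrightarrow> C1_curve_on A \<gamma> a b \<Longrightarrow> pw_C1 A \<gamma> a b"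
| join: "pw_C1 A \<gamma> a m \<Longrightarrow> pw_C1 A \<gamma> m b \<Longrightarrow> pw_C1 A \<gamma> a b"

lemma pw_C1_less: "pw_C1 A \<gamma> a b \<Longrightarrow> a < b"
  by (induction rule: pw_C1.induct) auto

lemma pw_C1_continuous: "pw_C1 A \<gamma> a b \<Longrightarrow> continuous_on {a..b} \<gamma>"
proof (induction rule: pw_C1.induct)
  case (base a b)
  then show ?case by (simp add: C1_curve_on_def)
next
  case (join a m b)
  then have "continuous_on ({a..m} \<union> {m..b}) \<gamma>"
    by (intro continuous_on_closed_Un) auto
  moreover have "{a..m} \<union> {m..b} = {a..b}"
    using join.hyps[THEN pw_C1_less] by auto
  ultimately show ?case by simp
qed

lemma C1_curve_on_subset:
  assumes "C1_curve_on A \<gamma> a b" "a \<le> s" "t \<le> b"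
  shows "C1_curve_on A \<gamma> s t"
  unfolding C1_curve_on_def
proof (intro conjI ballI)
  have sub: "{s..t} \<subseteq> {a..b}" using assms by auto
  show "continuous_on {s..t} \<gamma>"
    using assms(1) continuous_on_subset[OF _ sub, of \<gamma>] unfolding C1_curve_on_def by blast
  fix c assume "c \<in> A"
  then obtain D where D: "continuous_on {t\<in>{a..b}. \<gamma> t \<in> cdom c} D"
    "\<And>t. t\<in>{a..b} \<Longrightarrow> \<gamma> t \<in> cdom c \<Longrightarrow> ((coord c \<circ> \<gamma>) has_vector_derivative D t) (at t within {a..b})"
    using assms(1) by (auto simp: C1_curve_on_def)
  show "\<exists>D. continuous_on {ta \<in> {s..t}. \<gamma> ta \<in> cdom c} D \<and>
       (\<forall>ta\<in>{s..t}. \<gamma> ta \<in> cdom c \<longrightarrow> (coord c \<circ> \<gamma> has_vector_derivative D ta) (at ta within {s..t}))"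
    using sub D by (intro exI[of _ D] conjI)
      (auto elim!: continuous_on_subset intro: has_vector_derivative_within_subset[OF _ sub])
qed

lemma pw_C1_subset: "pw_C1 A \<gamma> a b \<Longrightarrow> a \<le> s \<Longrightarrow> s < t \<Longrightarrow> t \<le> b \<Longrightarrow> pw_C1 A \<gamma> s t"
proof (induction arbitrary: s t rule: pw_C1.induct)
  case (base a b)
  then show ?case using C1_curve_on_subset pw_C1.base by blast
next
  case (join a m b)
  consider "t \<le> m" | "m \<le> s" | "s < m" "m < t" by linarith
  then show ?case
  proof cases
    case 3
    then have "pw_C1 A \<gamma> s m" "pw_C1 A \<gamma> m t" using join by auto
    then show ?thesis by (rule pw_C1.join)
  qed (use join in auto)
qed

lemma C1_curve_on_cong:
  assumes "C1_curve_on A \<gamma> a b" "\<And>t. t \<in> {a..b} \<Longrightarrow> \<gamma>' t = \<gamma> t"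
  shows "C1_curve_on A \<gamma>' a b"
proof -
  have e: "{t \<in> {a..b}. \<gamma>' t \<in> S} = {t \<in> {a..b}. \<gamma> t \<in> S}" for S
    using assms(2) by auto
  have d: "((coord c \<circ> \<gamma>') has_vector_derivative D) (at t within {a..b})"
    if "((coord c \<circ> \<gamma>) has_vector_derivative D) (at t within {a..b})" "t \<in> {a..b}" for c D t
    by (rule has_vector_derivative_transform[OF that(2) _ that(1)]) (simp add: assms(2))
  show ?thesis
    unfolding C1_curve_on_def e
  proof (intro conjI ballI)
    have "continuous_on {a..b} \<gamma>" using assms(1) unfolding C1_curve_on_def by blast
    then show "continuous_on {a..b} \<gamma>'" by (rule continuous_on_eq) (simp add: assms(2))
    fix c assume "c \<in> A"
    then obtain D where D: "continuous_on {t\<in>{a..b}. \<gamma> t \<in> cdom c} D"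
      "\<And>t. t\<in>{a..b} \<Longrightarrow> \<gamma> t \<in> cdom c \<Longrightarrow> ((coord c \<circ> \<gamma>) has_vector_derivative D t) (at t within {a..b})"
      using assms(1) unfolding C1_curve_on_def by blast
    then show "\<exists>D. continuous_on {t\<in>{a..b}. \<gamma> t \<in> cdom c} D \<and>
      (\<forall>t\<in>{a..b}. \<gamma>' t \<in> cdom c \<longrightarrow> ((coord c \<circ> \<gamma>') has_vector_derivative D t) (at t within {a..b}))"
      by (intro exI[of _ D] conjI ballI impI d) (simp_all add: assms(2))
  qed
qed

lemma pw_C1_cong: "pw_C1 A \<gamma> a b \<Longrightarrow> (\<And>t. t \<in> {a..b} \<Longrightarrow> \<gamma>' t = \<gamma> t) \<Longrightarrow> pw_C1 A \<gamma>' a b"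
proof (induction rule: pw_C1.induct)
  case (base a b)
  then show ?case using C1_curve_on_cong pw_C1.base by metis
next
  case (join a m b)
  then show ?case
    by (intro pw_C1.join[of _ _ a m b]) (auto dest!: pw_C1_less)
qed

text \<open>The sign of \<alpha> is left open, so that rescaling and reversal of a curve are both
  covered.\<close>

lemma C1_curve_on_affine:
  assumes C: "C1_curve_on A \<gamma> a b" and "\<alpha> \<noteq> 0"
    and im: "(\<lambda>t. \<alpha> * t + \<beta>) ` {a'..b'} = {a..b}"
  shows "C1_curve_on A (\<lambda>t. \<gamma> (\<alpha> * t + \<beta>)) a' b'"
  unfolding C1_curve_on_def
proof (intro conjI ballI)
  let ?\<theta> = "\<lambda>t. \<alpha> * t + \<beta>"
  have in_ab: "?\<theta> t \<in> {a..b}" if "t \<in> {a'..b'}" for t using that im by blast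
  show "continuous_on {a'..b'} (\<lambda>t. \<gamma> (?\<theta> t))"
    by (rule continuous_on_compose2[of "{a..b}" \<gamma> _ ?\<theta>])
      (use C im in \<open>auto simp: C1_curve_on_def intro!: continuous_intros\<close>)
  fix c assume "c \<in> A"
  then obtain D where D: "continuous_on {t\<in>{a..b}. \<gamma> t \<in> cdom c} D"
    "\<And>t. t\<in>{a..b} \<Longrightarrow> \<gamma> t \<in> cdom c \<Longrightarrow> ((coord c \<circ> \<gamma>) has_vector_derivative D t) (at t within {a..b})"
    using C by (auto simp: C1_curve_on_def)
  show "\<exists>D. continuous_on {t \<in> {a'..b'}. \<gamma> (?\<theta> t) \<in> cdom c} D \<and>
       (\<forall>t\<in>{a'..b'}. \<gamma> (?\<theta> t) \<in> cdom c \<longrightarrow> (coord c \<circ> (\<lambda>t. \<gamma> (?\<theta> t)) has_vector_derivative D t) (at t within {a'..b'}))"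
  proof (intro exI[of _ "\<lambda>t. \<alpha> *\<^sub>R D (?\<theta> t)"] conjI ballI impI)
    have "continuous_on {t \<in> {a'..b'}. \<gamma> (?\<theta> t) \<in> cdom c} (\<lambda>t. D (?\<theta> t))"
      by (rule continuous_on_compose2[OF D(1), of _ ?\<theta>])
        (use in_ab in \<open>auto intro!: continuous_intros\<close>)
    then show "continuous_on {t \<in> {a'..b'}. \<gamma> (?\<theta> t) \<in> cdom c} (\<lambda>t. \<alpha> *\<^sub>R D (?\<theta> t))"
      by (intro continuous_intros)
    fix t assume t: "t \<in> {a'..b'}" "\<gamma> (?\<theta> t) \<in> cdom c"
    have 1: "(?\<theta> has_vector_derivative \<alpha>) (at t within {a'..b'})"
      by (auto intro!: derivative_eq_intros simp: has_vector_derivative_def has_real_derivative_iff_has_vector_derivative[symmetric])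
    have 2: "((coord c \<circ> \<gamma>) has_vector_derivative D (?\<theta> t)) (at (?\<theta> t) within ?\<theta> ` {a'..b'})"
      unfolding im by (rule D(2)) (use t in_ab in auto)
    show "(coord c \<circ> (\<lambda>t. \<gamma> (?\<theta> t)) has_vector_derivative \<alpha> *\<^sub>R D (?\<theta> t)) (at t within {a'..b'})"
      using vector_diff_chain_within[OF 1 2] by (simp add: comp_def)
  qed
qed

lemma pw_C1_affine:
  assumes "\<alpha> > 0"
  shows "pw_C1 A \<gamma> a b \<Longrightarrow> pw_C1 A (\<lambda>t. \<gamma> (\<alpha> * t + \<beta>)) ((a - \<beta>) / \<alpha>) ((b - \<beta>) / \<alpha>)"
proof (induction rule: pw_C1.induct)
  case (base a b)
  have "(\<lambda>t. \<alpha> * t + \<beta>) ` {(a - \<beta>) / \<alpha>..(b - \<beta>) / \<alpha>} = {a..b}"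
    using assms base(1) by (simp add: image_affinity_atLeastAtMost divide_right_mono)
  then show ?case
    using C1_curve_on_affine[OF base(2)] base(1) assms
    by (intro pw_C1.base) (auto simp: divide_strict_right_mono)
qed (rule pw_C1.join)

lemma pw_C1_reverse: "pw_C1 A \<gamma> a b \<Longrightarrow> pw_C1 A (\<lambda>t. \<gamma> (- t)) (- b) (- a)"
proof (induction rule: pw_C1.induct)
  case (base a b)
  have "(\<lambda>t. -1 * t + 0) ` {- b..- a} = {a..b}"
    using image_uminus_atLeastAtMost[of "-b" "-a"] by simp
  then show ?case
    using C1_curve_on_affine[OF base(2), of "-1" 0 "- b" "- a"] base(1)
    by (intro pw_C1.base) auto
qed (rule pw_C1.join)

text \<open>From left to right by induction on the number of break points strictly between two given
  ones, from right to left by uniting the break points of the two halves.\<close>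

lemma piecewise_C1_curve_iff: "piecewise_C1_curve A \<gamma> \<longleftrightarrow> pw_C1 A \<gamma> 0 1"
proof
  assume "piecewise_C1_curve A \<gamma>"
  then obtain S where S': "finite S \<and> {0, 1} \<subseteq> S \<and> S \<subseteq> {0..1} \<and>
      (\<forall>a\<in>S. \<forall>b\<in>S. a < b \<and> {a<..<b} \<inter> S = {} \<longrightarrow> C1_curve_on A \<gamma> a b)"
    unfolding piecewise_C1_curve_def by (rule exE)
  then have S: "finite S" "{0, 1} \<subseteq> S" "S \<subseteq> {0..1}" by simp_all
  have C: "C1_curve_on A \<gamma> a b" if "a \<in> S" "b \<in> S" "a < b" "{a<..<b} \<inter> S = {}" for a b
    using S' that by simp
  have "pw_C1 A \<gamma> a b" if "a \<in> S" "b \<in> S" "a < b" for a b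
    using that
  proof (induction "card ({a<..<b} \<inter> S)" arbitrary: a b rule: less_induct)
    case less
    show ?case
    proof (cases "{a<..<b} \<inter> S = {}")
      case True
      then show ?thesis using less.prems C by (intro pw_C1.base) auto
    next
      case False
      then obtain m where m: "m \<in> S" "a < m" "m < b" by auto
      have "card ({a<..<m} \<inter> S) < card ({a<..<b} \<inter> S)" "card ({m<..<b} \<inter> S) < card ({a<..<b} \<inter> S)"
        using m S(1) by (intro psubset_card_mono; auto)+
      then show ?thesis
        using less m by (intro pw_C1.join[of A \<gamma> a m b]) auto
    qed
  qed
  then show "pw_C1 A \<gamma> 0 1" using S(2) by auto
next
  assume "pw_C1 A \<gamma> 0 1"
  have "\<exists>S. finite S \<and> {a, b} \<subseteq> S \<and> S \<subseteq> {a..b} \<and>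
    (\<forall>u\<in>S. \<forall>v\<in>S. u < v \<and> {u<..<v} \<inter> S = {} \<longrightarrow> C1_curve_on A \<gamma> u v)" if "pw_C1 A \<gamma> a b" for a b
    using that
  proof (induction rule: pw_C1.induct)
    case (base a b)
    then show ?case by (intro exI[of _ "{a, b}"]) auto
  next
    case (join a m b)
    obtain S where S: "finite S" "{a, m} \<subseteq> S" "S \<subseteq> {a..m}"
      "\<And>u v. u \<in> S \<Longrightarrow> v \<in> S \<Longrightarrow> u < v \<Longrightarrow> {u<..<v} \<inter> S = {} \<Longrightarrow> C1_curve_on A \<gamma> u v"
      using join by metis
    obtain S' where S': "finite S'" "{m, b} \<subseteq> S'" "S' \<subseteq> {m..b}"
      "\<And>u v. u \<in> S' \<Longrightarrow> v \<in> S' \<Longrightarrow> u < v \<Longrightarrow> {u<..<v} \<inter> S' = {} \<Longrightarrow> C1_curve_on A \<gamma> u v"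
      using join by metis
    \<comment> \<open>The junction \<open>m\<close> belongs to both sets, so neighbouring points of
      the union lie on the same side of it.\<close>
    have "C1_curve_on A \<gamma> u v" if uv: "u \<in> S \<union> S'" "v \<in> S \<union> S'" "u < v" "{u<..<v} \<inter> (S \<union> S') = {}" for u v
    proof (cases "v \<le> m")
      case True
      have "w \<in> S" if "w \<in> S \<union> S'" "w \<le> m" for w
        using that S(2) S'(3) by (cases "w = m") force+
      moreover have "u \<le> m" using uv True by simp
      ultimately have "u \<in> S" "v \<in> S" using uv True by blast+
      then show ?thesis using S(4) uv by blast
    next
      case False
      have "u \<ge> m" using uv(3,4) False S(2) by force
      have "w \<in> S'" if "w \<in> S \<union> S'" "w \<ge> m" for w
        using that S'(2) S(3) by (cases "w = m") force+
      moreover have "v \<ge> m" using uv \<open>u \<ge> m\<close> by simp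
      ultimately have "u \<in> S'" "v \<in> S'" using uv \<open>u \<ge> m\<close> by blast+
      then show ?thesis using S'(4) uv by blast
    qed
    moreover have "S \<union> S' \<subseteq> {a..b}" using S(3) S'(3) join.hyps[THEN pw_C1_less] by force
    ultimately show ?case using S S' by (intro exI[of _ "S \<union> S'"]) auto
  qed
  from this[OF \<open>pw_C1 A \<gamma> 0 1\<close>] show "piecewise_C1_curve A \<gamma>"
    unfolding piecewise_C1_curve_def by blast
qed

abbreviation coords_differentiable ::
    "('m, 'n::finite) chart set \<Rightarrow> (real \<Rightarrow> 'm) \<Rightarrow> real \<Rightarrow> bool" where
  "coords_differentiable A \<gamma> t \<equiv>
     \<forall>c\<in>A. \<gamma> t \<in> cdom c \<longrightarrow> (\<exists>u. ((coord c \<circ> \<gamma>) has_vector_derivative u) (at t))"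

text \<open>The one-sided velocities of adjacent pieces may disagree at a junction; away from these
  finitely many times, which integrals ignore, they are two-sided.\<close>

lemma pw_C1_derivative:
  assumes "pw_C1 A \<gamma> a b"
  shows "\<exists>S. finite S \<and> (\<forall>t\<in>{a<..<b} - S. coords_differentiable A \<gamma> t)"
  using assms
proof (induction rule: pw_C1.induct)
  case (base a b)
  have "\<exists>u. ((coord c \<circ> \<gamma>) has_vector_derivative u) (at t)"
    if t: "t \<in> {a<..<b}" and c: "c \<in> A" "\<gamma> t \<in> cdom c" for t c
  proof -
    have "t \<in> {a..b}" using t by auto
    then obtain u where "((coord c \<circ> \<gamma>) has_vector_derivative u) (at t within {a..b})"
      using base c unfolding C1_curve_on_def by metis
    moreover have "at t within {a..b} = at t" using t by (intro at_within_interior) auto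
    ultimately show ?thesis by auto
  qed
  then show ?case by (intro exI[of _ "{}"]) blast
next
  case (join a m b)
  obtain S where S: "finite S \<and> (\<forall>t\<in>{a<..<m} - S. coords_differentiable A \<gamma> t)" using join.IH(1) by (rule exE)
  obtain S' where S': "finite S' \<and> (\<forall>t\<in>{m<..<b} - S'. coords_differentiable A \<gamma> t)" using join.IH(2) by (rule exE)
  have "\<exists>u. ((coord c \<circ> \<gamma>) has_vector_derivative u) (at t)"
    if t: "t \<in> {a<..<b} - insert m (S \<union> S')" and c: "c \<in> A" "\<gamma> t \<in> cdom c" for t c
  proof (cases "t < m")
    case True
    then have "t \<in> {a<..<m} - S" using t by auto
    then show ?thesis using S c by blast
  next
    case False
    then have "t \<in> {m<..<b} - S'" using t by auto
    then show ?thesis using S' c by blast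
  qed
  then show ?case using S S' by (intro exI[of _ "insert m (S \<union> S')"] conjI) (simp, blast)
qed

section \<open>Speed and length of curves\<close>

context riemannian_manifold
begin

definition speed :: "(real \<Rightarrow> 'm) \<Rightarrow> real \<Rightarrow> real" where
  "speed \<gamma> t = tnorm g (\<gamma> t) (velocity A \<gamma> t)"

definition curve_len :: "(real \<Rightarrow> 'm) \<Rightarrow> real \<Rightarrow> real \<Rightarrow> real" where
  "curve_len \<gamma> a b = integral {a..b} (speed \<gamma>)"

lemma metric_nonneg: "g x v v \<ge> 0"
  using metric_pos[of v x] bilinear_lzero[OF metric_bilinear, of x v] by (cases "v = 0") auto

lemma speed_nonneg [simp]: "speed \<gamma> t \<ge> 0"
  by (simp add: speed_def tnorm_def metric_nonneg)

lemma norm_in_chart_change: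
  "c \<in> A \<Longrightarrow> c' \<in> A \<Longrightarrow> x \<in> cdom c \<Longrightarrow> x \<in> cdom c' \<Longrightarrow> chart_deriv c c' id x L \<Longrightarrow>
    norm_in c' x (L u) = norm_in c x u"
  by (simp add: norm_in_def chart_vector_comp)

text \<open>Near \<open>t\<close> the curve stays in the domain of \<open>c\<close> by continuity,
  so the chain rule applies in coordinates. \<open>F = id\<close> changes the chart of a velocity,
  \<open>F = f\<close> gives the velocity of the image curve.\<close>

lemma coord_derivative_map:
  assumes c: "c \<in> A" "\<gamma> t \<in> cdom c" and t: "t \<in> S" and cont: "continuous (at t within S) \<gamma>"
    and u: "((coord c \<circ> \<gamma>) has_vector_derivative u) (at t within S)"
    and L: "chart_deriv c c' F (\<gamma> t) L"
  shows "((coord c' \<circ> (F \<circ> \<gamma>)) has_vector_derivative L u) (at t within S)"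
proof -
  have l: "linear L" by (rule chart_deriv_linear[OF L])
  have "((coord c' \<circ> F \<circ> param c) has_derivative L) (at ((coord c \<circ> \<gamma>) t))"
    using L by (simp add: chart_deriv_def)
  then have 1: "((coord c' \<circ> F \<circ> param c) \<circ> (coord c \<circ> \<gamma>) has_derivative L \<circ> (\<lambda>x. x *\<^sub>R u)) (at t within S)"
    using u unfolding has_vector_derivative_def
    by (intro diff_chain_within) (auto intro: has_derivative_at_withinI)
  have "(\<gamma> \<longlongrightarrow> \<gamma> t) (at t within S)" using cont by (simp add: continuous_within)
  then have ev: "\<forall>\<^sub>F s in at t within S. \<gamma> s \<in> cdom c"
    using topological_tendstoD open_cdom c by blast
  have "(coord c' \<circ> (F \<circ> \<gamma>) has_derivative L \<circ> (\<lambda>x. x *\<^sub>R u)) (at t within S)"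
    by (rule has_derivative_transform_eventually[OF 1])
      (use ev c t in \<open>auto simp: param_coord elim!: eventually_mono\<close>)
  moreover have "L \<circ> (\<lambda>x. x *\<^sub>R u) = (\<lambda>x. x *\<^sub>R L u)"
    using linear_cmul[OF l] by auto
  ultimately show ?thesis by (simp add: has_vector_derivative_def)
qed

lemma speed_eq:
  assumes c: "c \<in> A" "\<gamma> t \<in> cdom c" and cont: "continuous (at t) \<gamma>"
    and u: "((coord c \<circ> \<gamma>) has_vector_derivative u) (at t)"
  shows "speed \<gamma> t = norm_in c (\<gamma> t) u"
proof -
  have "((coord (chart_at A (\<gamma> t)) \<circ> (id \<circ> \<gamma>)) has_vector_derivative chart_vector A c (\<gamma> t) u) (at t)"
    by (rule coord_derivative_map[OF c _ cont u chart_deriv_chart_vector[OF c]]) simp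
  then have "velocity A \<gamma> t = chart_vector A c (\<gamma> t) u"
    unfolding velocity_def id_comp by (rule vector_derivative_at)
  then show ?thesis by (simp add: speed_def norm_in_def)
qed

lemma speed_eq_within:
  assumes "c \<in> A" "\<gamma> t \<in> cdom c" "continuous_on {a..b} \<gamma>" "t \<in> {a<..<b}"
    and "((coord c \<circ> \<gamma>) has_vector_derivative u) (at t)"
  shows "speed \<gamma> t = norm_in c (\<gamma> t) u"
proof -
  have "continuous (at t) \<gamma>"
    using continuous_on_subset[OF assms(3), of "{a<..<b}"] assms(4)
    by (simp add: continuous_on_eq_continuous_at greaterThanLessThan_subseteq_atLeastAtMost_iff)
  then show ?thesis using speed_eq assms by blast
qed

text \<open>\<open>speed\<close> reads the velocity in a chart that jumps with the point, which
  hides its continuity. The norm \<sigma> of the one-sided velocity is the same in every chart,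
  hence near each time it can be computed in one fixed chart. At the endpoints \<sigma> and
  \<open>speed\<close> may differ.\<close>

lemma C1_speed_continuous:
  assumes "a < b" and C: "C1_curve_on A \<gamma> a b"
  shows "\<exists>\<sigma>. continuous_on {a..b} \<sigma> \<and> (\<forall>t\<in>{a<..<b}. \<sigma> t = speed \<gamma> t)"
proof -
  have cont: "continuous_on {a..b} \<gamma>" using C by (simp add: C1_curve_on_def)
  have "\<forall>c\<in>A. \<exists>D. continuous_on {t\<in>{a..b}. \<gamma> t \<in> cdom c} D \<and> (\<forall>t\<in>{a..b}. \<gamma> t \<in> cdom c \<longrightarrow>
      ((coord c \<circ> \<gamma>) has_vector_derivative D t) (at t within {a..b}))"
    using C unfolding C1_curve_on_def by (rule conjunct2)
  from bchoice[OF this] obtain D where D': "\<forall>c\<in>A. continuous_on {t\<in>{a..b}. \<gamma> t \<in> cdom c} (D c) \<and>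
      (\<forall>t\<in>{a..b}. \<gamma> t \<in> cdom c \<longrightarrow> ((coord c \<circ> \<gamma>) has_vector_derivative D c t) (at t within {a..b}))"
    by (rule exE)
  have D: "continuous_on {t\<in>{a..b}. \<gamma> t \<in> cdom c} (D c)" if "c \<in> A" for c
    using D' that by blast
  have D2: "((coord c \<circ> \<gamma>) has_vector_derivative D c t) (at t within {a..b})"
    if "c \<in> A" "t \<in> {a..b}" "\<gamma> t \<in> cdom c" for c t
    using D' that by blast
  define ch where "ch t = chart_at A (\<gamma> t)" for t
  define \<sigma> where "\<sigma> t = norm_in (ch t) (\<gamma> t) (D (ch t) t)" for t
  have ch: "ch t \<in> A" "\<gamma> t \<in> cdom (ch t)" for t by (auto simp: ch_def chart_at)
  have \<sigma>: "\<sigma> t = norm_in c (\<gamma> t) (D c t)" if c: "c \<in> A" "t \<in> {a..b}" "\<gamma> t \<in> cdom c" for c t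
  proof -
    let ?L = "frechet_derivative (transition c (ch t)) (at (coord c (\<gamma> t)))"
    have L: "chart_deriv c (ch t) id (\<gamma> t) ?L"
      using chart_deriv_transition c ch by blast
    have "continuous (at t within {a..b}) \<gamma>"
      using cont c by (simp add: continuous_on_eq_continuous_within)
    then have "((coord (ch t) \<circ> (id \<circ> \<gamma>)) has_vector_derivative ?L (D c t)) (at t within {a..b})"
      using coord_derivative_map[OF c(1,3,2) _ D2[OF c] L] by blast
    \<comment> \<open>Derivatives within a nondegenerate interval are unique, which identifies the
      transformed velocity with the one given for the other chart.\<close>
    then have "?L (D c t) = D (ch t) t"
      using vector_derivative_unique_within_closed_interval[of a b t "coord (ch t) \<circ> \<gamma>"] D2[OF ch(1) c(2) ch(2)]
        \<open>a < b\<close> c(2) by (simp add: cbox_interval)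
    then show ?thesis using norm_in_chart_change[OF c(1) ch(1) c(3) ch(2) L, of "D c t"] by (simp add: \<sigma>_def)
  qed
  have "continuous (at t within {a..b}) \<sigma>" if t: "t \<in> {a..b}" for t
  proof -
    let ?c = "ch t" let ?N = "{s \<in> {a..b}. \<gamma> s \<in> cdom ?c}"
    have "openin (top_of_set {a..b}) ({a..b} \<inter> \<gamma> -` cdom ?c)"
      using continuous_openin_preimage_gen[OF cont open_cdom[OF ch(1)]] .
    then obtain O' where O: "open O'" "{a..b} \<inter> \<gamma> -` cdom ?c = {a..b} \<inter> O'"
      by (auto simp: openin_open)
    then have N: "?N = {a..b} \<inter> O'" by blast
    have cont': "continuous_on (cdom ?c) (coord ?c)"
      using chart_homeo[OF ch(1)] by (simp add: homeomorphism_def)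
    have "continuous_on ?N (\<lambda>s. (coord ?c (\<gamma> s), D ?c s))"
      by (intro continuous_on_Pair D ch(1) continuous_on_compose2[OF cont'] continuous_on_subset[OF cont]) auto
    then have "continuous_on ?N (\<lambda>s. metric_in ?c (param ?c (coord ?c (\<gamma> s))) (D ?c s) (D ?c s))"
      using continuous_on_compose2[OF continuous_metric_in_diag[OF ch(1)[of t]], of ?N "\<lambda>s. (coord ?c (\<gamma> s), D ?c s)"]
      by (auto simp: image_subset_iff)
    then have "continuous_on ?N (\<lambda>s. sqrt (metric_in ?c (param ?c (coord ?c (\<gamma> s))) (D ?c s) (D ?c s)))"
      by (intro continuous_intros)
    moreover have "sqrt (metric_in ?c (param ?c (coord ?c (\<gamma> s))) (D ?c s) (D ?c s)) = \<sigma> s" if "s \<in> ?N" for s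
      using that \<sigma>[OF ch(1)[of t], of s] by (simp add: norm_in_sqrt param_coord[OF ch(1)])
    ultimately have "continuous_on ?N \<sigma>" using continuous_on_eq by blast
    then have "continuous (at t within ?N) \<sigma>"
      using t ch by (simp add: continuous_on_eq_continuous_within)
    moreover have "at t within ?N = at t within {a..b}"
      using t ch O N by (intro at_within_nhd[of t O']) auto
    ultimately show ?thesis by simp
  qed
  moreover have "\<sigma> t = speed \<gamma> t" if t: "t \<in> {a<..<b}" for t
  proof -
    have t': "t \<in> {a..b}" and "at t within {a..b} = at t"
      using t by (auto intro!: at_within_interior)
    then have "((coord (ch t) \<circ> \<gamma>) has_vector_derivative D (ch t) t) (at t)"
      using D2[OF ch(1) t' ch(2)] by simp
    then show ?thesis
      using speed_eq_within[OF ch cont t] by (simp add: \<sigma>_def)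
  qed
  ultimately show ?thesis by (intro exI[of _ \<sigma>]) (auto simp: continuous_on_eq_continuous_within)
qed

lemma speed_integrable: "pw_C1 A \<gamma> a b \<Longrightarrow> speed \<gamma> integrable_on {a..b}"
proof (induction rule: pw_C1.induct)
  case (base a b)
  then obtain \<sigma> where \<sigma>: "continuous_on {a..b} \<sigma>" "\<forall>t\<in>{a<..<b}. \<sigma> t = speed \<gamma> t"
    using C1_speed_continuous by blast
  have "\<sigma> integrable_on cbox a b" using \<sigma>(1) by (simp add: integrable_continuous_real)
  then have "speed \<gamma> integrable_on cbox a b"
    using \<sigma>(2) by (intro integrable_spike_interior[of a b "speed \<gamma>" \<sigma>]) auto
  then show ?case by simp
next
  case (join a m b)
  then show ?case
    using Henstock_Kurzweil_Integration.integrable_combine[of a m b "speed \<gamma>"] pw_C1_less by fastforce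
qed

lemma curve_len_nonneg [simp]: "curve_len \<gamma> a b \<ge> 0"
  unfolding curve_len_def
  by (cases "speed \<gamma> integrable_on {a..b}") (auto intro: integral_nonneg simp: not_integrable_integral)

lemma curve_len_combine:
  "pw_C1 A \<gamma> a b \<Longrightarrow> a \<le> m \<Longrightarrow> m \<le> b \<Longrightarrow> curve_len \<gamma> a b = curve_len \<gamma> a m + curve_len \<gamma> m b"
  unfolding curve_len_def using Henstock_Kurzweil_Integration.integral_combine speed_integrable by metis

text \<open>The speed at an interior time depends only on nearby times, and the two endpoints, where
  the velocity of a concatenated curve may differ, form a null set.\<close>

lemma curve_len_cong:
  assumes "\<And>t. t \<in> {a<..<b} \<Longrightarrow> \<gamma>' t = \<gamma> t"
  shows "curve_len \<gamma>' a b = curve_len \<gamma> a b"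
proof -
  have "speed \<gamma>' t = speed \<gamma> t" if t: "t \<in> {a<..<b}" for t
  proof -
    have "((coord c \<circ> \<gamma>') has_vector_derivative D) (at t) \<longleftrightarrow> ((coord c \<circ> \<gamma>) has_vector_derivative D) (at t)"
      for c :: "('m, 'n) chart" and D
      using t assms by (auto elim!: has_vector_derivative_transform_within_open[of _ _ _ "{a<..<b}"])
    then have "velocity A \<gamma>' t = velocity A \<gamma> t"
      using assms t by (simp add: velocity_def vector_derivative_def)
    then show ?thesis using assms t by (simp add: speed_def)
  qed
  then show ?thesis
    unfolding curve_len_def
    by (intro integral_spike[of "{a, b}"]) auto
qed

lemma speed_affine:
  assumes "((coord (chart_at A (\<gamma> (\<alpha> * t + \<beta>))) \<circ> \<gamma>) has_vector_derivative u) (at (\<alpha> * t + \<beta>))"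
  shows "speed (\<lambda>t. \<gamma> (\<alpha> * t + \<beta>)) t = \<bar>\<alpha>\<bar> * speed \<gamma> (\<alpha> * t + \<beta>)"
proof -
  let ?c = "chart_at A (\<gamma> (\<alpha> * t + \<beta>))"
  have 1: "((\<lambda>t. \<alpha> * t + \<beta>) has_vector_derivative \<alpha>) (at t)"
    by (auto intro!: derivative_eq_intros simp: has_real_derivative_iff_has_vector_derivative[symmetric])
  have "(coord ?c \<circ> (\<lambda>t. \<gamma> (\<alpha> * t + \<beta>)) has_vector_derivative \<alpha> *\<^sub>R u) (at t)"
    using vector_diff_chain_at[OF 1 assms] by (simp add: comp_def)
  then have "velocity A (\<lambda>t. \<gamma> (\<alpha> * t + \<beta>)) t = \<alpha> *\<^sub>R velocity A \<gamma> (\<alpha> * t + \<beta>)"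
    using assms by (simp add: velocity_def vector_derivative_at)
  then show ?thesis
    by (simp add: speed_def tnorm_def bilinear_lmul[OF metric_bilinear] bilinear_rmul[OF metric_bilinear]
        real_sqrt_mult flip: mult.assoc)
qed

lemma curve_len_affine:
  assumes pw: "pw_C1 A \<gamma> a b" and "\<alpha> \<noteq> 0" and im: "(\<lambda>t. \<alpha> * t + \<beta>) ` {a'..b'} = {a..b}"
  shows "curve_len (\<lambda>t. \<gamma> (\<alpha> * t + \<beta>)) a' b' = curve_len \<gamma> a b"
proof -
  let ?\<theta> = "\<lambda>t. \<alpha> * t + \<beta>"
  obtain S where S: "finite S" "\<forall>t\<in>{a<..<b} - S. coords_differentiable A \<gamma> t"
    using pw_C1_derivative[OF pw] by blast
  \<comment> \<open>The times at which the speeds are not compared; finite because an affine map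
    with nonzero slope is injective.\<close>
  let ?S = "?\<theta> -` (insert a (insert b S))"
  have fin: "finite ?S"
    using S(1) \<open>\<alpha> \<noteq> 0\<close> by (intro finite_vimageI) (auto simp: inj_def)
  have sp: "speed (\<lambda>t. \<gamma> (?\<theta> t)) t = \<bar>\<alpha>\<bar> * speed \<gamma> (?\<theta> t)" if t: "t \<in> {a'..b'} - ?S" for t
  proof -
    have "?\<theta> t \<in> {a..b}" using t im by blast
    then have "?\<theta> t \<in> {a<..<b} - S" using t by auto
    then show ?thesis using S(2) chart_at speed_affine by blast
  qed
  have "(speed \<gamma> has_integral curve_len \<gamma> a b) (cbox a b)"
    using speed_integrable[OF pw] by (simp add: curve_len_def has_integral_integral)
  from has_integral_affinity[OF this \<open>\<alpha> \<noteq> 0\<close>, of \<beta>]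
  have "((\<lambda>t. speed \<gamma> (?\<theta> t)) has_integral (curve_len \<gamma> a b / \<bar>\<alpha>\<bar>)) ((\<lambda>x. (1 / \<alpha>) * x + - ((1 / \<alpha>) * \<beta>)) ` {a..b})"
    by simp
  also have "(\<lambda>x. (1 / \<alpha>) * x + - ((1 / \<alpha>) * \<beta>)) ` {a..b} = {a'..b'}"
    unfolding im[symmetric] image_image using \<open>\<alpha> \<noteq> 0\<close> by (simp add: field_simps)
  finally have "((\<lambda>t. \<bar>\<alpha>\<bar> * speed \<gamma> (?\<theta> t)) has_integral \<bar>\<alpha>\<bar> * (curve_len \<gamma> a b / \<bar>\<alpha>\<bar>)) {a'..b'}"
    by (rule has_integral_mult_right)
  then have "((\<lambda>t. \<bar>\<alpha>\<bar> * speed \<gamma> (?\<theta> t)) has_integral curve_len \<gamma> a b) {a'..b'}"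
    using \<open>\<alpha> \<noteq> 0\<close> by simp
  then have "(speed (\<lambda>t. \<gamma> (?\<theta> t)) has_integral curve_len \<gamma> a b) {a'..b'}"
    by (rule has_integral_spike_finite[OF fin, rotated]) (use sp in auto)
  then show ?thesis unfolding curve_len_def[of _ a' b'] by (rule integral_unique)
qed

end

section \<open>The Riemannian distance\<close>

text \<open>A finite subcover and the least of its radii: the passage from local to uniform scales
  on the manifold. It is also applied with a volume in the role of the radius.\<close>

lemma compact_uniform_radius:
  fixes P :: "'m::topological_space \<Rightarrow> real \<Rightarrow> bool"
  assumes K: "compact (UNIV :: 'm set)"
    and loc: "\<And>x. \<exists>U r. open U \<and> x \<in> U \<and> r > 0 \<and> (\<forall>y\<in>U. P y r)"
    and anti: "\<And>y r r'. P y r \<Longrightarrow> 0 < r' \<Longrightarrow> r' \<le> r \<Longrightarrow> P y r'"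
  shows "\<exists>r>0. \<forall>y. P y r"
proof -
  obtain U r where U: "\<And>x. open (U x) \<and> x \<in> U x \<and> r x > 0 \<and> (\<forall>y\<in>U x. P y (r x))"
    using loc by metis
  obtain X where X: "finite X" "UNIV \<subseteq> (\<Union>x\<in>X. U x)"
    using compactE_image[OF K, of UNIV U] U by (metis UNIV_I UN_I subsetI)
  \<comment> \<open>Inserting 1 guarantees a minimum over a nonempty set.\<close>
  define \<rho> where "\<rho> = Min (insert 1 (r ` X))"
  have "\<rho> > 0" unfolding \<rho>_def using X(1) U by (subst Min_gr_iff) auto
  moreover have "P y \<rho>" for y
  proof -
    obtain x where x: "x \<in> X" "y \<in> U x" using X(2) by blast
    have "\<rho> \<le> r x" unfolding \<rho>_def using X(1) x(1) by (intro Min_le) auto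
    then show ?thesis using U x \<open>\<rho> > 0\<close> anti by blast
  qed
  ultimately show ?thesis by blast
qed

lemma linear_apply_eq_sum:
  fixes L :: "real ^ 'n::finite \<Rightarrow> 'b::real_vector"
  assumes "linear L"
  shows "L u = (\<Sum>i\<in>UNIV. (u $ i) *\<^sub>R L (axis i 1))"
proof -
  have "L u = L (\<Sum>i\<in>UNIV. (u $ i) *\<^sub>R axis i 1)"
    using basis_expansion[of u] by (simp add: scalar_mult_eq_scaleR)
  then show ?thesis by (simp add: linear_sum[OF assms] linear_cmul[OF assms])
qed

text \<open>In finite dimension continuity on each fixed vector is enough, by expanding the argument
  in the basis. \<open>C_on\<close> gives the continuity of derivatives in just this form.\<close>

lemma continuous_on_apply_linear:
  fixes L :: "'a::topological_space \<Rightarrow> real ^ 'n::finite \<Rightarrow> 'b::real_normed_vector"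
  assumes L: "\<And>y. y \<in> S \<Longrightarrow> linear (L y)" "\<And>v. continuous_on S (\<lambda>y. L y v)"
    and p: "continuous_on T p" "p ` T \<subseteq> S" and u: "continuous_on T u"
  shows "continuous_on T (\<lambda>t. L (p t) (u t))"
proof -
  have "continuous_on T (\<lambda>t. L (p t) v)" for v
    by (rule continuous_on_compose2[OF L(2) p])
  then have "continuous_on T (\<lambda>t. \<Sum>i\<in>UNIV. (u t $ i) *\<^sub>R L (p t) (axis i 1))"
    by (intro continuous_intros u)
  then show ?thesis
    by (rule continuous_on_eq) (use linear_apply_eq_sum[OF L(1)] p(2) in \<open>auto simp: image_subset_iff\<close>)
qed

section \<open>Short curves and coordinate segments\<close>

context riemannian_manifold
begin

lemma continuous_on_coord: "c \<in> A \<Longrightarrow> continuous_on (cdom c) (coord c)"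
  and continuous_on_param: "c \<in> A \<Longrightarrow> continuous_on (coord c ` cdom c) (param c)"
  using chart_homeo by (auto simp: homeomorphism_def)

lemma chart_deriv_transition_continuous:
  assumes "c \<in> A" "c' \<in> A"
  shows "continuous_on (coord c ` (cdom c \<inter> cdom c')) (\<lambda>y. frechet_derivative (transition c c') (at y) v)"
  using smooth_transition[OF assms] C_on_derivative_continuous[of 1] by (simp only: smooth_on_def) blast

text \<open>\<open>C1_curve_on\<close> speaks of all charts, but one is enough: in any other chart
  the velocity is the image of \<open>u\<close> under the derivative of the transition map, which
  varies continuously.\<close>

lemma C1_curve_onI:
  assumes c: "c \<in> A" and cont: "continuous_on {a..b} \<gamma>" and sub: "\<gamma> ` {a..b} \<subseteq> cdom c"
    and u: "continuous_on {a..b} u" "\<And>t. t \<in> {a..b} \<Longrightarrow> ((coord c \<circ> \<gamma>) has_vector_derivative u t) (at t within {a..b})"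
  shows "C1_curve_on A \<gamma> a b"
  unfolding C1_curve_on_def
proof (intro conjI cont ballI)
  fix c' assume c': "c' \<in> A"
  let ?L = "\<lambda>y. frechet_derivative (transition c c') (at y)"
  let ?S = "coord c ` (cdom c \<inter> cdom c')"
  let ?T = "{t \<in> {a..b}. \<gamma> t \<in> cdom c'}"
  have lin: "linear (?L y)" if y: "y \<in> ?S" for y
  proof -
    obtain x where "x \<in> cdom c" "x \<in> cdom c'" "y = coord c x" using y by blast
    then show ?thesis using chart_deriv_linear[OF chart_deriv_transition[OF c c']] by blast
  qed
  have "continuous_on ?T (\<lambda>t. ?L (coord c (\<gamma> t)) (u t))"
  proof (rule continuous_on_apply_linear[OF lin chart_deriv_transition_continuous[OF c c']])
    show "continuous_on ?T (\<lambda>t. coord c (\<gamma> t))"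
      by (rule continuous_on_compose2[OF continuous_on_coord[OF c] continuous_on_subset[OF cont]])
        (use sub in auto)
    show "continuous_on ?T u" by (rule continuous_on_subset[OF u(1)]) auto
    show "(\<lambda>t. coord c (\<gamma> t)) ` ?T \<subseteq> ?S" using sub by blast
  qed
  moreover have "((coord c' \<circ> \<gamma>) has_vector_derivative ?L (coord c (\<gamma> t)) (u t)) (at t within {a..b})"
    if t: "t \<in> {a..b}" "\<gamma> t \<in> cdom c'" for t
  proof -
    have tc: "\<gamma> t \<in> cdom c" using sub t by blast
    have "continuous (at t within {a..b}) \<gamma>"
      using cont t by (simp add: continuous_on_eq_continuous_within)
    from coord_derivative_map[OF c tc t(1) this u(2)[OF t(1)] chart_deriv_transition[OF c c' tc t(2)]]
    show ?thesis unfolding id_comp .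
  qed
  ultimately show "\<exists>D. continuous_on ?T D \<and>
      (\<forall>t\<in>{a..b}. \<gamma> t \<in> cdom c' \<longrightarrow> (coord c' \<circ> \<gamma> has_vector_derivative D t) (at t within {a..b}))"
    by blast
qed

text \<open>A curve that leaves a coordinate ball has to cross its boundary sphere, up to which its length is
  at least a multiple of the coordinate distance.\<close>

lemma short_curve_in_chart:
  assumes c: "c \<in> A" "\<gamma> a \<in> cdom c" and pw: "pw_C1 A \<gamma> a b"
    and r: "r > 0" "cball (coord c (\<gamma> a)) r \<subseteq> coord c ` cdom c"
    and m: "m > 0" "\<And>y u. y \<in> cball (coord c (\<gamma> a)) r \<Longrightarrow> m * norm u \<le> norm_in c (param c y) u"
    and len: "curve_len \<gamma> a b < m * r" and t: "t \<in> {a..b}"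
  shows "\<gamma> t \<in> param c ` ball (coord c (\<gamma> a)) r"
proof (rule ccontr)
  let ?q = "coord c (\<gamma> a)"
  let ?B = "param c ` ball ?q r" and ?K = "param c ` cball ?q r"
  let ?bad = "{a..b} \<inter> \<gamma> -` (- ?B)"
  assume "\<gamma> t \<notin> ?B"
  then have ne: "?bad \<noteq> {}" using t by auto
  have cont: "continuous_on {a..b} \<gamma>" using pw_C1_continuous[OF pw] .
  have "ball ?q r \<subseteq> coord c ` cdom c" using r(2) ball_subset_cball by blast
  then have oB: "open ?B" using c(1) by (intro open_param_image) auto
  then have "closedin (top_of_set {a..b}) ?bad"
    by (intro continuous_closedin_preimage cont) (simp add: closed_def)
  then have cl: "closed ?bad" using closedin_closed_trans closed_atLeastAtMost by blast
  \<comment> \<open>The first time outside the coordinate ball; the infimum is attained because the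
    bad times form a closed set.\<close>
  define s where "s = Inf ?bad"
  have bdd: "bdd_below ?bad" by (rule bdd_belowI[of _ a]) auto
  have s: "s \<in> ?bad" unfolding s_def by (rule closed_contains_Inf[OF ne bdd cl])
  have aB: "\<gamma> a \<in> ?B" using param_coord[OF c] r(1) by (intro image_eqI[of _ _ ?q]) auto
  then have "a < s" using s by (cases "a = s") auto
  have before: "\<gamma> u \<in> ?B" if u: "a \<le> u" "u < s" for u
  proof (rule ccontr)
    assume "\<gamma> u \<notin> ?B"
    then have "u \<in> ?bad" using u s by auto
    then show False using cInf_lower[OF _ bdd, of u] u by (simp add: s_def)
  qed
  have conts: "continuous_on {a..s} \<gamma>" using s by (intro continuous_on_subset[OF cont]) auto
  \<comment> \<open>In a Hausdorff space the compact image of the closed ball is closed, so the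
    limit point \<open>\<gamma> s\<close> is still in the chart and its coordinates can be compared
    with those of the start.\<close>
  have "compact ?K"
    using continuous_on_param[OF c(1)] r(2) by (intro compact_continuous_image continuous_on_subset[of _ "param c" "cball ?q r"]) auto
  then have "closed ?K" by (rule compact_imp_closed)
  then have "closed ({a..s} \<inter> \<gamma> -` ?K)"
    using continuous_closedin_preimage[OF conts] closedin_closed_trans closed_atLeastAtMost by blast
  moreover have "{a..<s} \<subseteq> {a..s} \<inter> \<gamma> -` ?K" using before by force
  ultimately have "closure {a..<s} \<subseteq> {a..s} \<inter> \<gamma> -` ?K" by (rule closure_minimal[rotated])
  then have sub: "\<gamma> u \<in> ?K" if "u \<in> {a..s}" for u using \<open>a < s\<close> that by auto
  have inc: "\<gamma> u \<in> cdom c" "coord c (\<gamma> u) \<in> cball ?q r" if "u \<in> {a..s}" for u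
  proof -
    obtain y where y: "y \<in> cball ?q r" "\<gamma> u = param c y" using sub[OF \<open>u \<in> {a..s}\<close>] by blast
    then have "y \<in> coord c ` cdom c" using r(2) by blast
    then show "\<gamma> u \<in> cdom c" "coord c (\<gamma> u) \<in> cball ?q r"
      using y coord_param[OF c(1)] param_cdom[OF c(1)] by auto
  qed
  have s_ab: "s \<in> {a..s}" using \<open>a < s\<close> by auto
  have far: "norm (coord c (\<gamma> s) - ?q) \<ge> r"
  proof (rule ccontr)
    assume "\<not> ?thesis"
    then have "coord c (\<gamma> s) \<in> ball ?q r" by (simp add: dist_norm norm_minus_commute)
    then have "\<gamma> s \<in> ?B" using param_coord[OF c(1) inc(1)[OF s_ab]] by (metis image_eqI)
    then show False using s by auto
  qed
  have pws: "pw_C1 A \<gamma> a s" using pw_C1_subset[OF pw] \<open>a < s\<close> s by auto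
  obtain S where S: "finite S" "\<forall>t\<in>{a<..<s} - S. coords_differentiable A \<gamma> t"
    using pw_C1_derivative[OF pws] by blast
  define u where "u t = vector_derivative (coord c \<circ> \<gamma>) (at t)" for t
  have u: "((coord c \<circ> \<gamma>) has_vector_derivative u t) (at t)" if t: "t \<in> {a<..<s} - S" for t
  proof -
    have "\<gamma> t \<in> cdom c" using t by (intro inc) auto
    then obtain v where "((coord c \<circ> \<gamma>) has_vector_derivative v) (at t)"
      using S(2) t c(1) by blast
    then show ?thesis unfolding u_def by (metis vector_derivative_at)
  qed
  have contc: "continuous_on {a..s} (coord c \<circ> \<gamma>)"
    unfolding comp_def using inc by (intro continuous_on_compose2[OF continuous_on_coord[OF c(1)] conts]) auto
  have "(u has_integral ((coord c \<circ> \<gamma>) s - (coord c \<circ> \<gamma>) a)) {a..s}"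
    by (rule fundamental_theorem_of_calculus_interior_strong[OF S(1) _ u contc]) (use \<open>a < s\<close> in auto)
  \<comment> \<open>Setting the velocity to 0 at the exceptional times makes the bound by the
    nonnegative speed hold at all times.\<close>
  then have i: "((\<lambda>t. if t \<in> {a<..<s} - S then u t else 0) has_integral ((coord c \<circ> \<gamma>) s - (coord c \<circ> \<gamma>) a)) {a..s}"
    by (rule has_integral_spike_finite[of "insert a (insert s S)", rotated 2]) (use S(1) in auto)
  have "norm ((coord c \<circ> \<gamma>) s - (coord c \<circ> \<gamma>) a) \<le> integral {a..s} (\<lambda>t. speed \<gamma> t / m)"
    unfolding integral_unique[OF i, symmetric]
  proof (rule Henstock_Kurzweil_Integration.integral_norm_bound_integral)
    show "(\<lambda>t. speed \<gamma> t / m) integrable_on {a..s}"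
      using speed_integrable[OF pws] by (rule integrable_on_divide)
    fix t assume t: "t \<in> {a..s}"
    show "norm (if t \<in> {a<..<s} - S then u t else 0) \<le> speed \<gamma> t / m"
    proof (cases "t \<in> {a<..<s} - S")
      case True
      have "speed \<gamma> t = norm_in c (\<gamma> t) (u t)"
        using speed_eq_within[OF c(1) inc(1)[OF t] conts] u[OF True] True by blast
      moreover have "m * norm (u t) \<le> norm_in c (\<gamma> t) (u t)"
        using m(2)[OF inc(2)[OF t]] param_coord[OF c(1) inc(1)[OF t]] by simp
      ultimately show ?thesis using True m(1) by (simp add: field_simps)
    qed (use m(1) in auto)
  qed (use i in blast)
  then have "r \<le> curve_len \<gamma> a s / m"
    using far by (simp add: curve_len_def)
  then have "m * r \<le> curve_len \<gamma> a s" using m(1) by (simp add: field_simps)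
  also have "\<dots> \<le> curve_len \<gamma> a b"
    using curve_len_combine[OF pw, of s] s by simp
  finally show False using len by simp
qed

text \<open>The bound has to be uniform for starting points near \<open>x0\<close>. They are taken
  from a ball of half the radius, so that the ball of radius \<open>R / 2\<close> around each of
  them stays inside the region where the norm comparison with \<open>m\<close> holds.\<close>

lemma short_curves_stay:
  assumes "open U" "x0 \<in> U"
  shows "\<exists>W r. open W \<and> x0 \<in> W \<and> r > 0 \<and>
    (\<forall>\<gamma> a b. pw_C1 A \<gamma> a b \<longrightarrow> \<gamma> a \<in> W \<longrightarrow> curve_len \<gamma> a b < r \<longrightarrow> \<gamma> ` {a..b} \<subseteq> U)"
proof -
  let ?c = "chart_at A x0"
  let ?V = "coord ?c ` (cdom ?c \<inter> U)" and ?p = "coord ?c x0"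
  have c: "?c \<in> A" "x0 \<in> cdom ?c" using chart_at by auto
  have "open ?V" using c assms by (intro open_coord_image) (auto simp: open_cdom)
  then obtain R where R: "R > 0" "cball ?p R \<subseteq> ?V"
    using c assms open_contains_cball by (metis IntI imageI)
  then have sub: "cball ?p R \<subseteq> coord ?c ` cdom ?c" by blast
  obtain m M where m: "m > 0" "\<And>y u. y \<in> cball ?p R \<Longrightarrow> m * norm u \<le> norm_in ?c (param ?c y) u"
    using norm_in_bounds[OF c(1) compact_cball sub] by metis
  let ?W = "param ?c ` ball ?p (R / 2)"
  have sub2: "ball ?p (R / 2) \<subseteq> cball ?p R" using R(1) by auto
  have "open ?W" using c sub sub2 by (intro open_param_image) auto
  moreover have "x0 \<in> ?W" using param_coord[OF c] R(1) by (intro image_eqI[of _ _ ?p]) auto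
  moreover have "\<gamma> ` {a..b} \<subseteq> U"
    if pw: "pw_C1 A \<gamma> a b" and W: "\<gamma> a \<in> ?W" and len: "curve_len \<gamma> a b < m * (R / 2)" for \<gamma> a b
  proof
    fix z assume "z \<in> \<gamma> ` {a..b}"
    then obtain t where t: "t \<in> {a..b}" "z = \<gamma> t" by blast
    obtain q where q: "q \<in> ball ?p (R / 2)" "\<gamma> a = param ?c q" using W by blast
    have "q \<in> coord ?c ` cdom ?c" using q sub sub2 by blast
    then have qa: "coord ?c (\<gamma> a) = q" "\<gamma> a \<in> cdom ?c" using q coord_param[OF c(1)] param_cdom[OF c(1)] by auto
    have sub3: "cball q (R / 2) \<subseteq> cball ?p R"
    proof
      fix y assume "y \<in> cball q (R / 2)"
      then show "y \<in> cball ?p R" using q(1) dist_triangle[of ?p y q] by simp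
    qed
    have "\<gamma> t \<in> param ?c ` ball (coord ?c (\<gamma> a)) (R / 2)"
      by (rule short_curve_in_chart[OF c(1) qa(2) pw _ _ m(1) _ len t(1)])
        (use R(1) sub sub3 m(2) qa in auto)
    then obtain y where "y \<in> cball ?p R" "z = param ?c y" using t sub3 qa ball_subset_cball by blast
    then obtain w where "w \<in> cdom ?c \<inter> U" "y = coord ?c w" "z = param ?c y" using R(2) by blast
    then show "z \<in> U" using param_coord[OF c(1)] by auto
  qed
  ultimately show ?thesis using m(1) R(1)
    by (intro exI[of _ ?W] exI[of _ "m * (R / 2)"]) auto
qed

text \<open>The segment stays in the ball by convexity, and its coordinate velocity is the constant
  \<open>y - p\<close>.\<close>

lemma segment_curve:
  assumes c: "c \<in> A" and R: "cball p R \<subseteq> coord c ` cdom c" "y \<in> cball p R"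
    and M: "\<And>z u. z \<in> cball p R \<Longrightarrow> norm_in c (param c z) u \<le> M * norm u"
  shows "\<exists>\<gamma>. pw_C1 A \<gamma> 0 1 \<and> \<gamma> 0 = param c p \<and> \<gamma> 1 = param c y \<and> curve_len \<gamma> 0 1 \<le> M * norm (y - p)"
proof -
  let ?v = "y - p"
  let ?l = "\<lambda>t. p + t *\<^sub>R ?v"
  define \<gamma> where "\<gamma> t = param c (?l t)" for t
  have l: "?l t \<in> cball p R" if "t \<in> {0..1}" for t
  proof -
    have "norm (t *\<^sub>R ?v) \<le> 1 * norm ?v" using that by (simp add: mult_left_le_one_le)
    then show ?thesis using R(2) by (simp add: dist_norm norm_minus_commute)
  qed
  then have lc: "?l t \<in> coord c ` cdom c" if "t \<in> {0..1}" for t using R(1) that by blast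
  have co: "coord c (\<gamma> t) = ?l t" "\<gamma> t \<in> cdom c" if "t \<in> {0..1}" for t
    using coord_param[OF c lc[OF that]] param_cdom[OF c lc[OF that]] by (auto simp: \<gamma>_def)
  have cont: "continuous_on {0..1} \<gamma>"
    unfolding \<gamma>_def
    by (rule continuous_on_compose2[OF continuous_on_param[OF c]]) (use lc in \<open>auto intro!: continuous_intros\<close>)
  have dl: "(?l has_vector_derivative ?v) (at t within S)" for t S
    by (auto intro!: derivative_eq_intros simp: has_vector_derivative_def)
  have dc: "((coord c \<circ> \<gamma>) has_vector_derivative ?v) (at t within {0..1})" if "t \<in> {0..1}" for t
    by (rule has_vector_derivative_transform[OF that _ dl]) (simp add: co)
  have C1: "C1_curve_on A \<gamma> 0 1"
    by (rule C1_curve_onI[OF c cont _ continuous_on_const dc]) (use co in auto)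
  have pw: "pw_C1 A \<gamma> 0 1" using C1 by (intro pw_C1.base) auto
  have sp: "speed \<gamma> t \<le> M * norm ?v" if t: "t \<in> {0<..<1}" for t
  proof -
    have t': "t \<in> {0..1}" and "at t within {0..1} = at t" using t by (auto intro!: at_within_interior)
    then have "((coord c \<circ> \<gamma>) has_vector_derivative ?v) (at t)" using dc[OF t'] by simp
    then have "speed \<gamma> t = norm_in c (\<gamma> t) ?v"
      by (rule speed_eq_within[OF c co(2)[OF t'] cont t])
    then show ?thesis using M[OF l[OF t']] by (simp add: \<gamma>_def)
  qed
  have "curve_len \<gamma> 0 1 = integral {0<..<1} (speed \<gamma>)"
    by (simp add: curve_len_def integral_open_interval_real)
  also have "\<dots> \<le> integral {0<..<1} (\<lambda>t::real. M * norm ?v)"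
    using speed_integrable[OF pw] sp by (intro integral_le) (auto simp: integrable_on_open_interval_real)
  also have "\<dots> = M * norm ?v" by (subst integral_open_interval_real[symmetric]) simp
  finally show ?thesis using pw by (intro exI[of _ \<gamma>]) (auto simp: \<gamma>_def)
qed

text \<open>Separates the algebra of lengths under reversal and concatenation from the curves, which
  are always renormalised to the unit interval.\<close>

definition linked :: "'m \<Rightarrow> 'm \<Rightarrow> real \<Rightarrow> bool" where
  "linked x y l \<longleftrightarrow> (\<exists>\<gamma>. pw_C1 A \<gamma> 0 1 \<and> \<gamma> 0 = x \<and> \<gamma> 1 = y \<and> curve_len \<gamma> 0 1 = l)"

lemma riemannian_dist_eq: "riemannian_dist A g x y = Inf {l. linked x y l}"
proof -
  have "{curve_length A g \<gamma> |\<gamma>. piecewise_C1_curve A \<gamma> \<and> \<gamma> 0 = x \<and> \<gamma> 1 = y} = {l. linked x y l}"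
    by (auto simp: linked_def piecewise_C1_curve_iff curve_length_def curve_len_def speed_def[abs_def])
  then show ?thesis by (simp add: riemannian_dist_def)
qed

lemma linked_nonneg: "linked x y l \<Longrightarrow> l \<ge> 0"
  by (auto simp: linked_def)

lemma pw_C1_linked:
  assumes pw: "pw_C1 A \<gamma> a b"
  shows "linked (\<gamma> a) (\<gamma> b) (curve_len \<gamma> a b)"
proof -
  have ab: "b - a > 0" using pw_C1_less[OF pw] by simp
  have im: "(\<lambda>t. (b - a) * t + a) ` {0..1} = {a..b}"
    using ab by (subst image_affinity_atLeastAtMost) auto
  have "pw_C1 A (\<lambda>t. \<gamma> ((b - a) * t + a)) 0 1"
    using pw_C1_affine[OF ab pw, of a] ab by simp
  moreover have "curve_len (\<lambda>t. \<gamma> ((b - a) * t + a)) 0 1 = curve_len \<gamma> a b"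
    using curve_len_affine[OF pw _ im] ab by simp
  ultimately show ?thesis
    unfolding linked_def by (intro exI[of _ "\<lambda>t. \<gamma> ((b - a) * t + a)"]) auto
qed

lemma linked_sym:
  assumes "linked x y l" shows "linked y x l"
proof -
  obtain \<gamma> where \<gamma>: "pw_C1 A \<gamma> 0 1" "\<gamma> 0 = x" "\<gamma> 1 = y" "curve_len \<gamma> 0 1 = l"
    using assms by (auto simp: linked_def)
  have pw: "pw_C1 A (\<lambda>t. \<gamma> (- t)) (-1) 0" using pw_C1_reverse[OF \<gamma>(1)] by simp
  have "(\<lambda>t. -1 * t + 0) ` {-1..0} = {0..1::real}"
    using image_uminus_atLeastAtMost[of "-1" "0::real"] by simp
  then have "curve_len (\<lambda>t. \<gamma> (- t)) (-1) 0 = l"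
    using curve_len_affine[OF \<gamma>(1), of "-1" 0 "-1" 0] \<gamma>(4) by simp
  then show ?thesis using pw_C1_linked[OF pw] \<gamma> by simp
qed

lemma linked_trans:
  assumes "linked x y l" "linked y z l'" shows "linked x z (l + l')"
proof -
  obtain \<gamma> where \<gamma>: "pw_C1 A \<gamma> 0 1" "\<gamma> 0 = x" "\<gamma> 1 = y" "curve_len \<gamma> 0 1 = l"
    using assms(1) by (auto simp: linked_def)
  obtain \<gamma>' where \<gamma>': "pw_C1 A \<gamma>' 0 1" "\<gamma>' 0 = y" "\<gamma>' 1 = z" "curve_len \<gamma>' 0 1 = l'"
    using assms(2) by (auto simp: linked_def)
  \<comment> \<open>The concatenation runs over \<open>{0..2}\<close>; \<open>pw_C1_linked\<close>
    brings it back to the unit interval.\<close>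
  define \<delta> where "\<delta> t = (if t \<le> 1 then \<gamma> t else \<gamma>' (t + -1))" for t
  have d1: "\<delta> t = \<gamma> t" if "t \<in> {0..1}" for t using that by (simp add: \<delta>_def)
  have d2: "\<delta> t = \<gamma>' (t + -1)" if "t \<in> {1..2}" for t
  proof (cases "t = 1")
    case True then show ?thesis using \<gamma> \<gamma>' by (simp add: \<delta>_def)
  qed (use that in \<open>auto simp: \<delta>_def\<close>)
  have pw1: "pw_C1 A \<delta> 0 1" by (rule pw_C1_cong[OF \<gamma>(1) d1])
  have pw2': "pw_C1 A (\<lambda>t. \<gamma>' (t + -1)) 1 2" using pw_C1_affine[OF zero_less_one \<gamma>'(1), of "-1"] by simp
  then have pw2: "pw_C1 A \<delta> 1 2" by (rule pw_C1_cong[OF _ d2])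
  have pw: "pw_C1 A \<delta> 0 2" using pw1 pw2 by (rule pw_C1.join)
  have "(\<lambda>t. 1 * t + -1) ` {1..2} = {0..1::real}"
    by (subst image_affinity_atLeastAtMost) auto
  then have "curve_len (\<lambda>t. \<gamma>' (t + -1)) 1 2 = l'"
    using curve_len_affine[OF \<gamma>'(1), of 1 "-1" 1 2] \<gamma>'(4) by simp
  moreover have "curve_len \<delta> 1 2 = curve_len (\<lambda>t. \<gamma>' (t + -1)) 1 2"
    by (rule curve_len_cong) (use d2 in auto)
  moreover have "curve_len \<delta> 0 1 = l"
    using curve_len_cong[of 0 1 \<delta> \<gamma>] d1 \<gamma>(4) by simp
  ultimately have "curve_len \<delta> 0 2 = l + l'"
    using curve_len_combine[OF pw, of 1] by simp
  then show ?thesis using pw_C1_linked[OF pw] d1[of 0] d2[of 2] \<gamma> \<gamma>' by simp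
qed

lemma linked_near:
  assumes "e > 0"
  shows "\<exists>W. open W \<and> x \<in> W \<and> (\<forall>y\<in>W. \<exists>l<e. linked x y l)"
proof -
  let ?c = "chart_at A x"
  let ?p = "coord ?c x"
  have c: "?c \<in> A" "x \<in> cdom ?c" using chart_at by auto
  then obtain R where R: "R > 0" "cball ?p R \<subseteq> coord ?c ` cdom ?c"
    using open_coord[OF c(1)] open_contains_cball by (metis imageI)
  obtain m M where M: "M > 0" "\<And>y u. y \<in> cball ?p R \<Longrightarrow> norm_in ?c (param ?c y) u \<le> M * norm u"
    using norm_in_bounds[OF c(1) compact_cball R(2)] by metis
  define r where "r = min R (e / M)"
  have r: "r > 0" "r \<le> R" "r \<le> e / M" using R(1) M(1) assms by (auto simp: r_def)
  let ?W = "param ?c ` ball ?p r"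
  have sub: "ball ?p r \<subseteq> cball ?p R" using r by auto
  have "open ?W" using c sub R by (intro open_param_image) auto
  moreover have "x \<in> ?W" using param_coord[OF c] r(1) by (intro image_eqI[of _ _ ?p]) auto
  moreover have "\<exists>l<e. linked x y l" if "y \<in> ?W" for y
  proof -
    obtain z where z: "z \<in> ball ?p r" "y = param ?c z" using \<open>y \<in> ?W\<close> by blast
    then obtain \<gamma> where \<gamma>: "pw_C1 A \<gamma> 0 1" "\<gamma> 0 = param ?c ?p" "\<gamma> 1 = param ?c z" "curve_len \<gamma> 0 1 \<le> M * norm (z - ?p)"
      using segment_curve[OF c(1) R(2) _ M(2), of z] sub by blast
    have "norm (z - ?p) < e / M" using z(1) r(3) by (simp add: dist_norm norm_minus_commute)
    then have "M * norm (z - ?p) < e" using M(1) by (simp add: field_simps)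
    then show ?thesis
      using \<gamma> z param_coord[OF c] by (intro exI[of _ "curve_len \<gamma> 0 1"]) (auto simp: linked_def)
  qed
  ultimately show ?thesis by blast
qed

end

section \<open>The distance as a metric for the manifold topology\<close>

context closed_connected_oriented_riemannian_manifold
begin

abbreviation rdist :: "'m \<Rightarrow> 'm \<Rightarrow> real" where
  "rdist \<equiv> riemannian_dist A g"

text \<open>Being joined by a curve is an equivalence relation with open classes, so a connected
  space has only one class. This keeps the infimum in the distance from being taken over the empty
  set.\<close>

lemma ex_linked: "\<exists>l. linked x y l"
proof (rule connected_equivalence_relation[OF connected_manifold])
  fix a :: 'm
  obtain W where "open W \<and> a \<in> W \<and> (\<forall>y\<in>W. \<exists>l<1. linked a y l)"
    using linked_near[of 1 a] by auto
  then show "\<exists>T. openin (top_of_set UNIV) T \<and> a \<in> T \<and> (\<forall>x\<in>T. \<exists>l. linked a x l)"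
    by (intro exI[of _ W]) auto
qed (use linked_sym linked_trans in blast)+

lemma rdist_le: "linked x y l \<Longrightarrow> rdist x y \<le> l"
  unfolding riemannian_dist_eq
  by (rule cInf_lower) (auto intro!: bdd_belowI[of _ 0] linked_nonneg)

lemma rdist_less_linked: "rdist x y < r \<Longrightarrow> \<exists>l<r. linked x y l"
  unfolding riemannian_dist_eq using cInf_lessD[of "{l. linked x y l}" r] ex_linked by auto

lemma rdist_nonneg: "rdist x y \<ge> 0"
  unfolding riemannian_dist_eq using ex_linked by (intro cInf_greatest) (auto intro: linked_nonneg)

lemma rdist_sym: "rdist x y = rdist y x"
proof -
  have "{l. linked x y l} = {l. linked y x l}" using linked_sym by auto
  then show ?thesis by (simp add: riemannian_dist_eq)
qed

lemma rdist_triangle: "rdist x z \<le> rdist x y + rdist y z"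
proof (rule field_le_epsilon)
  fix e :: real assume "e > 0"
  obtain l where l: "l < rdist x y + e / 2" "linked x y l"
    using rdist_less_linked[of x y "rdist x y + e / 2"] \<open>e > 0\<close> by auto
  obtain l' where l': "l' < rdist y z + e / 2" "linked y z l'"
    using rdist_less_linked[of y z "rdist y z + e / 2"] \<open>e > 0\<close> by auto
  show "rdist x z \<le> rdist x y + rdist y z + e"
    using rdist_le[OF linked_trans[OF l(2) l'(2)]] l l' by simp
qed

lemma rdist_near: "e > 0 \<Longrightarrow> \<exists>W. open W \<and> x \<in> W \<and> (\<forall>y\<in>W. rdist x y < e)"
  using linked_near[of e x] rdist_le by (metis le_less_trans)

lemma rdist_self [simp]: "rdist x x = 0"
proof (rule antisym[OF _ rdist_nonneg], rule field_le_epsilon)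
  fix e :: real assume "e > 0"
  then show "rdist x x \<le> 0 + e" using rdist_near[of e x] by force
qed

text \<open>A curve from \<open>x\<close> shorter than the radius cannot leave \<open>U\<close>.
  Together with \<open>rdist_near\<close> this makes the distance balls neighbourhood bases of the
  given topology.\<close>

lemma rdist_small:
  assumes "open U" "x \<in> U"
  shows "\<exists>r>0. \<forall>y. rdist x y < r \<longrightarrow> y \<in> U"
proof -
  obtain W r where W: "x \<in> W" "r > 0"
    "\<forall>\<gamma> a b. pw_C1 A \<gamma> a b \<longrightarrow> \<gamma> a \<in> W \<longrightarrow> curve_len \<gamma> a b < r \<longrightarrow> \<gamma> ` {a..b} \<subseteq> U"
    using short_curves_stay[OF assms] by blast
  have "y \<in> U" if xy: "rdist x y < r" for y
  proof -
    obtain \<gamma> where "pw_C1 A \<gamma> 0 1" "\<gamma> 0 = x" "\<gamma> 1 = y" "curve_len \<gamma> 0 1 < r"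
      using rdist_less_linked[OF xy] by (auto simp: linked_def)
    then have "\<gamma> ` {0..1} \<subseteq> U" using W by blast
    then show ?thesis using \<open>\<gamma> 1 = y\<close> by auto
  qed
  then show ?thesis using W(2) by blast
qed

lemma open_rdist_ball: "open {y. rdist x y < r}"
  unfolding open_subopen[of "{y. rdist x y < r}"]
proof (intro ballI)
  fix y assume y: "y \<in> {y. rdist x y < r}"
  then obtain W where W: "open W" "y \<in> W" "\<forall>z\<in>W. rdist y z < r - rdist x y"
    using rdist_near[of "r - rdist x y" y] by auto
  have "rdist x z < r" if "z \<in> W" for z
    using W(3) that rdist_triangle[of x z y] by force
  then show "\<exists>T. open T \<and> y \<in> T \<and> T \<subseteq> {y. rdist x y < r}" using W by blast
qed

text \<open>Half the radius is spent on the centre and half on the point, so that one radius serves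
  all nearby centres, as \<open>compact_uniform_radius\<close> requires.\<close>

lemma rdist_small_nbhd:
  assumes "open U" "x \<in> U"
  shows "\<exists>W r. open W \<and> x \<in> W \<and> r > 0 \<and> (\<forall>y\<in>W. \<forall>z. rdist y z < r \<longrightarrow> z \<in> U)"
proof -
  obtain r where r: "r > 0" "\<And>y. rdist x y < r \<Longrightarrow> y \<in> U" using rdist_small[OF assms] by blast
  have "z \<in> U" if "rdist x y < r / 2" "rdist y z < r / 2" for y z
    using r(2)[of z] rdist_triangle[of x z y] that by simp
  then show ?thesis
    using r(1) open_rdist_ball[of x "r / 2"] by (intro exI[of _ "{y. rdist x y < r / 2}"] exI[of _ "r / 2"]) auto
qed

end

section \<open>Expanding maps\<close>

lemma continuous_on_det:
  fixes M :: "'a::topological_space \<Rightarrow> real ^ 'n::finite ^ 'n"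
  assumes "\<And>i j. continuous_on S (\<lambda>x. M x $ i $ j)"
  shows "continuous_on S (\<lambda>x. det (M x))"
  unfolding det_def by (intro continuous_intros assms)

text \<open>Cramer's rule: the solution may have been chosen pointwise, but as a quotient of
  determinants it is continuous.\<close>

lemma continuous_on_linear_solution:
  fixes M :: "'a::topological_space \<Rightarrow> real ^ 'n::finite ^ 'n"
  assumes M: "\<And>i j. continuous_on S (\<lambda>x. M x $ i $ j)" and nz: "\<And>x. x \<in> S \<Longrightarrow> det (M x) \<noteq> 0"
    and b: "continuous_on S b" and sol: "\<And>x. x \<in> S \<Longrightarrow> M x *v w x = b x"
  shows "continuous_on S w"
proof -
  let ?w = "\<lambda>x. \<chi> k. det (\<chi> i j. if j = k then b x $ i else M x $ i $ j) / det (M x)"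
  have "continuous_on S (\<lambda>x. (\<chi> i j. if j = k then b x $ i else M x $ i $ j) $ i $ j)" for i j k
    using M b by (cases "j = k") (auto intro!: continuous_intros)
  then have "continuous_on S ?w"
    using nz by (intro continuous_on_vec_lambda continuous_on_divide continuous_on_det M) auto
  then show ?thesis
    by (rule continuous_on_eq) (use cramer[OF nz] sol in auto)
qed

text \<open>A one-step condition, because words mix different maps and bounds for the iterates of a
  single map do not combine.\<close>

locale noncontracting_map = closed_connected_oriented_riemannian_manifold A g
  for A :: "('m::t2_space, 'n::finite) chart set" and g :: "'m \<Rightarrow> real ^ 'n \<Rightarrow> real ^ 'n \<Rightarrow> real" +
  fixes k :: nat and f :: "'m \<Rightarrow> 'm"
  assumes C_map_f: "C_map k A f" and k_nonzero: "k \<noteq> 0"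
    and tangent_map_ge: "tnorm g (f x) (tangent_map A f x v) \<ge> tnorm g x v"
begin

lemma continuous_f: "continuous_on UNIV f"
  using C_map_f by (simp add: C_map_def)

lemma open_vimage_f: "open U \<Longrightarrow> open (f -` U)"
  using continuous_f by (rule open_vimage[rotated])

lemmas chart_deriv_f = C_map_chart_deriv[OF C_map_f k_nonzero]

lemma norm_in_ge:
  assumes "c \<in> A" "c' \<in> A" "x \<in> cdom c" "f x \<in> cdom c'" "chart_deriv c c' f x L"
  shows "norm_in c x u \<le> norm_in c' (f x) (L u)"
  using tangent_map_ge[of x "chart_vector A c x u"]
    fun_cong[OF tangent_map_chart_vector[OF C_map_f k_nonzero assms], of u]
  by (simp add: norm_in_def)

text \<open>A nonzero kernel vector would have positive norm and an image of norm 0.\<close>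

lemma det_chart_deriv_f:
  assumes c: "c \<in> A" "c' \<in> A" "x \<in> cdom c" "f x \<in> cdom c'" and L: "chart_deriv c c' f x L"
  shows "det (matrix L) \<noteq> 0"
proof -
  have "u = 0" if "L u = 0" for u
  proof (rule ccontr)
    assume "u \<noteq> 0"
    then have "norm_in c x u > 0" using metric_in_pos c by (simp add: norm_in_sqrt)
    moreover have "norm_in c' (f x) 0 = 0" using norm_in_scale[OF c(2,4), of 0 0] by simp
    ultimately show False using norm_in_ge[OF c L, of u] that by simp
  qed
  then have "inj L" using chart_deriv_linear[OF L] linear_injective_0 by blast
  then show ?thesis
    using chart_deriv_linear[OF L] det_nz_iff_inj by blast
qed

lemma Jac_pos: "Jac A g f x > 0"
proof -
  let ?c = "chart_at A x" and ?c' = "chart_at A (f x)"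
  note L = tangent_map_chart_deriv[OF C_map_f k_nonzero, of x]
  have "Jac A g f x * vol_density ?c x > 0"
    using Jac_density[OF C_map_f k_nonzero chart_at(1) chart_at(1) chart_at(2) chart_at(2) L]
      det_chart_deriv_f[OF chart_at(1) chart_at(1) chart_at(2) chart_at(2) L]
      vol_density_pos[OF chart_at(1) chart_at(2), of "f x"] by simp
  then show ?thesis
    using vol_density_pos[OF chart_at(1) chart_at(2), of x] by (simp add: zero_less_mult_iff)
qed

lemma continuous_derivative_f:
  assumes "c \<in> A" "c' \<in> A"
  shows "continuous_on (coord c ` (cdom c \<inter> f -` cdom c'))
    (\<lambda>y. frechet_derivative (coord c' \<circ> f \<circ> param c) (at y) v)"
  using C_map_f k_nonzero assms by (intro C_on_derivative_continuous) (auto simp: C_map_def)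

text \<open>The frames and charts in \<open>Jac\<close> are chosen pointwise without any continuity.
  Near \<open>x0\<close> the formula of \<open>Jac_density\<close> in two fixed charts expresses it
  by continuous functions.\<close>

lemma continuous_Jac: "continuous_on UNIV (Jac A g f)"
proof (rule continuous_at_imp_continuous_on, rule ballI)
  fix x0
  let ?c = "chart_at A x0" and ?c' = "chart_at A (f x0)"
  have c: "?c \<in> A" "?c' \<in> A" "x0 \<in> cdom ?c" "f x0 \<in> cdom ?c'" using chart_at by auto
  let ?N = "cdom ?c \<inter> f -` cdom ?c'"
  let ?L = "\<lambda>x. frechet_derivative (coord ?c' \<circ> f \<circ> param ?c) (at (coord ?c x))"
  have oN: "open ?N" using c by (intro open_Int open_vimage_f) (auto simp: open_cdom)
  have cc: "continuous_on ?N (coord ?c)" using continuous_on_subset[OF continuous_on_coord[OF c(1)]] by auto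
  have "continuous_on ?N (\<lambda>x. ?L x v)" for v
    by (rule continuous_on_compose2[OF continuous_derivative_f[OF c(1,2)] cc]) auto
  then have 1: "continuous_on ?N (\<lambda>x. det (matrix (?L x)))"
    by (intro continuous_on_det) (auto simp: matrix_def intro!: continuous_intros)
  have 2: "continuous_on (cdom ch) (\<lambda>x. vol_density ch x)" if "ch \<in> A" for ch
  proof -
    have "continuous_on (cdom ch) (\<lambda>x. vol_density ch (param ch (coord ch x)))"
      by (rule continuous_on_compose2[OF continuous_on_density[OF that] continuous_on_coord[OF that]]) auto
    then show ?thesis by (rule continuous_on_eq) (simp add: param_coord[OF that])
  qed
  have 3: "continuous_on ?N (\<lambda>x. vol_density ?c' (f x))"
    by (rule continuous_on_compose2[OF 2[OF c(2)] continuous_on_subset[OF continuous_f]]) auto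
  have 4: "continuous_on ?N (\<lambda>x. vol_density ?c x)"
    by (rule continuous_on_subset[OF 2[OF c(1)]]) auto
  have nz: "vol_density ?c x \<noteq> 0" if "x \<in> ?N" for x
    using vol_density_pos[OF c(1)] that by fastforce
  have "continuous_on ?N (\<lambda>x. \<bar>det (matrix (?L x))\<bar> * vol_density ?c' (f x) / vol_density ?c x)"
    using 1 3 4 nz by (intro continuous_intros) auto
  moreover have "\<bar>det (matrix (?L x))\<bar> * vol_density ?c' (f x) / vol_density ?c x = Jac A g f x" if "x \<in> ?N" for x
    using Jac_density[OF C_map_f k_nonzero c(1,2) _ _ chart_deriv_f[OF c(1,2)], of x] that nz[OF that]
    by (simp add: field_simps)
  ultimately have "continuous_on ?N (Jac A g f)" by (rule continuous_on_eq)
  then show "isCont (Jac A g f) x0"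
    using oN c by (simp add: continuous_on_eq_continuous_at)
qed

text \<open>The inverse function theorem in charts. The last conclusion is the purpose: curves lift
  through \<open>h\<close> and become no longer, since \<open>f\<close> does not shrink tangent
  vectors.\<close>

lemma local_inverse:
  obtains U V h where "open U" "x0 \<in> U" "open V" "f ` U = V" "inj_on f U"
    "\<And>x. x \<in> U \<Longrightarrow> h (f x) = x"
    "\<And>\<gamma> a b. pw_C1 A \<gamma> a b \<Longrightarrow> \<gamma> ` {a..b} \<subseteq> V \<Longrightarrow>
      pw_C1 A (h \<circ> \<gamma>) a b \<and> curve_len (h \<circ> \<gamma>) a b \<le> curve_len \<gamma> a b"
proof -
  let ?c = "chart_at A x0" and ?c' = "chart_at A (f x0)"
  have c: "?c \<in> A" "?c' \<in> A" "x0 \<in> cdom ?c" "f x0 \<in> cdom ?c'" using chart_at by auto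
  let ?N = "cdom ?c \<inter> f -` cdom ?c'"
  let ?\<Omega> = "coord ?c ` ?N"
  let ?F = "coord ?c' \<circ> f \<circ> param ?c"
  let ?F' = "\<lambda>y. frechet_derivative ?F (at y)"
  let ?p = "coord ?c x0"
  have oN: "open ?N" using c by (intro open_Int open_vimage_f) (auto simp: open_cdom)
  have o\<Omega>: "open ?\<Omega>" using c oN by (intro open_coord_image) auto
  have F': "chart_deriv ?c ?c' f x (?F' (coord ?c x))" if "x \<in> ?N" for x
    using chart_deriv_f[OF c(1,2)] that by blast
  have dF: "(?F has_derivative ?F' y) (at y)" if "y \<in> ?\<Omega>" for y
    using F' that by (auto simp: chart_deriv_def)
  have detF: "det (matrix (?F' y)) \<noteq> 0" if "y \<in> ?\<Omega>" for y
    using det_chart_deriv_f[OF c(1,2) _ _ F'] that by auto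
  have bl: "bounded_linear (?F' y)" if "y \<in> ?\<Omega>" for y
    using dF[OF that] has_derivative_bounded_linear by blast
  \<comment> \<open>The inverse function theorem asks for a continuous family of bounded linear
    maps; in finite dimension continuity on each vector provides it.\<close>
  define F2 where "F2 y = Blinfun (?F' y)" for y
  have F2: "blinfun_apply (F2 y) = ?F' y" if "y \<in> ?\<Omega>" for y
    using bl[OF that] by (simp add: F2_def bounded_linear_Blinfun_apply)
  have p: "?p \<in> ?\<Omega>" using c by blast
  have contF2: "continuous_on ?\<Omega> F2"
  proof (rule continuous_on_blinfun_componentwise)
    fix i :: "real ^ 'n"
    show "continuous_on ?\<Omega> (\<lambda>y. blinfun_apply (F2 y) i)"
      by (rule continuous_on_eq[OF continuous_derivative_f[OF c(1,2), of i]]) (simp add: F2)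
  qed
  have "inj (?F' ?p)"
    using det_nz_iff_inj[of "?F' ?p"] detF[OF p] bl[OF p] by (simp add: bounded_linear.linear)
  then obtain G0 where G0: "linear G0" "G0 \<circ> ?F' ?p = id"
    using linear_injective_left_inverse[of "?F' ?p"] bl[OF p] bounded_linear.linear by blast
  have "Blinfun G0 o\<^sub>L F2 ?p = id_blinfun"
    using G0 F2[OF p] by (intro blinfun_eqI)
      (simp add: bounded_linear_Blinfun_apply linear_conv_bounded_linear[symmetric] fun_eq_iff)
  then obtain U' V' G G' where IFT: "open U'" "U' \<subseteq> ?\<Omega>" "?p \<in> U'" "open V'" "?F ?p \<in> V'"
    "homeomorphism U' V' ?F G"
    using inverse_function_theorem[OF o\<Omega> _ contF2 p, of ?F] dF F2 by metis
  have FG: "?F ` U' = V'" "G ` V' = U'" "\<And>y. y \<in> U' \<Longrightarrow> G (?F y) = y" "\<And>z. z \<in> V' \<Longrightarrow> ?F (G z) = z"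
    "continuous_on V' G" using IFT(6) by (auto simp: homeomorphism_def)
  define U where "U = param ?c ` U'"
  define h where "h = param ?c \<circ> G \<circ> coord ?c'"
  have U_N: "x \<in> ?N" "coord ?c x \<in> U'" if xU: "x \<in> U" for x
  proof -
    obtain y where y: "y \<in> U'" "x = param ?c y" using xU by (auto simp: U_def)
    then obtain z where "z \<in> ?N" "y = coord ?c z" using IFT(2) by blast
    then show "x \<in> ?N" "coord ?c x \<in> U'" using y param_coord[OF c(1)] by auto
  qed
  have U'_in: "U' \<subseteq> coord ?c ` cdom ?c" using IFT(2) by blast
  have oU: "open U" unfolding U_def by (rule open_param_image[OF c(1) IFT(1) U'_in])
  have x0U: "x0 \<in> U" using IFT(3) param_coord[OF c(1,3)] by (metis U_def imageI)
  have Ff: "?F (coord ?c x) = coord ?c' (f x)" if "x \<in> U" for x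
    using U_N[OF that] param_coord[OF c(1)] by simp
  have hf: "h (f x) = x" if "x \<in> U" for x
    using FG(3)[OF U_N(2)[OF that]] Ff[OF that] U_N[OF that] param_coord[OF c(1)] by (simp add: h_def)
  have inj: "inj_on f U" using hf by (rule inj_on_inverseI)
  have fU: "f x \<in> cdom ?c'" "coord ?c' (f x) \<in> V'" if "x \<in> U" for x
    using U_N[OF that] imageI[OF U_N(2)[OF that], of ?F] unfolding Ff[OF that] FG(1) by auto
  have V'_in: "V' \<subseteq> coord ?c' ` cdom ?c'"
  proof
    fix z assume "z \<in> V'"
    then obtain y where "y \<in> U'" "z = ?F y" using FG(1) by blast
    then have "param ?c y \<in> U" "z = coord ?c' (f (param ?c y))" by (auto simp: U_def)
    then show "z \<in> coord ?c' ` cdom ?c'" using fU by blast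
  qed
  have V_eq: "f ` U = param ?c' ` V'"
  proof (intro equalityI subsetI)
    fix y assume "y \<in> f ` U"
    then obtain x where x: "x \<in> U" "y = f x" by blast
    then have "y = param ?c' (coord ?c' (f x))" using fU(1)[OF x(1)] param_coord[OF c(2)] by simp
    then show "y \<in> param ?c' ` V'" using fU(2)[OF x(1)] by (rule image_eqI)
  next
    fix y assume "y \<in> param ?c' ` V'"
    then obtain z where "z \<in> V'" "y = param ?c' z" by blast
    then obtain w where w: "w \<in> U'" "y = param ?c' (?F w)" using FG(1) by blast
    then have x: "param ?c w \<in> U" "y = param ?c' (coord ?c' (f (param ?c w)))" by (auto simp: U_def)
    then have "y = f (param ?c w)" using param_coord[OF c(2) fU(1)[OF x(1)]] by simp
    then show "y \<in> f ` U" using x(1) by (rule image_eqI)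
  qed
  have oV: "open (f ` U)" unfolding V_eq by (rule open_param_image[OF c(2) IFT(4) V'_in])
  have hV: "h y \<in> U" "f (h y) = y" if "y \<in> f ` U" for y using that hf by auto
  have V_c': "y \<in> cdom ?c'" "coord ?c' y \<in> V'" if "y \<in> f ` U" for y using that fU by auto
  have coh: "coord ?c (h y) = G (coord ?c' y)" if "y \<in> f ` U" for y
  proof -
    have "G (coord ?c' y) \<in> coord ?c ` cdom ?c" using V_c'[OF that] FG(2) U'_in by blast
    then show ?thesis using coord_param[OF c(1)] by (simp add: h_def)
  qed
  have conth: "continuous_on (f ` U) h"
  proof -
    have "continuous_on (f ` U) (\<lambda>y. G (coord ?c' y))"
      by (rule continuous_on_compose2[OF FG(5) continuous_on_subset[OF continuous_on_coord[OF c(2)]]])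
        (use V_c' in auto)
    then have "continuous_on (f ` U) (\<lambda>y. param ?c (G (coord ?c' y)))"
      by (rule continuous_on_compose2[OF continuous_on_param[OF c(1)]]) (use V_c' FG(2) U'_in in blast)
    then show ?thesis by (simp add: h_def comp_def)
  qed
  \<comment> \<open>The inverse is differentiable at every point of \<open>V'\<close>, and any right
    inverse of the derivative of \<open>?F\<close> at the preimage is its derivative.\<close>
  have dG: "(G has_derivative G') (at z)"
    if z: "z \<in> V'" and G': "?F' (G z) \<circ> G' = id" for z G'
  proof -
    have "G z \<in> U'" using z FG(2) by blast
    then show ?thesis
      using has_derivative_inverse_strong_x[OF IFT(1), of G z ?F "?F' (G z)" G'] z FG dF IFT(2,6) G'
      by (auto simp: homeomorphism_def)
  qed
  have lift_C1: "C1_curve_on A (h \<circ> \<gamma>) a b" if C: "C1_curve_on A \<gamma> a b" and V: "\<gamma> ` {a..b} \<subseteq> f ` U" for \<gamma> a b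
  proof -
    have cont: "continuous_on {a..b} \<gamma>" using C unfolding C1_curve_on_def by blast
    have V: "\<gamma> t \<in> f ` U" if "t \<in> {a..b}" for t using V that by blast
    have "\<exists>D. continuous_on {t\<in>{a..b}. \<gamma> t \<in> cdom ?c'} D \<and>
        (\<forall>t\<in>{a..b}. \<gamma> t \<in> cdom ?c' \<longrightarrow> ((coord ?c' \<circ> \<gamma>) has_vector_derivative D t) (at t within {a..b}))"
      using C c(2) unfolding C1_curve_on_def by blast
    moreover have "{t\<in>{a..b}. \<gamma> t \<in> cdom ?c'} = {a..b}" using V V_c' by blast
    ultimately obtain D where D: "continuous_on {a..b} D"
        "\<And>t. t \<in> {a..b} \<Longrightarrow> ((coord ?c' \<circ> \<gamma>) has_vector_derivative D t) (at t within {a..b})"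
      using V V_c' by auto
    let ?q = "\<lambda>t. coord ?c (h (\<gamma> t))"
    have q: "?q t \<in> U'" "?q t \<in> ?\<Omega>" if "t \<in> {a..b}" for t
      using U_N(2)[OF hV(1)[OF V[OF that]]] IFT(2) by auto
    have conthg: "continuous_on {a..b} (h \<circ> \<gamma>)"
      unfolding comp_def by (rule continuous_on_compose2[OF conth cont]) (use V in auto)
    have contq: "continuous_on {a..b} ?q"
      using continuous_on_compose2[OF continuous_on_coord[OF c(1)] conthg] hV(1)[OF V] U_N(1) by (auto simp: image_subset_iff)
    have "\<exists>G'. ?F' y \<circ> G' = id" if "y \<in> ?\<Omega>" for y
    proof -
      have "surj (?F' y)"
        using det_nz_iff_inj[of "?F' y"] detF[OF that] bl[OF that] linear_injective_imp_surjective
        by (metis bounded_linear.linear)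
      then show ?thesis using surj_iff by blast
    qed
    then obtain G' where G': "\<And>y. y \<in> ?\<Omega> \<Longrightarrow> ?F' y \<circ> G' y = id" by metis
    let ?u = "\<lambda>t. G' (?q t) (D t)"
    have Fu: "matrix (?F' (?q t)) *v ?u t = D t" if "t \<in> {a..b}" for t
    proof -
      have "matrix (?F' (?q t)) *v ?u t = ?F' (?q t) (?u t)"
        using matrix_vector_mul(3)[OF bl[OF q(2)[OF that]]] by metis
      then show ?thesis using fun_cong[OF G'[OF q(2)[OF that]], of "D t"] by simp
    qed
    \<comment> \<open>\<open>G'\<close> is a pointwise choice, so the continuity of the lifted
      velocity comes from its solving a linear system with continuous coefficients and nonzero
      determinant.\<close>
    have contu: "continuous_on {a..b} ?u"
    proof (rule continuous_on_linear_solution[OF _ _ D(1) Fu])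
      fix i j
      have "continuous_on {a..b} (\<lambda>t. ?F' (?q t) (axis j 1))"
        by (rule continuous_on_compose2[OF continuous_derivative_f[OF c(1,2)] contq]) (use q in blast)
      then show "continuous_on {a..b} (\<lambda>t. matrix (?F' (?q t)) $ i $ j)"
        by (simp add: matrix_def continuous_on_component)
    qed (use detF q in blast)
    have du: "((coord ?c \<circ> (h \<circ> \<gamma>)) has_vector_derivative ?u t) (at t within {a..b})" if t: "t \<in> {a..b}" for t
    proof -
      let ?z = "(coord ?c' \<circ> \<gamma>) t"
      have z: "?z \<in> V'" "G ?z = ?q t" using V_c'[OF V[OF t]] coh[OF V[OF t]] by auto
      have "(G has_derivative G' (?q t)) (at ?z)"
        using dG[OF z(1), of "G' (?q t)"] G'[OF q(2)[OF t]] z(2) by simp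
      then have 1: "(G \<circ> (coord ?c' \<circ> \<gamma>) has_derivative G' (?q t) \<circ> (\<lambda>s. s *\<^sub>R D t)) (at t within {a..b})"
        using D(2)[OF t] unfolding has_vector_derivative_def
        by (intro diff_chain_within) (auto intro: has_derivative_at_withinI)
      have "linear (G' (?q t))"
        using \<open>(G has_derivative G' (?q t)) (at ?z)\<close> has_derivative_linear by blast
      then have "G' (?q t) \<circ> (\<lambda>s. s *\<^sub>R D t) = (\<lambda>s. s *\<^sub>R ?u t)" by (auto simp: linear_cmul)
      then have "((G \<circ> (coord ?c' \<circ> \<gamma>)) has_vector_derivative ?u t) (at t within {a..b})"
        using 1 by (simp add: has_vector_derivative_def)
      then show ?thesis
        by (rule has_vector_derivative_transform[OF t, rotated]) (use V coh in auto)
    qed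
    have "(h \<circ> \<gamma>) ` {a..b} \<subseteq> cdom ?c" using hV(1)[OF V] U_N(1) by auto
    then show ?thesis using C1_curve_onI[OF c(1) conthg _ contu du] by blast
  qed
  have lift_pw: "\<gamma> ` {a..b} \<subseteq> f ` U \<Longrightarrow> pw_C1 A (h \<circ> \<gamma>) a b" if "pw_C1 A \<gamma> a b" for \<gamma> a b
    using that
  proof (induction rule: pw_C1.induct)
    case (base a b)
    then show ?case using lift_C1[of \<gamma> a b] by (intro pw_C1.base)
  next
    case (join a m b)
    have "{a..m} \<subseteq> {a..b}" "{m..b} \<subseteq> {a..b}" using join.hyps[THEN pw_C1_less] by auto
    then have "\<gamma> ` {a..m} \<subseteq> f ` U" "\<gamma> ` {m..b} \<subseteq> f ` U" using join.prems by blast+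
    then show ?case using join.IH pw_C1.join by blast
  qed
  have lift_len: "curve_len (h \<circ> \<gamma>) a b \<le> curve_len \<gamma> a b"
    if pw: "pw_C1 A \<gamma> a b" and V: "\<gamma> ` {a..b} \<subseteq> f ` U" for \<gamma> a b
  proof -
    let ?\<delta> = "h \<circ> \<gamma>"
    have V: "\<gamma> t \<in> f ` U" if "t \<in> {a..b}" for t using V that by blast
    have pwh: "pw_C1 A ?\<delta> a b" using lift_pw that by blast
    obtain S where S: "finite S" "\<forall>t\<in>{a<..<b} - S. coords_differentiable A ?\<delta> t"
      using pw_C1_derivative[OF pwh] by blast
    \<comment> \<open>\<gamma> is the image of its lift under \<open>f\<close>, so its velocity is
      the image of the velocity of the lift and has at least the same norm.\<close>
    have sp: "speed ?\<delta> t \<le> speed \<gamma> t" if t: "t \<in> {a<..<b} - S" for t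
    proof -
      have t': "t \<in> {a..b}" "t \<in> {a<..<b}" using t by auto
      have x: "?\<delta> t \<in> cdom ?c" "f (?\<delta> t) \<in> cdom ?c'" "f (?\<delta> t) = \<gamma> t"
        using hV[OF V[OF t'(1)]] U_N(1)[OF hV(1)[OF V[OF t'(1)]]] by auto
      obtain u where u: "((coord ?c \<circ> ?\<delta>) has_vector_derivative u) (at t)" using S(2) t c(1) x(1) by blast
      have L: "chart_deriv ?c ?c' f (?\<delta> t) (?F' (coord ?c (?\<delta> t)))" using F' x by blast
      have contd: "continuous (at t) ?\<delta>"
        using continuous_on_interior[OF pw_C1_continuous[OF pwh]] t'(2)
        by (simp only: interior_atLeastAtMost_real)
      have "((coord ?c' \<circ> (f \<circ> ?\<delta>)) has_vector_derivative ?F' (coord ?c (?\<delta> t)) u) (at t)"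
        by (rule coord_derivative_map[OF c(1) x(1) _ contd u L]) simp
      then have "((coord ?c' \<circ> \<gamma>) has_vector_derivative ?F' (coord ?c (?\<delta> t)) u) (at t)"
        by (rule has_vector_derivative_transform_within_open[of _ _ _ "{a<..<b}"])
          (use t'(2) hV(2) V in auto)
      then have "speed \<gamma> t = norm_in ?c' (\<gamma> t) (?F' (coord ?c (?\<delta> t)) u)"
        using speed_eq_within[OF c(2) _ pw_C1_continuous[OF pw] t'(2)] x by simp
      moreover have "speed ?\<delta> t = norm_in ?c (?\<delta> t) u"
        using speed_eq[OF c(1) x(1) contd u] .
      ultimately show ?thesis using norm_in_ge[OF c(1,2) x(1,2) L, of u] x(3) by simp
    qed
    \<comment> \<open>At these times the speed of the lift is replaced by 0, which leaves the
      integral unchanged and makes the comparison hold everywhere.\<close>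
    let ?S = "insert a (insert b S)"
    have "curve_len ?\<delta> a b = integral {a..b} (\<lambda>t. if t \<in> ?S then 0 else speed ?\<delta> t)"
      unfolding curve_len_def by (rule integral_spike[of ?S]) (use S(1) in auto)
    also have "\<dots> \<le> integral {a..b} (speed \<gamma>)"
    proof (rule integral_le)
      show "(\<lambda>t. if t \<in> ?S then 0 else speed ?\<delta> t) integrable_on {a..b}"
        by (rule integrable_spike_finite[of ?S _ _ "speed ?\<delta>"]) (use S(1) speed_integrable[OF pwh] in auto)
    qed (use speed_integrable[OF pw] sp in auto)
    finally show ?thesis by (simp add: curve_len_def)
  qed
  show thesis
    by (rule that[OF oU x0U oV refl inj hf]) (use lift_pw lift_len in blast)+
qed

text \<open>A curve shorter than \<open>r\<close> from \<open>f x\<close> to \<open>z\<close> lifts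
  to a curve from \<open>x\<close> to a preimage of \<open>z\<close> that is no longer. That the
  radii at source and target agree, for every \<open>r\<close> up to the bound, is what allows
  iteration.\<close>

lemma expanding_ball:
  "\<exists>r0>0. \<forall>x r z. r \<le> r0 \<longrightarrow> rdist (f x) z < r \<longrightarrow> (\<exists>y. f y = z \<and> rdist x y < r)"
proof -
  have "\<exists>r0>0. \<forall>x. \<forall>r\<le>r0. \<forall>z. rdist (f x) z < r \<longrightarrow> (\<exists>y. f y = z \<and> rdist x y < r)"
  proof (rule compact_uniform_radius[OF closed_manifold])
    fix x0
    obtain U V h where U: "open U" "x0 \<in> U" "open V" "f ` U = V" "\<And>x. x \<in> U \<Longrightarrow> h (f x) = x"
      and lift: "\<And>\<gamma> a b. pw_C1 A \<gamma> a b \<Longrightarrow> \<gamma> ` {a..b} \<subseteq> V \<Longrightarrow>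
        pw_C1 A (h \<circ> \<gamma>) a b \<and> curve_len (h \<circ> \<gamma>) a b \<le> curve_len \<gamma> a b"
      by (rule local_inverse[of x0]) blast
    obtain W \<rho> where W: "open W" "f x0 \<in> W" "\<rho> > 0"
      and stay: "\<And>\<gamma> a b. pw_C1 A \<gamma> a b \<Longrightarrow> \<gamma> a \<in> W \<Longrightarrow> curve_len \<gamma> a b < \<rho> \<Longrightarrow> \<gamma> ` {a..b} \<subseteq> V"
      using short_curves_stay[of V "f x0"] U by blast
    have "\<exists>y. f y = z \<and> rdist x y < r"
      if x: "x \<in> U" "f x \<in> W" and r: "r \<le> \<rho>" "rdist (f x) z < r" for x r z
    proof -
      obtain \<gamma> where \<gamma>: "pw_C1 A \<gamma> 0 1" "\<gamma> 0 = f x" "\<gamma> 1 = z" "curve_len \<gamma> 0 1 < r"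
        using rdist_less_linked[OF r(2)] by (auto simp: linked_def)
      have sub: "\<gamma> ` {0..1} \<subseteq> V" using stay[OF \<gamma>(1)] \<gamma> x r by simp
      note l = lift[OF \<gamma>(1) sub]
      have "linked x (h z) (curve_len (h \<circ> \<gamma>) 0 1)"
        using l \<gamma> U(5)[OF x(1)] unfolding linked_def by (intro exI[of _ "h \<circ> \<gamma>"]) auto
      then have "rdist x (h z) < r" using rdist_le l \<gamma>(4) by fastforce
      moreover have "z \<in> V" using sub \<gamma>(3) by (metis atLeastAtMost_iff image_subset_iff order_refl zero_le_one)
      then have "f (h z) = z" using U(4,5) by auto
      ultimately show ?thesis by blast
    qed
    then show "\<exists>U r0. open U \<and> x0 \<in> U \<and> r0 > 0 \<and>
      (\<forall>x\<in>U. \<forall>r\<le>r0. \<forall>z. rdist (f x) z < r \<longrightarrow> (\<exists>y. f y = z \<and> rdist x y < r))"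
      using U W open_vimage_f[OF W(1)] by (intro exI[of _ "U \<inter> f -` W"] exI[of _ \<rho>]) auto
  qed auto
  then show ?thesis by blast
qed

lemma locally_injective: "\<exists>r>0. \<forall>x. inj_on f {y. rdist x y < r}"
proof (rule compact_uniform_radius[OF closed_manifold])
  fix x0
  obtain U V and h :: "'m \<Rightarrow> 'm" where U: "open U" "x0 \<in> U" "inj_on f U"
    by (rule local_inverse[of x0]) blast
  then obtain W r where "open W" "x0 \<in> W" "r > 0" "\<forall>y\<in>W. \<forall>z. rdist y z < r \<longrightarrow> z \<in> U"
    using rdist_small_nbhd[OF U(1,2)] by blast
  then show "\<exists>U r. open U \<and> x0 \<in> U \<and> r > 0 \<and> (\<forall>x\<in>U. inj_on f {y. rdist x y < r})"
    using U(3) by (intro exI[of _ W] exI[of _ r]) (auto intro: inj_on_subset[OF U(3)])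
qed (auto elim!: inj_on_subset)

end

context closed_connected_oriented_riemannian_manifold
begin

lemma uniformly_continuous_rdist:
  fixes h :: "'m \<Rightarrow> real"
  assumes h: "continuous_on UNIV h" and "\<eta> > 0"
  shows "\<exists>r>0. \<forall>x y. rdist x y < r \<longrightarrow> \<bar>h x - h y\<bar> \<le> \<eta>"
proof -
  have "\<exists>r>0. \<forall>x. \<forall>y. rdist x y < r \<longrightarrow> \<bar>h x - h y\<bar> \<le> \<eta>"
  proof (rule compact_uniform_radius[OF closed_manifold])
    fix x0
    let ?U = "h -` ball (h x0) (\<eta> / 2)"
    have U: "open ?U" "x0 \<in> ?U" using h \<open>\<eta> > 0\<close> by (auto intro: open_vimage)
    then obtain W r where W: "open W" "x0 \<in> W" "r > 0" "\<forall>y\<in>W. \<forall>z. rdist y z < r \<longrightarrow> z \<in> ?U"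
      using rdist_small_nbhd[OF U] by blast
    have "\<bar>h x - h y\<bar> \<le> \<eta>" if "x \<in> W" "rdist x y < r" for x y
    proof -
      have "x \<in> ?U" "y \<in> ?U" using W that by auto
      then have "\<bar>h x0 - h x\<bar> < \<eta> / 2" "\<bar>h x0 - h y\<bar> < \<eta> / 2" by (auto simp: dist_real_def)
      then show ?thesis by linarith
    qed
    then show "\<exists>U r. open U \<and> x0 \<in> U \<and> r > 0 \<and> (\<forall>x\<in>U. \<forall>y. rdist x y < r \<longrightarrow> \<bar>h x - h y\<bar> \<le> \<eta>)"
      using W by blast
  qed auto
  then show ?thesis by blast
qed

end

section \<open>Volume estimates along orbits\<close>

primrec traj :: "(nat \<Rightarrow> 'a \<Rightarrow> 'a) \<Rightarrow> (nat \<Rightarrow> nat) \<Rightarrow> nat \<Rightarrow> 'a \<Rightarrow> 'a" where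
  "traj f w 0 x = x"
| "traj f w (Suc i) x = f (w i) (traj f w i x)"

lemma traj_Suc_comp: "traj f w (Suc i) = f (w i) \<circ> traj f w i"
  by auto

lemma finite_uniform_radius:
  fixes P :: "'a \<Rightarrow> real \<Rightarrow> bool"
  assumes "finite J" "\<And>j. j \<in> J \<Longrightarrow> \<exists>r>0. P j r"
    and anti: "\<And>j r r'. j \<in> J \<Longrightarrow> P j r \<Longrightarrow> 0 < r' \<Longrightarrow> r' \<le> r \<Longrightarrow> P j r'"
  shows "\<exists>r>0. \<forall>j\<in>J. P j r"
  using assms
proof (induction J rule: finite_induct)
  case empty
  then show ?case by (intro exI[of _ 1]) auto
next
  case (insert j J)
  obtain r where r: "r > 0" "\<forall>j\<in>J. P j r" using insert.IH insert.prems by blast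
  obtain r' where r': "r' > 0" "P j r'" using insert.prems by blast
  have "P i (min r r')" if "i \<in> insert j J" for i
    using insert.prems(2)[OF that, of r "min r r'"] insert.prems(2)[OF that, of r' "min r r'"] r r' that by auto
  then show ?case using r(1) r'(1) by (intro exI[of _ "min r r'"]) auto
qed

section \<open>Finitely many coordinate patches with bounded density\<close>

context closed_connected_oriented_riemannian_manifold
begin

abbreviation rball :: "'m \<Rightarrow> real \<Rightarrow> 'm set" where
  "rball x r \<equiv> {y. rdist x y < r}"

text \<open>On a patch, Lebesgue measure in coordinates and Riemannian volume agree up to a factor
  between \<open>1 / C\<close> and \<open>C\<close>. Boundedness keeps the volumes finite,
  nonemptiness makes them positive.\<close>

definition good_patches :: "(('m, 'n) chart \<times> 'm set) set \<Rightarrow> real \<Rightarrow> bool" where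
  "good_patches I C \<longleftrightarrow> finite I \<and> C > 0 \<and> (\<Union>p\<in>I. snd p) = UNIV \<and>
    (\<forall>(c, W)\<in>I. c \<in> A \<and> open W \<and> W \<noteq> {} \<and> W \<subseteq> cdom c \<and> bounded (coord c ` W) \<and>
      (\<forall>x\<in>W. 1 / C \<le> vol_density c x \<and> vol_density c x \<le> C))"

lemma rball_mono: "r' \<le> r \<Longrightarrow> rball x r' \<subseteq> rball x r"
  by auto

lemma ex_patch:
  "\<exists>c W C. c \<in> A \<and> open W \<and> x \<in> W \<and> W \<subseteq> cdom c \<and> bounded (coord c ` W) \<and> C > 0 \<and>
    (\<forall>x\<in>W. 1 / C \<le> vol_density c x \<and> vol_density c x \<le> C)"
proof -
  let ?c = "chart_at A x"
  let ?p = "coord ?c x"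
  have c: "?c \<in> A" "x \<in> cdom ?c" using chart_at by auto
  then obtain R where R: "R > 0" "cball ?p R \<subseteq> coord ?c ` cdom ?c"
    using open_coord[OF c(1)] open_contains_cball by (metis imageI)
  let ?W = "param ?c ` ball ?p R"
  let ?h = "\<lambda>y. vol_density ?c (param ?c y)"
  have sub: "ball ?p R \<subseteq> coord ?c ` cdom ?c" using R(2) ball_subset_cball by blast
  have cont: "continuous_on (cball ?p R) ?h"
    using continuous_on_subset[OF continuous_on_density[OF c(1)] R(2)] .
  have ne: "cball ?p R \<noteq> {}" using R(1) by simp
  obtain y1 where y1: "y1 \<in> cball ?p R" "\<And>y. y \<in> cball ?p R \<Longrightarrow> ?h y1 \<le> ?h y"
    using continuous_attains_inf[OF compact_cball ne cont] by blast
  obtain y2 where y2: "y2 \<in> cball ?p R" "\<And>y. y \<in> cball ?p R \<Longrightarrow> ?h y \<le> ?h y2"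
    using continuous_attains_sup[OF compact_cball ne cont] by blast
  have pos: "?h y1 > 0" using vol_density_pos[OF c(1) param_cdom[OF c(1)]] y1(1) R(2) by blast
  define C where "C = max (?h y2) (1 / ?h y1)"
  have C: "C > 0" "?h y2 \<le> C" "1 / ?h y1 \<le> C" using pos by (auto simp: C_def less_max_iff_disj)
  have C1: "1 / C \<le> ?h y1" using C(1,3) pos by (simp add: field_simps)
  have "1 / C \<le> vol_density ?c z \<and> vol_density ?c z \<le> C" if "z \<in> ?W" for z
    using that C C1 y1(2) y2(2) ball_subset_cball by fastforce
  moreover have "coord ?c ` ?W = ball ?p R"
    using sub coord_param[OF c(1)] by (force simp: image_image)
  moreover have "?W \<subseteq> cdom ?c" using sub param_cdom[OF c(1)] by blast
  moreover have "x \<in> ?W" using param_coord[OF c] R(1) by (intro image_eqI[of _ _ ?p]) auto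
  moreover have "open ?W" using c sub by (intro open_param_image) auto
  ultimately show ?thesis using c(1) C(1)
    by (intro exI[of _ ?c] exI[of _ ?W] exI[of _ C]) auto
qed

lemma good_patchesD:
  "good_patches I C \<Longrightarrow> (c, W) \<in> I \<Longrightarrow>
    c \<in> A \<and> open W \<and> W \<noteq> {} \<and> W \<subseteq> cdom c \<and> bounded (coord c ` W)"
  by (auto simp: good_patches_def)

lemma ex_good_patches: "\<exists>I C. good_patches I C"
proof -
  have "\<forall>x. \<exists>c W C. c \<in> A \<and> open W \<and> x \<in> W \<and> W \<subseteq> cdom c \<and> bounded (coord c ` W) \<and> C > 0 \<and>
    (\<forall>x\<in>W. 1 / C \<le> vol_density c x \<and> vol_density c x \<le> C)" using ex_patch by blast
  then obtain ch W C where P: "\<And>x. ch x \<in> A \<and> open (W x) \<and> x \<in> W x \<and> W x \<subseteq> cdom (ch x) \<and>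
      bounded (coord (ch x) ` W x) \<and> C x > (0::real) \<and>
      (\<forall>y\<in>W x. 1 / C x \<le> vol_density (ch x) y \<and> vol_density (ch x) y \<le> C x)" by metis
  obtain X where X: "finite X" "UNIV \<subseteq> (\<Union>x\<in>X. W x)"
    using compactE_image[OF closed_manifold, of UNIV W] P by (metis UNIV_I UN_I subsetI)
  \<comment> \<open>The sum dominates every \<open>C x\<close>, and the summand 1 makes it positive
    at once.\<close>
  define D where "D = 1 + sum C X"
  have nn: "sum C X \<ge> 0" using P by (intro sum_nonneg) (auto intro: less_imp_le)
  have D: "C x \<le> D" if "x \<in> X" for x
    using member_le_sum[OF that, of C] X(1) P by (fastforce simp: D_def intro: less_imp_le)
  have bd: "1 / D \<le> vol_density (ch x) y \<and> vol_density (ch x) y \<le> D" if "x \<in> X" "y \<in> W x" for x y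
  proof -
    have "1 / D \<le> 1 / C x" using D[OF that(1)] P[of x] by (intro divide_left_mono) (auto simp: D_def)
    then show ?thesis using P[of x] that D[OF that(1)] by force
  qed
  have "W x \<noteq> {}" for x using P by blast
  then have "good_patches ((\<lambda>x. (ch x, W x)) ` X) D"
    unfolding good_patches_def using X P bd nn by (auto simp: D_def)
  then show ?thesis by blast
qed

lemma vol_density_transition:
  assumes c: "c \<in> A" "c' \<in> A" "x \<in> cdom c" "x \<in> cdom c'" and L: "chart_deriv c c' id x L"
  shows "\<bar>det (matrix L)\<bar> * vol_density c' x = vol_density c x"
proof -
  have "chart_vector A c x = chart_vector A c' x \<circ> L"
    using chart_vector_comp[OF c L] by auto
  then have "det (matrix (chart_vector A c x)) = det (matrix (chart_vector A c' x)) * det (matrix L)"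
    using det_matrix_comp[OF chart_deriv_linear[OF L] linear_chart_vector[OF c(2,4)]] by simp
  then have "vol_density c x * frame_det x = (\<bar>det (matrix L)\<bar> * vol_density c' x) * frame_det x"
    using vol_density_eq[OF c(1,3)] vol_density_eq[OF c(2,4)] by (simp add: abs_mult mult_ac)
  then show ?thesis using det_gram_frame(3)[of x] by simp
qed

end

section \<open>Words, products of Jacobians and Bowen balls\<close>

locale expanding_family = closed_connected_oriented_riemannian_manifold A g
  for A :: "('m::t2_space, 'n::finite) chart set" and g :: "'m \<Rightarrow> real ^ 'n \<Rightarrow> real ^ 'n \<Rightarrow> real" +
  fixes k :: nat and f :: "nat \<Rightarrow> 'm \<Rightarrow> 'm"
  assumes maps: "j \<in> {1..k} \<Longrightarrow> noncontracting_map A g 2 (f j)"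
    and no_coincidence: "j \<in> {1..k} \<Longrightarrow> j' \<in> {1..k} \<Longrightarrow> j \<noteq> j' \<Longrightarrow> f j x \<noteq> f j' x"
begin

definition word :: "nat \<Rightarrow> (nat \<Rightarrow> nat) \<Rightarrow> bool" where
  "word n w \<longleftrightarrow> (\<forall>i<n. w i \<in> {1..k})"

lemma word_le: "word n w \<Longrightarrow> m \<le> n \<Longrightarrow> word m w"
  by (auto simp: word_def)

lemma word_letter: "word n w \<Longrightarrow> i < n \<Longrightarrow> w i \<in> {1..k}"
  by (auto simp: word_def)

text \<open>By the chain rule the Jacobian of \<open>traj f w n\<close> at \<open>x\<close>; the
  product form is the one that exponentials of Birkhoff sums produce.\<close>

definition jac :: "(nat \<Rightarrow> nat) \<Rightarrow> nat \<Rightarrow> 'm \<Rightarrow> real" where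
  "jac w n x = (\<Prod>i<n. Jac A g (f (w i)) (traj f w i x))"

definition bowen :: "(nat \<Rightarrow> nat) \<Rightarrow> nat \<Rightarrow> 'm \<Rightarrow> real \<Rightarrow> 'm set" where
  "bowen w n x r = {y. \<forall>i\<le>n. rdist (traj f w i x) (traj f w i y) < r}"

lemma jac_pos: "word n w \<Longrightarrow> jac w n x > 0"
  unfolding jac_def by (intro prod_pos) (auto intro!: noncontracting_map.Jac_pos maps word_letter)

lemma continuous_traj: "word n w \<Longrightarrow> continuous_on UNIV (traj f w n)"
proof (induction n)
  case 0
  then show ?case by simp
next
  case (Suc n)
  have "continuous_on UNIV (f (w n))"
    using noncontracting_map.continuous_f[OF maps[OF word_letter[OF Suc.prems]]] by simp
  then show ?case
    unfolding traj_Suc_comp using Suc word_le[OF Suc.prems, of n]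
    by (intro continuous_on_compose) (auto elim: continuous_on_subset)
qed

text \<open>Chain rule through the chart chosen at the intermediate point, whose density occurs in
  both factors and cancels. The induction passes through that chart, hence \<open>c'\<close> is
  arbitrary in it.\<close>

lemma traj_chart_deriv:
  "word n w \<Longrightarrow> c \<in> A \<Longrightarrow> c' \<in> A \<Longrightarrow> x \<in> cdom c \<Longrightarrow> traj f w n x \<in> cdom c' \<Longrightarrow>
    \<exists>L. chart_deriv c c' (traj f w n) x L \<and>
      \<bar>det (matrix L)\<bar> * vol_density c' (traj f w n x) = jac w n x * vol_density c x"
proof (induction n arbitrary: c')
  case 0
  have e: "traj f w 0 = id" by auto
  have L: "chart_deriv c c' id x (frechet_derivative (transition c c') (at (coord c x)))"
    using chart_deriv_transition 0 by simp
  show ?case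
    unfolding e by (rule exI, rule conjI[OF L]) (use vol_density_transition[OF _ _ _ _ L] 0 in \<open>simp add: jac_def\<close>)
next
  case (Suc n)
  let ?y = "traj f w n x"
  let ?d = "chart_at A ?y"
  have d: "?d \<in> A" "?y \<in> cdom ?d" using chart_at by auto
  interpret fw: noncontracting_map A g 2 "f (w n)"
    using maps[OF word_letter[OF Suc.prems(1)]] by simp
  have wn: "word n w" using word_le[OF Suc.prems(1)] by simp
  obtain L where L: "chart_deriv c ?d (traj f w n) x L"
    "\<bar>det (matrix L)\<bar> * vol_density ?d ?y = jac w n x * vol_density c x"
    using Suc.IH[OF wn Suc.prems(2) d(1) Suc.prems(4) d(2)] by blast
  have fy: "f (w n) ?y \<in> cdom c'" using Suc.prems(5) by simp
  note L' = fw.chart_deriv_f[OF d(1) Suc.prems(3) d(2) fy]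
  let ?L' = "frechet_derivative (coord c' \<circ> f (w n) \<circ> param ?d) (at (coord ?d ?y))"
  have 1: "chart_deriv c c' (traj f w (Suc n)) x (?L' \<circ> L)"
    unfolding traj_Suc_comp
    using chart_deriv_comp[OF Suc.prems(2) d(1) continuous_traj[OF wn] Suc.prems(4) d(2) L(1) L'] .
  have "\<bar>det (matrix ?L')\<bar> * vol_density c' (f (w n) ?y) = Jac A g (f (w n)) ?y * vol_density ?d ?y"
    using Jac_density[OF fw.C_map_f fw.k_nonzero d(1) Suc.prems(3) d(2) fy L'] by simp
  then have "\<bar>det (matrix (?L' \<circ> L))\<bar> * vol_density c' (traj f w (Suc n) x) = jac w (Suc n) x * vol_density c x"
    using L(2) det_matrix_comp[OF chart_deriv_linear[OF L(1)] chart_deriv_linear[OF L']]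
    by (simp add: abs_mult jac_def) algebra
  with 1 show ?case by blast
qed

lemma bowen_0: "bowen w 0 x r = rball x r"
  by (simp add: bowen_def)

lemma bowen_subset_rball: "bowen w n x r \<subseteq> rball x r"
  unfolding bowen_def by (auto dest: spec[of _ 0])

lemma traj_bowen: "y \<in> bowen w n x r \<Longrightarrow> i \<le> n \<Longrightarrow> rdist (traj f w i x) (traj f w i y) < r"
  by (simp add: bowen_def)

lemma open_bowen:
  assumes "word n w" shows "open (bowen w n x r)"
proof -
  have "bowen w n x r = (\<Inter>i\<in>{..n}. traj f w i -` rball (traj f w i x) r)"
    by (auto simp: bowen_def)
  moreover have "open (traj f w i -` rball (traj f w i x) r)" if "i \<le> n" for i
    using open_rdist_ball continuous_traj[OF word_le[OF assms that]] by (rule open_vimage)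
  ultimately show ?thesis by auto
qed

text \<open>Collects what a common scale has to satisfy. Every clause survives a decrease of the
  radius, so the packing radius and the covering radius can both be taken below one
  \<open>r\<close>.\<close>

definition good_radius :: "(('m, 'n) chart \<times> 'm set) set \<Rightarrow> real \<Rightarrow> real \<Rightarrow> bool" where
  "good_radius I \<eta> r \<longleftrightarrow> (\<forall>x. \<exists>p\<in>I. rball x r \<subseteq> snd p) \<and>
    (\<forall>j\<in>{1..k}. (\<forall>x s z. s \<le> r \<longrightarrow> rdist (f j x) z < s \<longrightarrow> (\<exists>y. f j y = z \<and> rdist x y < s)) \<and>
      (\<forall>x. inj_on (f j) (rball x r)) \<and>
      (\<forall>x y. rdist x y < r \<longrightarrow> \<bar>ln (Jac A g (f j) x) - ln (Jac A g (f j) y)\<bar> \<le> \<eta>))"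

lemma good_radius_mono: "good_radius I \<eta> r \<Longrightarrow> r' \<le> r \<Longrightarrow> good_radius I \<eta> r'"
proof -
  assume r: "good_radius I \<eta> r" "r' \<le> r"
  have sub: "rball x r' \<subseteq> rball x r" for x using r(2) by auto
  have "\<exists>p\<in>I. rball x r' \<subseteq> snd p" for x
    using r(1) sub[of x] unfolding good_radius_def by (meson subset_trans)
  moreover have "inj_on (f j) (rball x r')" if "j \<in> {1..k}" for j x
    using r(1) that sub[of x] unfolding good_radius_def by (meson inj_on_subset)
  ultimately show "good_radius I \<eta> r'"
    using r unfolding good_radius_def by (smt (verit))
qed

lemma ex_good_radius:
  assumes I: "good_patches I C" and "\<eta> > 0"
  shows "\<exists>r>0. good_radius I \<eta> r"
proof -
  let ?P1 = "\<lambda>j r. \<forall>x s z. s \<le> r \<longrightarrow> rdist (f j x) z < s \<longrightarrow> (\<exists>y. f j y = z \<and> rdist x y < s)"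
  let ?P2 = "\<lambda>j r. \<forall>x. inj_on (f j) (rball x r)"
  let ?P3 = "\<lambda>j r. \<forall>x y. rdist x y < r \<longrightarrow> \<bar>ln (Jac A g (f j) x) - ln (Jac A g (f j) y)\<bar> \<le> \<eta>"
  have 1: "\<exists>r>0. \<forall>j\<in>{1..k}. ?P1 j r"
    by (rule finite_uniform_radius[OF _ noncontracting_map.expanding_ball[OF maps]]) auto
  have 2: "\<exists>r>0. \<forall>j\<in>{1..k}. ?P2 j r"
  proof (rule finite_uniform_radius[OF _ noncontracting_map.locally_injective[OF maps]])
    fix j r r' assume r: "?P2 j r" "r' \<le> r"
    show "?P2 j r'"
    proof
      fix x show "inj_on (f j) (rball x r')"
        by (rule inj_on_subset[OF spec[OF r(1)] rball_mono[OF r(2)]])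
    qed
  qed auto
  have 3: "\<exists>r>0. \<forall>j\<in>{1..k}. ?P3 j r"
  proof (rule finite_uniform_radius)
    fix j assume "j \<in> {1..k}"
    then interpret fj: noncontracting_map A g 2 "f j" by (rule maps)
    have "continuous_on UNIV (\<lambda>x. ln (Jac A g (f j) x))"
      using fj.continuous_Jac fj.Jac_pos by (intro continuous_on_ln) (auto simp: less_imp_neq[symmetric])
    then show "\<exists>r>0. ?P3 j r" using uniformly_continuous_rdist \<open>\<eta> > 0\<close> by blast
  qed auto
  have 4: "\<exists>r>0. \<forall>x. \<exists>p\<in>I. rball x r \<subseteq> snd p"
  proof (rule compact_uniform_radius[OF closed_manifold])
    fix x0
    have "x0 \<in> (\<Union>p\<in>I. snd p)" using I by (simp add: good_patches_def)
    then obtain p where p: "p \<in> I" "x0 \<in> snd p" by blast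
    then have "open (snd p)" using I by (auto simp: good_patches_def)
    then obtain W r where "open W" "x0 \<in> W" "r > 0" "\<forall>y\<in>W. \<forall>z. rdist y z < r \<longrightarrow> z \<in> snd p"
      using rdist_small_nbhd[OF _ p(2)] by blast
    then show "\<exists>U r. open U \<and> x0 \<in> U \<and> r > 0 \<and> (\<forall>x\<in>U. \<exists>p\<in>I. rball x r \<subseteq> snd p)"
      using p(1) by (intro exI[of _ W] exI[of _ r]) blast
  next
    fix x r r' assume r: "\<exists>p\<in>I. rball x r \<subseteq> snd p" "r' \<le> r"
    then show "\<exists>p\<in>I. rball x r' \<subseteq> snd p" using rball_mono[OF r(2), of x] by blast
  qed
  obtain r1 r2 r3 r4 where r: "r1 > 0" "\<forall>j\<in>{1..k}. ?P1 j r1" "r2 > 0" "\<forall>j\<in>{1..k}. ?P2 j r2"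
    "r3 > 0" "\<forall>j\<in>{1..k}. ?P3 j r3" "r4 > 0" "\<forall>x. \<exists>p\<in>I. rball x r4 \<subseteq> snd p"
    using 1 2 3 4 by blast
  define r where "r = min (min r1 r2) (min r3 r4)"
  have le: "r \<le> r1" "r \<le> r2" "r \<le> r3" "r \<le> r4" by (auto simp: r_def)
  have sub: "rball x r \<subseteq> rball x r2" "rball x r \<subseteq> rball x r4" for x using le by auto
  have "good_radius I \<eta> r"
    unfolding good_radius_def
  proof (intro conjI allI ballI)
    fix x show "\<exists>p\<in>I. rball x r \<subseteq> snd p" using r(8) sub(2)[of x] by blast
  next
    fix j x assume "j \<in> {1..k}"
    then show "inj_on (f j) (rball x r)" using r(4) inj_on_subset[OF _ sub(1)[of x], of "f j"] by blast
  next
    fix j x s z assume j: "j \<in> {1..k}"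
    show "s \<le> r \<longrightarrow> rdist (f j x) z < s \<longrightarrow> (\<exists>y. f j y = z \<and> rdist x y < s)"
      using bspec[OF r(2) j, THEN spec, of x, THEN spec, of s, THEN spec, of z] le(1) by auto
  next
    fix j x y assume j: "j \<in> {1..k}"
    show "rdist x y < r \<longrightarrow> \<bar>ln (Jac A g (f j) x) - ln (Jac A g (f j) y)\<bar> \<le> \<eta>"
      using bspec[OF r(6) j, THEN spec, of x, THEN spec, of y] le(3) by auto
  qed
  then show ?thesis using r by (intro exI[of _ r]) (auto simp: r_def)
qed

lemma bowen_sym: "y \<in> bowen w n x r \<Longrightarrow> x \<in> bowen w n y r"
  by (simp add: bowen_def rdist_sym)

text \<open>The two orbits stay \<open>r\<close>-close during \<open>n\<close> steps, and each step
  costs at most a factor \<open>exp \<eta>\<close>.\<close>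

lemma jac_distortion:
  assumes r: "good_radius I \<eta> r" and w: "word n w" and y: "y \<in> bowen w n x r"
  shows "jac w n y \<le> exp (real n * \<eta>) * jac w n x"
proof -
  have pos: "Jac A g (f (w i)) z > 0" if "i < n" for i z
    using noncontracting_map.Jac_pos[OF maps[OF word_letter[OF w that]]] .
  have d: "\<bar>ln (Jac A g (f (w i)) (traj f w i x)) - ln (Jac A g (f (w i)) (traj f w i y))\<bar> \<le> \<eta>" if "i < n" for i
    using r word_letter[OF w that] traj_bowen[OF y, of i] that unfolding good_radius_def by auto
  have key: "a \<le> exp \<eta> * b" if "a > 0" "b > 0" "ln a - ln b \<le> \<eta>" for a b :: real
  proof -
    have "ln a \<le> \<eta> + ln b" using that by simp
    then have "exp (ln a) \<le> exp (\<eta> + ln b)" by (simp only: exp_le_cancel_iff)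
    then show ?thesis using that by (simp add: exp_add)
  qed
  have e: "exp (real n * \<eta>) = (\<Prod>i<n. exp \<eta>)" by (simp add: exp_of_nat_mult)
  show "jac w n y \<le> exp (real n * \<eta>) * jac w n x"
    unfolding jac_def e prod.distrib[symmetric]
  proof (rule prod_mono)
    fix i assume "i \<in> {..<n}"
    then show "0 \<le> Jac A g (f (w i)) (traj f w i y) \<and>
        Jac A g (f (w i)) (traj f w i y) \<le> exp \<eta> * Jac A g (f (w i)) (traj f w i x)"
      using d[of i] pos[of i] by (auto intro!: key less_imp_le[OF pos])
  qed
qed

text \<open>Points are pulled back one letter at a time: a point near
  \<open>traj f w (Suc n) x\<close> has a preimage equally near \<open>traj f w n x\<close>, to
  which the induction hypothesis applies. Closeness at the last time is the assumption on the point
  itself.\<close>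

lemma rball_subset_traj_bowen:
  assumes r: "good_radius I \<eta> r"
  shows "word n w \<Longrightarrow> rball (traj f w n x) r \<subseteq> traj f w n ` bowen w n x r"
proof (induction n)
  case 0
  then show ?case by (simp add: bowen_0)
next
  case (Suc n)
  show ?case
  proof
    fix z assume "z \<in> rball (traj f w (Suc n) x) r"
    then have z: "rdist (f (w n) (traj f w n x)) z < r" by simp
    have "\<forall>x s z. s \<le> r \<longrightarrow> rdist (f (w n) x) z < s \<longrightarrow> (\<exists>y. f (w n) y = z \<and> rdist x y < s)"
      using r word_letter[OF Suc.prems, of n] unfolding good_radius_def by blast
    then obtain y' where y': "f (w n) y' = z" "rdist (traj f w n x) y' < r" using z order_refl by blast
    then obtain y where y: "y \<in> bowen w n x r" "traj f w n y = y'"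
      using Suc.IH[OF word_le[OF Suc.prems]] by auto
    have "traj f w (Suc n) y = z" using y y' by simp
    moreover have "y \<in> bowen w (Suc n) x r"
      using y(1) z calculation unfolding bowen_def by (auto simp: le_Suc_eq)
    ultimately show "z \<in> traj f w (Suc n) ` bowen w (Suc n) x r" by blast
  qed
qed

text \<open>Closeness at time \<open>n\<close> puts the image into a ball on which the next map is
  injective.\<close>

lemma inj_on_traj_bowen:
  assumes r: "good_radius I \<eta> r"
  shows "word n w \<Longrightarrow> inj_on (traj f w n) (bowen w n x r)"
proof (induction n)
  case 0
  then show ?case by (auto simp: inj_on_def)
next
  case (Suc n)
  have sub: "bowen w (Suc n) x r \<subseteq> bowen w n x r" by (auto simp: bowen_def)
  have "inj_on (f (w n)) (rball (traj f w n x) r)"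
    using r word_letter[OF Suc.prems, of n] unfolding good_radius_def by blast
  moreover have "traj f w n ` bowen w (Suc n) x r \<subseteq> rball (traj f w n x) r"
    using traj_bowen by fastforce
  ultimately have "inj_on (f (w n)) (traj f w n ` bowen w (Suc n) x r)" by (rule inj_on_subset)
  moreover have "inj_on (traj f w n) (bowen w (Suc n) x r)"
    using Suc.IH[OF word_le[OF Suc.prems]] sub inj_on_subset by auto
  ultimately show ?case unfolding traj_Suc_comp by (rule comp_inj_on[rotated])
qed

text \<open>The densities at the start and at the end each cost at most a factor \<open>C\<close>,
  whence \<open>C\<^sup>2\<close> for every \<open>n\<close>.\<close>

lemma traj_coord_deriv:
  fixes c c' :: "('m, 'n) chart" and w :: "nat \<Rightarrow> nat" and n :: nat and x :: 'm
  defines "G \<equiv> coord c' \<circ> traj f w n \<circ> param c"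
  defines "L \<equiv> frechet_derivative G (at (coord c x))"
  assumes I: "good_patches I C" and w: "word n w" and p: "(c, W) \<in> I" "(c', W') \<in> I"
    and x: "x \<in> W" "traj f w n x \<in> W'"
  shows "(G has_derivative L) (at (coord c x))"
    and "jac w n x / C\<^sup>2 \<le> \<bar>det (matrix L)\<bar>" and "\<bar>det (matrix L)\<bar> \<le> C\<^sup>2 * jac w n x"
proof -
  have C: "C > 0" and c: "c \<in> A" "c' \<in> A" and sub: "W \<subseteq> cdom c" "W' \<subseteq> cdom c'"
    and dens: "\<And>x. x \<in> W \<Longrightarrow> 1 / C \<le> vol_density c x \<and> vol_density c x \<le> C"
      "\<And>x. x \<in> W' \<Longrightarrow> 1 / C \<le> vol_density c' x \<and> vol_density c' x \<le> C"
    using I p by (auto simp: good_patches_def)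
  have xc: "x \<in> cdom c" "traj f w n x \<in> cdom c'" using sub x by auto
  obtain L' where L: "chart_deriv c c' (traj f w n) x L'"
    "\<bar>det (matrix L')\<bar> * vol_density c' (traj f w n x) = jac w n x * vol_density c x"
    using traj_chart_deriv[OF w c xc] by blast
  let ?D = "\<bar>det (matrix L')\<bar>" and ?s = "vol_density c x" and ?t = "vol_density c' (traj f w n x)"
  have s: "1 / C \<le> ?s" "?s \<le> C" and t: "1 / C \<le> ?t" "?t \<le> C" using dens x by auto
  have J: "jac w n x > 0" by (rule jac_pos[OF w])
  have "jac w n x / C \<le> jac w n x * ?s" using mult_left_mono[OF s(1), of "jac w n x"] J by simp
  also have "\<dots> \<le> ?D * C" unfolding L(2)[symmetric] using t(2) by (rule mult_left_mono) simp
  finally have 1: "jac w n x / C\<^sup>2 \<le> ?D" using C by (simp add: field_simps power2_eq_square)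
  have "?D / C \<le> ?D * ?t" using mult_left_mono[OF t(1), of ?D] by simp
  also have "\<dots> \<le> jac w n x * C" unfolding L(2) using s(2) J by (intro mult_left_mono) auto
  finally have 2: "?D \<le> C\<^sup>2 * jac w n x" using C by (simp add: field_simps power2_eq_square)
  have G: "(G has_derivative L') (at (coord c x))" using L(1) by (simp add: chart_deriv_def G_def)
  have "L = L'" unfolding L_def by (rule frechet_derivative_at[OF G, symmetric])
  then show "(G has_derivative L) (at (coord c x))"
    "jac w n x / C\<^sup>2 \<le> \<bar>det (matrix L)\<bar>" "\<bar>det (matrix L)\<bar> \<le> C\<^sup>2 * jac w n x"
    using G 1 2 by simp_all
qed

section \<open>Volumes of images under compositions, and of balls\<close>

lemma vol_image_upper:
  assumes I: "good_patches I C" and w: "word n w" and p: "(c, W) \<in> I" "(c', W') \<in> I"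
    and S: "open S" "S \<subseteq> W" "traj f w n ` S \<subseteq> W'"
    and V: "open V" "V \<subseteq> traj f w n ` S" and B: "\<And>x. x \<in> S \<Longrightarrow> jac w n x \<le> B"
  shows "vol (coord c' ` V) \<le> C\<^sup>2 * B * vol (coord c ` S)"
proof -
  let ?G = "coord c' \<circ> traj f w n \<circ> param c"
  let ?L = "\<lambda>y. frechet_derivative ?G (at y)"
  note L = traj_coord_deriv[OF I w p]
  have c: "c \<in> A" "c' \<in> A" and sub: "W \<subseteq> cdom c" "W' \<subseteq> cdom c'" and bd: "bounded (coord c ` W)"
    using I p by (auto simp: good_patches_def)
  have SW: "x \<in> W" "traj f w n x \<in> W'" if "x \<in> S" for x using S that by auto
  have im: "?G ` coord c ` S = coord c' ` traj f w n ` S"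
    using SW sub param_coord[OF c(1)] by (force simp: image_image)
  show ?thesis
  proof (rule vol_le_of_subset_image)
    show "open (coord c ` S)" using S sub by (intro open_coord_image[OF c(1)]) auto
    show "bounded (coord c ` S)" using bd S(2) by (meson bounded_subset image_mono)
    show "(?G has_derivative ?L y) (at y)" if "y \<in> coord c ` S" for y
      using L SW that by auto
    show "\<bar>det (matrix (?L y))\<bar> \<le> C\<^sup>2 * B" if y: "y \<in> coord c ` S" for y
    proof -
      obtain x where x: "x \<in> S" "y = coord c x" using y by blast
      have "\<bar>det (matrix (?L y))\<bar> \<le> C\<^sup>2 * jac w n x" using L SW x by auto
      also have "\<dots> \<le> C\<^sup>2 * B" using B[OF x(1)] by (intro mult_left_mono) auto
      finally show ?thesis .
    qed
    show "coord c' ` V \<subseteq> ?G ` coord c ` S" unfolding im using V by blast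
    show "open (coord c' ` V)" using V S sub by (intro open_coord_image[OF c(2)]) auto
  qed
qed

text \<open>Injectivity excludes overlaps in \<open>W'\<close>, so its finite volume caps that of
  \<open>S\<close>.\<close>

lemma vol_image_lower:
  assumes I: "good_patches I C" and w: "word n w" and p: "(c, W) \<in> I" "(c', W') \<in> I"
    and S: "open S" "S \<subseteq> W" "traj f w n ` S \<subseteq> W'" and inj: "inj_on (traj f w n) S"
    and b: "b > 0" "\<And>x. x \<in> S \<Longrightarrow> b \<le> jac w n x"
  shows "b / C\<^sup>2 * vol (coord c ` S) \<le> vol (coord c' ` W')"
proof -
  let ?G = "coord c' \<circ> traj f w n \<circ> param c"
  let ?L = "\<lambda>y. frechet_derivative ?G (at y)"
  note L = traj_coord_deriv[OF I w p]
  have C: "C > 0" and c: "c \<in> A" "c' \<in> A" and sub: "W \<subseteq> cdom c" "W' \<subseteq> cdom c'"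
    and W': "open W'" "bounded (coord c' ` W')"
    using I p by (auto simp: good_patches_def)
  have SW: "x \<in> W" "traj f w n x \<in> W'" if "x \<in> S" for x using S that by auto
  have eq: "?G (coord c x) = coord c' (traj f w n x)" if "x \<in> S" for x
    using SW[OF that] sub param_coord[OF c(1)] by auto
  show ?thesis
  proof (rule vol_ge_of_inj)
    show "open (coord c ` S)" using S sub by (intro open_coord_image[OF c(1)]) auto
    show "(?G has_derivative ?L y) (at y)" if "y \<in> coord c ` S" for y
      using L SW that by auto
    show "b / C\<^sup>2 \<le> \<bar>det (matrix (?L y))\<bar>" if y: "y \<in> coord c ` S" for y
    proof -
      obtain x where x: "x \<in> S" "y = coord c x" using y by blast
      have "b / C\<^sup>2 \<le> jac w n x / C\<^sup>2" using b(2)[OF x(1)] by (intro divide_right_mono) auto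
      also have "\<dots> \<le> \<bar>det (matrix (?L y))\<bar>" using L SW x by auto
      finally show ?thesis .
    qed
    show "b / C\<^sup>2 > 0" using b C by simp
    show "inj_on ?G (coord c ` S)"
    proof (rule inj_onI)
      fix y y' assume "y \<in> coord c ` S" "y' \<in> coord c ` S"
        and e: "?G y = ?G y'"
      then obtain x x' where x: "x \<in> S" "x' \<in> S" "y = coord c x" "y' = coord c x'" by blast
      then have "coord c' (traj f w n x) = coord c' (traj f w n x')" using e eq by simp
      then have "traj f w n x = traj f w n x'"
        using SW(2)[OF x(1)] SW(2)[OF x(2)] sub(2) param_coord[OF c(2)] by (metis subsetD)
      then show "y = y'" using inj x by (auto dest: inj_onD)
    qed
    show "?G ` coord c ` S \<subseteq> coord c' ` W'"
      using eq SW(2) by (auto simp del: comp_apply)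
    show "open (coord c' ` W')" using W' sub by (intro open_coord_image[OF c(2)]) auto
  qed (rule W'(2))
qed

text \<open>If \<open>z\<close> is within \<open>e / 2\<close> of \<open>z0\<close>, its ball of
  radius \<open>e\<close> contains the fixed ball of radius \<open>e / 2\<close> around
  \<open>z0\<close>, whose part in any patch containing \<open>z0\<close> has positive volume. In
  \<open>compact_uniform_radius\<close> the volume \<open>m\<close> takes the place of the
  radius.\<close>

lemma rball_vol_bound:
  assumes I: "good_patches I C" and "e > 0"
  shows "\<exists>m>0. \<forall>z. \<forall>p\<in>I. rball z e \<subseteq> snd p \<longrightarrow> m \<le> vol (coord (fst p) ` rball z e)"
proof (rule compact_uniform_radius[OF closed_manifold])
  fix z0
  let ?O = "rball z0 (e / 2)"
  have oO: "open ?O" by (rule open_rdist_ball)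
  have z0: "z0 \<in> ?O" using \<open>e > 0\<close> by simp
  have "\<exists>m>0. \<forall>p\<in>I. z0 \<in> snd p \<longrightarrow> m \<le> vol (coord (fst p) ` (?O \<inter> snd p))"
  proof (rule finite_uniform_radius)
    show "finite I" using I by (simp add: good_patches_def)
    fix p assume p: "p \<in> I"
    obtain c W where cW: "p = (c, W)" by (cases p)
    note Q = good_patchesD[OF I p[unfolded cW]]
    show "\<exists>m>0. z0 \<in> snd p \<longrightarrow> m \<le> vol (coord (fst p) ` (?O \<inter> snd p))"
    proof (cases "z0 \<in> W")
      case True
      have "vol (coord c ` (?O \<inter> W)) > 0"
      proof (rule vol_pos)
        show "open (coord c ` (?O \<inter> W))" using Q oO by (intro open_coord_image) auto
        show "bounded (coord c ` (?O \<inter> W))" using Q by (meson bounded_subset image_mono inf_le2)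
      qed (use True z0 in blast)
      then show ?thesis using cW by auto
    qed (use cW in \<open>auto intro: exI[of _ 1]\<close>)
  qed auto
  then obtain m where m: "m > 0" "\<And>p. p \<in> I \<Longrightarrow> z0 \<in> snd p \<Longrightarrow> m \<le> vol (coord (fst p) ` (?O \<inter> snd p))"
    by blast
  have "m \<le> vol (coord (fst p) ` rball z e)" if z: "z \<in> ?O" and p: "p \<in> I" "rball z e \<subseteq> snd p" for z p
  proof -
    obtain c W where cW: "p = (c, W)" by (cases p)
    note Q = good_patchesD[OF I p(1)[unfolded cW]]
    have sub: "?O \<subseteq> rball z e"
    proof
      fix y assume "y \<in> ?O"
      then show "y \<in> rball z e" using z rdist_triangle[of z y z0] rdist_sym[of z z0] by simp
    qed
    have "z0 \<in> snd p" using sub p(2) z0 by blast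
    then have "m \<le> vol (coord c ` (?O \<inter> W))" using m(2)[OF p(1)] cW by simp
    also have "\<dots> \<le> vol (coord c ` rball z e)"
    proof (rule vol_mono)
      show "coord c ` (?O \<inter> W) \<subseteq> coord c ` rball z e" using sub by blast
      show "open (coord c ` (?O \<inter> W))" using Q oO by (intro open_coord_image) auto
      show "open (coord c ` rball z e)" using Q p(2) cW by (intro open_coord_image open_rdist_ball) auto
      show "bounded (coord c ` rball z e)" using Q p(2) cW by (metis bounded_subset image_mono snd_conv)
    qed
    finally show ?thesis using cW by simp
  qed
  then show "\<exists>U m. open U \<and> z0 \<in> U \<and> m > 0 \<and>
      (\<forall>z\<in>U. \<forall>p\<in>I. rball z e \<subseteq> snd p \<longrightarrow> m \<le> vol (coord (fst p) ` rball z e))"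
    using oO z0 m(1) by blast
qed (meson order_trans)

text \<open>Packing: around separated points the Bowen balls of radius \<open>e / 2\<close> are
  disjoint. The image of each contains a ball of radius \<open>e / 2\<close>, whose volume is at
  least \<open>m\<close>, and this bounds the volume of the Bowen ball from below.\<close>

lemma sum_inverse_jac_le:
  assumes I: "good_patches I C" and r: "good_radius I \<eta> r" and e: "0 < e" "e \<le> 2 * r"
  shows "\<exists>K>0. \<forall>n w E. word n w \<longrightarrow> finite E \<longrightarrow>
    (\<forall>x\<in>E. \<forall>y\<in>E. x \<noteq> y \<longrightarrow> (\<exists>i\<le>n. rdist (traj f w i x) (traj f w i y) > e)) \<longrightarrow>
    (\<Sum>x\<in>E. 1 / jac w n x) \<le> K * exp (real n * \<eta>)"
proof -
  have r2: "good_radius I \<eta> (e / 2)" using good_radius_mono[OF r] e by simp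
  obtain m where m: "m > 0" "\<And>z p. p \<in> I \<Longrightarrow> rball z (e / 2) \<subseteq> snd p \<Longrightarrow> m \<le> vol (coord (fst p) ` rball z (e / 2))"
    using rball_vol_bound[OF I, of "e / 2"] e by auto
  have fI: "finite I" and C: "C > 0"
    using I by (auto simp: good_patches_def)
  obtain pt where pt: "\<And>x. pt x \<in> I" "\<And>x. rball x (e / 2) \<subseteq> snd (pt x)"
    using r2 unfolding good_radius_def by metis
  define V where "V = (\<Sum>p\<in>I. vol (coord (fst p) ` snd p))"
  have V0: "V \<ge> 0" unfolding V_def by (intro sum_nonneg) auto
  have "(\<Sum>x\<in>E. 1 / jac w n x) \<le> (C\<^sup>2 / m * (V + 1)) * exp (real n * \<eta>)"
    if w: "word n w" and E: "finite E"
      and sep: "\<forall>x\<in>E. \<forall>y\<in>E. x \<noteq> y \<longrightarrow> (\<exists>i\<le>n. rdist (traj f w i x) (traj f w i y) > e)" for n w E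
  proof -
    let ?B = "\<lambda>x. bowen w n x (e / 2)"
    let ?v = "\<lambda>x. vol (coord (fst (pt x)) ` ?B x)"
    have B_sub: "?B x \<subseteq> snd (pt x)" for x using bowen_subset_rball pt(2) by blast
    have 1: "1 / jac w n x \<le> C\<^sup>2 / m * exp (real n * \<eta>) * ?v x" for x
    proof -
      let ?z = "traj f w n x"
      have J: "jac w n x > 0" by (rule jac_pos[OF w])
      have "m \<le> vol (coord (fst (pt ?z)) ` rball ?z (e / 2))" by (rule m(2)[OF pt])
      also have "\<dots> \<le> C\<^sup>2 * (exp (real n * \<eta>) * jac w n x) * ?v x"
      proof (rule vol_image_upper[OF I w])
        show "(fst (pt x), snd (pt x)) \<in> I" "(fst (pt ?z), snd (pt ?z)) \<in> I" using pt(1) by auto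
        show "open (?B x)" by (rule open_bowen[OF w])
        show "?B x \<subseteq> snd (pt x)" by (rule B_sub)
        show "traj f w n ` ?B x \<subseteq> snd (pt ?z)" using pt(2)[of ?z] traj_bowen by fastforce
        show "open (rball ?z (e / 2))" by (rule open_rdist_ball)
        show "rball ?z (e / 2) \<subseteq> traj f w n ` ?B x" by (rule rball_subset_traj_bowen[OF r2 w])
      qed (rule jac_distortion[OF r2 w])
      finally have "m \<le> C\<^sup>2 * (exp (real n * \<eta>) * jac w n x) * ?v x" .
      then show ?thesis using J m(1) by (simp add: field_simps)
    qed
    have disj: "?B x \<inter> ?B y = {}" if xy: "x \<in> E" "y \<in> E" "x \<noteq> y" for x y
    proof (rule ccontr)
      assume "?B x \<inter> ?B y \<noteq> {}"
      then obtain z where z: "z \<in> ?B x" "z \<in> ?B y" by blast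
      obtain i where i: "i \<le> n" "rdist (traj f w i x) (traj f w i y) > e" using sep xy by blast
      then show False
        using traj_bowen[OF z(1) i(1)] traj_bowen[OF z(2) i(1)]
          rdist_triangle[of "traj f w i x" "traj f w i y" "traj f w i z"]
          rdist_sym[of "traj f w i y" "traj f w i z"] by simp
    qed
    \<comment> \<open>Each centre is assigned one patch that contains its Bowen ball; disjointness
      is used within a patch, and the volumes of the patches are added.\<close>
    have "(\<Sum>x\<in>E. ?v x) = (\<Sum>p\<in>I. \<Sum>x\<in>{x\<in>E. pt x = p}. ?v x)"
      by (rule sum.group[symmetric]) (use E fI pt(1) in auto)
    also have "\<dots> \<le> V"
      unfolding V_def
    proof (rule sum_mono)
      fix p assume p: "p \<in> I"
      obtain c W where cW: "p = (c, W)" by (cases p)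
      note Q = good_patchesD[OF I p[unfolded cW]]
      have BW: "?B x \<subseteq> W" if "pt x = p" for x using B_sub[of x] that cW by simp
      have "(\<Sum>x\<in>{x\<in>E. pt x = p}. ?v x) = (\<Sum>x\<in>{x\<in>E. pt x = p}. vol (coord c ` ?B x))"
        by (rule sum.cong) (auto simp: cW)
      also have "\<dots> \<le> vol (coord c ` W)"
      proof (rule sum_vol_le)
        show "open (coord c ` ?B x) \<and> coord c ` ?B x \<subseteq> coord c ` W" if "x \<in> {x\<in>E. pt x = p}" for x
          using BW[of x] that Q open_bowen[OF w] by (auto intro!: open_coord_image)
        show "open (coord c ` W)" using Q by (intro open_coord_image) auto
        have "coord c ` ?B x \<inter> coord c ` ?B y = {}" if "x \<in> {x\<in>E. pt x = p}" "y \<in> {x\<in>E. pt x = p}" "x \<noteq> y" for x y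
        proof -
          have "inj_on (coord c) W"
            using Q param_coord[of c] by (intro inj_on_inverseI[of _ "param c"]) auto
          then have "coord c ` ?B x \<inter> coord c ` ?B y = coord c ` (?B x \<inter> ?B y)"
            using BW that by (intro inj_on_image_Int[symmetric]) auto
          then show ?thesis using disj that by auto
        qed
        then show "disjoint_family_on (\<lambda>x. coord c ` ?B x) {x\<in>E. pt x = p}"
          by (auto simp: disjoint_family_on_def)
      qed (use E Q in auto)
      finally show "(\<Sum>x\<in>{x\<in>E. pt x = p}. ?v x) \<le> vol (coord (fst p) ` snd p)" by (simp add: cW)
    qed
    \<comment> \<open>\<open>V + 1\<close> in place of \<open>V\<close> makes the constant
      \<open>K\<close> positive without further argument.\<close>
    finally have 2: "(\<Sum>x\<in>E. ?v x) \<le> V + 1" by simp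
    have "(\<Sum>x\<in>E. 1 / jac w n x) \<le> (\<Sum>x\<in>E. C\<^sup>2 / m * exp (real n * \<eta>) * ?v x)"
      by (rule sum_mono) (rule 1)
    also have "\<dots> = C\<^sup>2 / m * exp (real n * \<eta>) * (\<Sum>x\<in>E. ?v x)" by (simp add: sum_distrib_left)
    also have "\<dots> \<le> C\<^sup>2 / m * exp (real n * \<eta>) * (V + 1)"
      using 2 m(1) by (intro mult_left_mono) auto
    finally show ?thesis by (simp add: mult_ac)
  qed
  then show ?thesis using C m(1) V0 by (intro exI[of _ "C\<^sup>2 / m * (V + 1)"]) auto
qed

text \<open>Covering: the Bowen balls cut out pieces that cover one fixed patch \<open>W\<close>. On
  each piece the composition is injective with image in a patch of volume at most \<open>V\<close>,
  which bounds the piece from above.\<close>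

lemma sum_inverse_jac_ge:
  assumes I: "good_patches I C" and r: "good_radius I \<eta> r"
  shows "\<exists>\<kappa>>0. \<forall>n w E. word n w \<longrightarrow> finite E \<longrightarrow> (\<Union>x\<in>E. bowen w n x r) = UNIV \<longrightarrow>
    \<kappa> * exp (- real n * \<eta>) \<le> (\<Sum>x\<in>E. 1 / jac w n x)"
proof -
  have fI: "finite I" and C: "C > 0" and cov: "(\<Union>p\<in>I. snd p) = UNIV"
    using I by (auto simp: good_patches_def)
  obtain c W where p: "(c, W) \<in> I" using cov by (metis UNIV_I UN_E surj_pair)
  note Q = good_patchesD[OF I p]
  obtain pt where pt: "\<And>x. pt x \<in> I" "\<And>x. rball x r \<subseteq> snd (pt x)"
    using r unfolding good_radius_def by metis
  define V where "V = (\<Sum>p\<in>I. vol (coord (fst p) ` snd p))"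
  have V: "vol (coord (fst p) ` snd p) \<le> V" if "p \<in> I" for p
    unfolding V_def by (rule member_le_sum[OF that _ fI]) auto
  have vW: "vol (coord c ` W) > 0" using Q by (intro vol_pos open_coord_image) auto
  then have V0: "V > 0" using V[OF p] by simp
  have "vol (coord c ` W) / (V * C\<^sup>2) * exp (- real n * \<eta>) \<le> (\<Sum>x\<in>E. 1 / jac w n x)"
    if w: "word n w" and E: "finite E" and cover: "(\<Union>x\<in>E. bowen w n x r) = UNIV" for n w E
  proof -
    let ?S = "\<lambda>x. bowen w n x r \<inter> W"
    have o: "open (?S x)" for x using open_bowen[OF w] Q by auto
    have 1: "vol (coord c ` ?S x) \<le> V * C\<^sup>2 * exp (real n * \<eta>) * (1 / jac w n x)" for x
    proof -
      let ?z = "traj f w n x"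
      have J: "jac w n x > 0" by (rule jac_pos[OF w])
      have "(jac w n x / exp (real n * \<eta>)) / C\<^sup>2 * vol (coord c ` ?S x) \<le> vol (coord (fst (pt ?z)) ` snd (pt ?z))"
      proof (rule vol_image_lower[OF I w p])
        show "(fst (pt ?z), snd (pt ?z)) \<in> I" using pt(1) by simp
        show "open (?S x)" by (rule o)
        show "traj f w n ` ?S x \<subseteq> snd (pt ?z)" using pt(2)[of ?z] traj_bowen by fastforce
        show "inj_on (traj f w n) (?S x)" using inj_on_traj_bowen[OF r w] by (rule inj_on_subset) auto
        \<comment> \<open>The distortion bound with centre and point exchanged, which makes it a
          lower bound for the Jacobian at the point.\<close>
        show "jac w n x / exp (real n * \<eta>) \<le> jac w n y" if "y \<in> ?S x" for y
          using jac_distortion[OF r w bowen_sym, of y x] that by (simp add: field_simps)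
      qed (use J in auto)
      also have "\<dots> \<le> V" by (rule V[OF pt(1)])
      finally show ?thesis using J C by (simp add: field_simps)
    qed
    have "vol (coord c ` W) \<le> (\<Sum>x\<in>E. vol (coord c ` ?S x))"
    proof (rule vol_le_sum[OF E])
      show "open (coord c ` ?S x) \<and> bounded (coord c ` ?S x)" for x
        using o[of x] Q by (auto intro!: open_coord_image) (meson bounded_subset image_mono inf_le2)
      show "open (coord c ` W)" using Q by (intro open_coord_image) auto
      show "coord c ` W \<subseteq> (\<Union>x\<in>E. coord c ` ?S x)" using cover by blast
    qed
    also have "\<dots> \<le> (\<Sum>x\<in>E. V * C\<^sup>2 * exp (real n * \<eta>) * (1 / jac w n x))"
      by (rule sum_mono) (rule 1)
    also have "\<dots> = V * C\<^sup>2 * exp (real n * \<eta>) * (\<Sum>x\<in>E. 1 / jac w n x)" by (simp add: sum_distrib_left)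
    finally have "vol (coord c ` W) \<le> V * C\<^sup>2 * exp (real n * \<eta>) * (\<Sum>x\<in>E. 1 / jac w n x)" .
    then show ?thesis using V0 C by (simp add: exp_minus field_simps)
  qed
  then show ?thesis using vW V0 C by (intro exI[of _ "vol (coord c ` W) / (V * C\<^sup>2)"]) auto
qed

text \<open>Absence of coincidences separates \<open>f j x0\<close> from \<open>f j' x0\<close>, and
  compactness makes this uniform. The starting points may be distinct but close, since orbits along
  different words need not pass through a common point.\<close>

lemma different_letters_separate:
  "\<exists>r>0. \<forall>x y j j'. j \<in> {1..k} \<longrightarrow> j' \<in> {1..k} \<longrightarrow> j \<noteq> j' \<longrightarrow> rdist x y < r \<longrightarrow> \<not> rdist (f j x) (f j' y) < r"
proof -
  let ?P = "\<lambda>q r. \<forall>x y. rdist x y < r \<longrightarrow> \<not> rdist (f (fst q) x) (f (snd q) y) < r"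
  let ?J = "{q \<in> {1..k} \<times> {1..k}. fst q \<noteq> snd q}"
  have "\<exists>r>0. \<forall>q\<in>?J. ?P q r"
  proof (rule finite_uniform_radius)
    fix q assume q: "q \<in> ?J"
    obtain j j' where jj: "q = (j, j')" by (cases q)
    have j: "j \<in> {1..k}" "j' \<in> {1..k}" "j \<noteq> j'" using q jj by auto
    interpret fj: noncontracting_map A g 2 "f j" by (rule maps[OF j(1)])
    interpret fj': noncontracting_map A g 2 "f j'" by (rule maps[OF j(2)])
    have "\<exists>r>0. \<forall>x. \<forall>y. rdist x y < r \<longrightarrow> \<not> rdist (f j x) (f j' y) < r"
    proof (rule compact_uniform_radius[OF closed_manifold])
      fix x0
      obtain U U' where U: "open U" "open U'" "f j x0 \<in> U" "f j' x0 \<in> U'" "U \<inter> U' = {}"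
        using hausdorff[OF no_coincidence[OF j, of x0]] by blast
      obtain W r where W: "open W" "f j x0 \<in> W" "r > 0" "\<forall>y\<in>W. \<forall>z. rdist y z < r \<longrightarrow> z \<in> U"
        using rdist_small_nbhd[OF U(1,3)] by blast
      obtain W' r' where W': "open W'" "x0 \<in> W'" "r' > 0" "\<forall>y\<in>W'. \<forall>z. rdist y z < r' \<longrightarrow> z \<in> f j' -` U'"
        using rdist_small_nbhd[OF fj'.open_vimage_f[OF U(2)], of x0] U(4) by blast
      have "\<not> rdist (f j x) (f j' y) < min r r'" if x: "x \<in> f j -` W \<inter> W'" "rdist x y < min r r'" for x y
      proof
        assume "rdist (f j x) (f j' y) < min r r'"
        then have "f j' y \<in> U" using W(4) x by auto
        moreover have "f j' y \<in> U'" using W'(4) x by auto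
        ultimately show False using U(5) by blast
      qed
      then show "\<exists>U r. open U \<and> x0 \<in> U \<and> r > 0 \<and> (\<forall>x\<in>U. \<forall>y. rdist x y < r \<longrightarrow> \<not> rdist (f j x) (f j' y) < r)"
        using W(2,3) W'(1-3) fj.open_vimage_f[OF W(1)]
        by (intro exI[of _ "f j -` W \<inter> W'"] exI[of _ "min r r'"]) auto
    qed (smt (verit))
    then show "\<exists>r>0. ?P q r" by (simp add: jj)
  qed (simp, smt (verit))
  then obtain r where r: "r > 0" "\<forall>q\<in>?J. ?P q r" by blast
  have "\<not> rdist (f j x) (f j' y) < r"
    if "j \<in> {1..k}" "j' \<in> {1..k}" "j \<noteq> j'" "rdist x y < r" for x y j j'
    using bspec[OF r(2), of "(j, j')"] that by auto
  then show ?thesis using r(1) by blast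
qed

end

section \<open>Topological pressure\<close>

lemma ln_ennreal_le: "b > 0 \<Longrightarrow> x \<le> ennreal b \<Longrightarrow> ln_ennreal x \<le> ereal (ln b)"
  by (cases x) (auto simp: ln_ennreal_def top_unique ennreal_neg)

lemma ln_ennreal_ge: "b > 0 \<Longrightarrow> ennreal b \<le> x \<Longrightarrow> ereal (ln b) \<le> ln_ennreal x"
  by (cases x) (auto simp: ln_ennreal_def)

lemma growth_rate_tendsto:
  fixes K c :: real and k :: nat
  assumes "K > 0" "k \<ge> 1"
  shows "(\<lambda>n. ereal (ln (K * real k ^ n * exp (real n * c)) / real n)) \<longlonglongrightarrow> ereal (ln (real k) + c)"
proof -
  have "(\<lambda>n. ln K / real n + (ln (real k) + c)) \<longlonglongrightarrow> 0 + (ln (real k) + c)"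
    by (intro tendsto_add tendsto_const lim_const_over_n)
  moreover have "\<forall>\<^sub>F n in sequentially. ln K / real n + (ln (real k) + c) = ln (K * real k ^ n * exp (real n * c)) / real n"
    using eventually_gt_at_top[of 0]
    by eventually_elim (use assms in \<open>simp add: ln_mult ln_realpow field_simps\<close>)
  ultimately show ?thesis by (simp add: tendsto_cong)
qed

lemma limsup_growth:
  assumes "K > 0" "k \<ge> 1"
  shows "limsup (\<lambda>n. ereal (ln (K * real k ^ n * exp (real n * c))) / ereal (real n)) = ereal (ln (real k) + c)"
proof (rule lim_imp_Limsup)
  have "\<forall>\<^sub>F n in sequentially. ereal (ln (K * real k ^ n * exp (real n * c)) / real n) =
      ereal (ln (K * real k ^ n * exp (real n * c))) / ereal (real n)"
    using eventually_gt_at_top[of 0] by eventually_elim simp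
  with growth_rate_tendsto[OF assms]
  show "(\<lambda>n. ereal (ln (K * real k ^ n * exp (real n * c))) / ereal (real n)) \<longlonglongrightarrow> ereal (ln (real k) + c)"
    by (rule Lim_transform_eventually)
qed simp

lemma limsup_divide_mono:
  assumes "\<And>n. a n \<le> b n"
  shows "limsup (\<lambda>n. a n / ereal (real n)) \<le> limsup (\<lambda>n. b n / ereal (real n))"
proof (rule Limsup_mono)
  \<comment> \<open>The term \<open>n = 0\<close>, a division by zero, does not affect the
    limsup.\<close>
  show "\<forall>\<^sub>F n in sequentially. a n / ereal (real n) \<le> b n / ereal (real n)"
    using eventually_gt_at_top[of 0] by eventually_elim (simp add: assms)
qed

lemma limsup_growth_le:
  assumes "K > 0" "k \<ge> 1" "\<And>n. S n \<le> ennreal (K * real k ^ n * exp (real n * c))"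
  shows "limsup (\<lambda>n. ln_ennreal (S n) / ereal (real n)) \<le> ereal (ln (real k) + c)"
  unfolding limsup_growth[OF assms(1,2), symmetric]
  using assms by (intro limsup_divide_mono ln_ennreal_le) auto

lemma limsup_growth_ge:
  assumes "K > 0" "k \<ge> 1" "\<And>n. ennreal (K * real k ^ n * exp (real n * c)) \<le> S n"
  shows "ereal (ln (real k) + c) \<le> limsup (\<lambda>n. ln_ennreal (S n) / ereal (real n))"
  unfolding limsup_growth[OF assms(1,2), symmetric]
  using assms by (intro limsup_divide_mono ln_ennreal_ge) auto

text \<open>Greedy selection: a point is added only if it is related to all points kept so far. With
  \<open>R\<close> as separation this is a maximal separated subset, and each rejected point is
  close to a kept one.\<close>

lemma ex_maximal_pairwise:
  assumes "finite X" and sym: "\<And>x y. R x y \<Longrightarrow> R y x"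
  shows "\<exists>E\<subseteq>X. (\<forall>x\<in>E. \<forall>y\<in>E. x \<noteq> y \<longrightarrow> R x y) \<and> (\<forall>x\<in>X. x \<in> E \<or> (\<exists>e\<in>E. \<not> R e x))"
  using assms(1)
proof (induction X rule: finite_induct)
  case (insert x X)
  then obtain E where E: "E \<subseteq> X" "\<forall>x\<in>E. \<forall>y\<in>E. x \<noteq> y \<longrightarrow> R x y" "\<forall>x\<in>X. x \<in> E \<or> (\<exists>e\<in>E. \<not> R e x)"
    by blast
  show ?case
  proof (cases "\<exists>e\<in>E. \<not> R e x")
    case True
    then have "\<forall>y\<in>insert x X. y \<in> E \<or> (\<exists>e\<in>E. \<not> R e y)" using E(3) by auto
    then show ?thesis using E(1,2) by (intro exI[of _ E]) auto
  next
    case False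
    then have "R e x" "R x e" if "e \<in> E" for e using that sym by auto
    then have "\<forall>u\<in>insert x E. \<forall>v\<in>insert x E. u \<noteq> v \<longrightarrow> R u v" using E(2) by auto
    moreover have "\<forall>y\<in>insert x X. y \<in> insert x E \<or> (\<exists>e\<in>insert x E. \<not> R e y)" using E(3) by auto
    ultimately show ?thesis using E(1) by (intro exI[of _ "insert x E"]) auto
  qed
qed auto

lemma orbit_dist_gt_iff:
  "orbit_dist d (Suc n) xs ys > e \<longleftrightarrow> (\<exists>i\<le>n. d (xs ! i) (ys ! i) > e)"
proof -
  have "{d (xs ! i) (ys ! i) |i. i < Suc n} = (\<lambda>i. d (xs ! i) (ys ! i)) ` {..n}" by auto
  then show ?thesis unfolding orbit_dist_def by (subst Max_gr_iff) auto
qed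

section \<open>Orbits of the correspondence as words with starting points\<close>

locale expanding_correspondence = expanding_family A g k f
  for A :: "('m::t2_space, 'n::finite) chart set" and g :: "'m \<Rightarrow> real ^ 'n \<Rightarrow> real ^ 'n \<Rightarrow> real"
    and k :: nat and f :: "nat \<Rightarrow> 'm \<Rightarrow> 'm" +
  fixes T :: "'m \<Rightarrow> 'm set" and \<phi> :: "'m \<times> 'm \<Rightarrow> real"
  assumes k_pos: "k \<ge> 1"
    and T_eq: "T x = (\<lambda>j. f j x) ` {1..k}"
    and \<phi>_eq: "j \<in> {1..k} \<Longrightarrow> \<phi> (x, f j x) = - ln (Jac A g (f j) x)"
begin

text \<open>Extensional functions, so that words with the same letters before \<open>n\<close> are
  equal and can be counted.\<close>

definition words :: "nat \<Rightarrow> (nat \<Rightarrow> nat) set" where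
  "words n = {..<n} \<rightarrow>\<^sub>E {1..k}"

lemma finite_words [simp]: "finite (words n)"
  by (simp add: words_def finite_PiE)

lemma card_words: "card (words n) = k ^ n"
  by (simp add: words_def card_PiE)

lemma words_word: "w \<in> words n \<Longrightarrow> word n w"
  by (auto simp: words_def word_def PiE_def)

text \<open>A word of \<open>n\<close> letters produces \<open>n + 1\<close> points, hence
  \<open>Suc n\<close>.\<close>

definition orb :: "nat \<Rightarrow> (nat \<Rightarrow> nat) \<Rightarrow> 'm \<Rightarrow> 'm list" where
  "orb n w x = map (\<lambda>i. traj f w i x) [0..<Suc n]"

lemma length_orb [simp]: "length (orb n w x) = Suc n"
  by (simp add: orb_def)

lemma orb_nth: "i \<le> n \<Longrightarrow> orb n w x ! i = traj f w i x"
  unfolding orb_def by (subst nth_map) (auto simp del: upt_Suc)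

lemma orb_in_orbits: "w \<in> words n \<Longrightarrow> orb n w x \<in> orbits (n + 1) T"
proof -
  assume w: "w \<in> words n"
  then show ?thesis
    using word_letter[OF words_word[OF w]] by (auto simp: orbits_def orb_nth T_eq)
qed

lemma exp_birkhoff_sum_orb:
  assumes "w \<in> words n"
  shows "exp (birkhoff_sum \<phi> n (orb n w x)) = 1 / jac w n x"
proof -
  note w = word_letter[OF words_word[OF assms]]
  have "birkhoff_sum \<phi> n (orb n w x) = (\<Sum>i<n. - ln (Jac A g (f (w i)) (traj f w i x)))"
    unfolding birkhoff_sum_def by (rule sum.cong) (auto simp: orb_nth \<phi>_eq[OF w])
  also have "\<dots> = - ln (jac w n x)"
    unfolding jac_def sum_negf
    using noncontracting_map.Jac_pos[OF maps[OF w]]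
    by (subst ln_prod) (auto simp: less_imp_neq[symmetric])
  finally show ?thesis using jac_pos[OF words_word[OF assms]] by (simp add: exp_minus inverse_eq_divide)
qed

lemma orbits_eq_orb:
  assumes xs: "xs \<in> orbits (n + 1) T"
  shows "\<exists>w\<in>words n. xs = orb n w (xs ! 0)"
proof -
  have len: "length xs = Suc n" and "\<And>i. i < n \<Longrightarrow> xs ! Suc i \<in> T (xs ! i)"
    using xs by (auto simp: orbits_def)
  then have "\<forall>i\<in>{..<n}. \<exists>j. j \<in> {1..k} \<and> xs ! Suc i = f j (xs ! i)" by (auto simp: T_eq image_iff Bex_def)
  from bchoice[OF this] obtain v where v: "\<forall>i\<in>{..<n}. v i \<in> {1..k} \<and> xs ! Suc i = f (v i) (xs ! i)"
    by (rule exE)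
  let ?w = "restrict v {..<n}"
  have tr: "xs ! i = traj f ?w i (xs ! 0)" if "i \<le> n" for i
    using that by (induction i) (use v in auto)
  have "xs = orb n ?w (xs ! 0)"
  proof (rule nth_equalityI)
    fix i assume "i < length xs"
    then have "i \<le> n" using len by simp
    then show "xs ! i = orb n ?w (xs ! 0) ! i" by (simp only: orb_nth) (rule tr)
  qed (simp add: len)
  moreover have "?w \<in> words n" using v by (auto simp: words_def)
  ultimately show ?thesis by blast
qed

definition partition_sum :: "real \<Rightarrow> nat \<Rightarrow> ennreal" where
  "partition_sum e n = (SUP E \<in> {E. E \<subseteq> orbits (n + 1) T \<and> separated rdist (n + 1) e E}.
     (\<Sum>\<^sub>\<infinity>xs\<in>E. ennreal (exp (birkhoff_sum \<phi> n xs))))"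

text \<open>A separated set might be infinite, so the bound is shown for its finite subsets. An
  orbit with a given word is determined by its starting point, which reduces the part of the sum
  belonging to that word to the packing estimate \<open>K\<close>.\<close>

lemma partition_sum_le:
  assumes K: "\<And>n w E. word n w \<Longrightarrow> finite E \<Longrightarrow>
    (\<And>x y. x \<in> E \<Longrightarrow> y \<in> E \<Longrightarrow> x \<noteq> y \<Longrightarrow> \<exists>i\<le>n. rdist (traj f w i x) (traj f w i y) > e) \<Longrightarrow>
    (\<Sum>x\<in>E. 1 / jac w n x) \<le> K * exp (real n * \<eta>)"
  shows "partition_sum e n \<le> ennreal (K * real k ^ n * exp (real n * \<eta>))"
  unfolding partition_sum_def
proof (rule SUP_least, rule infsum_le_finite_sums)
  fix E F assume E: "E \<in> {E. E \<subseteq> orbits (n + 1) T \<and> separated rdist (n + 1) e E}"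
    and F: "finite F" "F \<subseteq> E"
  have sepF: "\<exists>i\<le>n. rdist (xs ! i) (ys ! i) > e" if "xs \<in> F" "ys \<in> F" "xs \<noteq> ys" for xs ys
  proof -
    have "xs \<in> E" "ys \<in> E" using F(2) that by auto
    then have "orbit_dist rdist (Suc n) xs ys > e" using E that(3) by (auto simp: separated_def)
    then show ?thesis by (simp only: orbit_dist_gt_iff)
  qed
  \<comment> \<open>One word is chosen for each orbit, and the sum is then grouped by words.\<close>
  have "\<forall>xs\<in>F. \<exists>w. w \<in> words n \<and> xs = orb n w (xs ! 0)" using orbits_eq_orb E F by blast
  from bchoice[OF this] obtain wd where wd: "\<And>xs. xs \<in> F \<Longrightarrow> wd xs \<in> words n \<and> xs = orb n (wd xs) (xs ! 0)"
    by blast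
  have inner: "(\<Sum>xs\<in>{xs\<in>F. wd xs = w}. exp (birkhoff_sum \<phi> n xs)) \<le> K * exp (real n * \<eta>)" if w: "w \<in> words n" for w
  proof -
    let ?F = "{xs\<in>F. wd xs = w}" let ?h = "\<lambda>xs. xs ! 0"
    have orb: "xs = orb n w (xs ! 0)" if "xs \<in> ?F" for xs using wd that by auto
    then have inj: "inj_on ?h ?F" by (metis (no_types, lifting) inj_onI)
    have "(\<Sum>xs\<in>?F. exp (birkhoff_sum \<phi> n xs)) = (\<Sum>xs\<in>?F. 1 / jac w n (?h xs))"
      using orb exp_birkhoff_sum_orb[OF w] by (intro sum.cong refl) metis
    also have "\<dots> = (\<Sum>x\<in>?h ` ?F. 1 / jac w n x)" by (simp only: sum.reindex[OF inj] comp_def)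
    also have "\<dots> \<le> K * exp (real n * \<eta>)"
    proof (rule K[OF words_word[OF w]])
      fix x y assume "x \<in> ?h ` ?F" "y \<in> ?h ` ?F" "x \<noteq> y"
      then obtain xs ys where xy: "xs \<in> ?F" "ys \<in> ?F" "x = ?h xs" "y = ?h ys" "xs \<noteq> ys" by blast
      then obtain i where i: "i \<le> n" "rdist (xs ! i) (ys ! i) > e" using sepF by blast
      then have "rdist (orb n w x ! i) (orb n w y ! i) > e" using orb xy by metis
      then show "\<exists>i\<le>n. rdist (traj f w i x) (traj f w i y) > e" using i(1) by (auto simp: orb_nth)
    qed (use F in auto)
    finally show ?thesis .
  qed
  have "(\<Sum>xs\<in>F. exp (birkhoff_sum \<phi> n xs)) = (\<Sum>w\<in>words n. \<Sum>xs\<in>{xs\<in>F. wd xs = w}. exp (birkhoff_sum \<phi> n xs))"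
    by (rule sum.group[symmetric]) (use F wd in auto)
  also have "\<dots> \<le> (\<Sum>w\<in>words n. K * exp (real n * \<eta>))" by (rule sum_mono) (rule inner)
  also have "\<dots> = K * real k ^ n * exp (real n * \<eta>)" by (simp add: card_words)
  finally show "(\<Sum>xs\<in>F. ennreal (exp (birkhoff_sum \<phi> n xs))) \<le> ennreal (K * real k ^ n * exp (real n * \<eta>))"
    by (subst sum_ennreal) (auto intro: ennreal_leI)
qed (rule nonneg_summable_on_complete, simp)

text \<open>Each word gets a maximal separated set of starting points. The orbits of all words
  together are still separated, so they compete in the supremum, and the covering estimate \<kappa>
  applies to each word.\<close>

lemma partition_sum_ge:
  assumes \<kappa>: "\<And>n w E. word n w \<Longrightarrow> finite E \<Longrightarrow> (\<Union>x\<in>E. bowen w n x (2 * e)) = UNIV \<Longrightarrow>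
      \<kappa> * exp (real n * c) \<le> (\<Sum>x\<in>E. 1 / jac w n x)"
    and e: "e > 0" "\<And>x y j j'. j \<in> {1..k} \<Longrightarrow> j' \<in> {1..k} \<Longrightarrow> j \<noteq> j' \<Longrightarrow> rdist x y \<le> e \<Longrightarrow> rdist (f j x) (f j' y) > e"
  shows "ennreal (\<kappa> * real k ^ n * exp (real n * c)) \<le> partition_sum e n"
proof -
  let ?sep = "\<lambda>w x y. \<exists>i\<le>n. rdist (traj f w i x) (traj f w i y) > e"
  have "\<exists>E. finite E \<and> (\<forall>x\<in>E. \<forall>y\<in>E. x \<noteq> y \<longrightarrow> ?sep w x y) \<and> (\<Union>x\<in>E. bowen w n x (2 * e)) = UNIV"
    if w: "w \<in> words n" for w
  proof -
    have "x \<in> bowen w n x e" for x using e(1) by (simp add: bowen_def)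
    then obtain X where X: "finite X" "UNIV \<subseteq> (\<Union>x\<in>X. bowen w n x e)"
      using compactE_image[OF closed_manifold, of UNIV "\<lambda>x. bowen w n x e"] open_bowen[OF words_word[OF w]]
      by (metis UNIV_I UN_I subsetI)
    obtain E where E: "E \<subseteq> X" "\<forall>x\<in>E. \<forall>y\<in>E. x \<noteq> y \<longrightarrow> ?sep w x y"
      "\<forall>x\<in>X. x \<in> E \<or> (\<exists>u\<in>E. \<not> ?sep w u x)"
      using ex_maximal_pairwise[OF X(1), of "?sep w"] rdist_sym by metis
    have "y \<in> (\<Union>x\<in>E. bowen w n x (2 * e))" for y
    proof -
      obtain x where x: "x \<in> X" "y \<in> bowen w n x e" using X(2) by blast
      have "\<exists>u\<in>E. \<forall>i\<le>n. rdist (traj f w i u) (traj f w i x) \<le> e"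
      proof (cases "x \<in> E")
        case True
        then show ?thesis using e(1) by (intro bexI[of _ x]) auto
      next
        case False
        then show ?thesis using E(3) x(1) by (meson not_less)
      qed
      then obtain u where u: "u \<in> E" "\<And>i. i \<le> n \<Longrightarrow> rdist (traj f w i u) (traj f w i x) \<le> e" by blast
      \<comment> \<open>Maximality holds only among the points of \<open>X\<close>: one
        \<open>e\<close> comes from it and another from the cover by Bowen balls around
        \<open>X\<close>.\<close>
      have "rdist (traj f w i u) (traj f w i y) < 2 * e" if "i \<le> n" for i
        using u(2)[OF that] traj_bowen[OF x(2) that]
          rdist_triangle[of "traj f w i u" "traj f w i y" "traj f w i x"] by simp
      then show ?thesis using u(1) by (auto simp: bowen_def)
    qed
    then show ?thesis using E X(1) by (intro exI[of _ E]) (auto intro: finite_subset)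
  qed
  then obtain E where E: "\<And>w. w \<in> words n \<Longrightarrow> finite (E w) \<and> (\<forall>x\<in>E w. \<forall>y\<in>E w. x \<noteq> y \<longrightarrow> ?sep w x y) \<and>
      (\<Union>x\<in>E w. bowen w n x (2 * e)) = UNIV" by metis
  let ?D = "Sigma (words n) E"
  let ?o = "\<lambda>(w, x). orb n w x"
  have sepD: "orbit_dist rdist (n + 1) (orb n w x) (orb n v y) > e"
    if D: "(w, x) \<in> ?D" "(v, y) \<in> ?D" "(w, x) \<noteq> (v, y)" for w x v y
  proof -
    have wv: "w \<in> words n" "v \<in> words n" using D by auto
    have "\<exists>i\<le>n. rdist (traj f w i x) (traj f v i y) > e"
    proof (cases "w = v")
      case True
      then show ?thesis using D E[OF wv(1)] by auto
    next
      case False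
      \<comment> \<open>Where the letters differ, the points are either already apart at time
        \<open>i\<close> or so close that different maps drive them apart at time
        \<open>Suc i\<close>, which is still at most \<open>n\<close>.\<close>
      then obtain i where i: "i < n" "w i \<noteq> v i" using wv PiE_ext unfolding words_def by blast
      show ?thesis
      proof (cases "rdist (traj f w i x) (traj f v i y) \<le> e")
        case True
        then have "rdist (traj f w (Suc i) x) (traj f v (Suc i) y) > e"
          using e(2)[OF word_letter[OF words_word[OF wv(1)] i(1)] word_letter[OF words_word[OF wv(2)] i(1)] i(2)] by simp
        then show ?thesis using i(1) by (intro exI[of _ "Suc i"]) auto
      next
        case False
        then show ?thesis using i(1) by (intro exI[of _ i]) auto
      qed
    qed
    then show ?thesis using orbit_dist_gt_iff[of e rdist n "orb n w x" "orb n v y"] by (auto simp: orb_nth)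
  qed
  have zero: "orbit_dist rdist (n + 1) xs xs \<le> e" for xs
    using orbit_dist_gt_iff[of e rdist n xs xs] e(1) by force
  \<comment> \<open>Separation by more than a positive \<open>e\<close> excludes equality, so
    different pairs of word and starting point give different orbits and no weight is counted
    twice.\<close>
  have inj: "inj_on ?o ?D"
  proof (rule inj_onI)
    fix p q assume pq: "p \<in> ?D" "q \<in> ?D" "?o p = ?o q"
    obtain w x v y where e: "p = (w, x)" "q = (v, y)" by (cases p, cases q)
    show "p = q"
    proof (rule ccontr)
      assume "p \<noteq> q"
      then have "orbit_dist rdist (n + 1) (orb n w x) (orb n v y) > e" using sepD pq unfolding e by blast
      then show False using pq(3) zero[of "orb n v y"] by (simp add: e)
    qed
  qed
  have finD: "finite ?D" using E by auto
  have sep: "?o ` ?D \<in> {E. E \<subseteq> orbits (n + 1) T \<and> separated rdist (n + 1) e E}"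
    using orb_in_orbits sepD by (fastforce simp: separated_def)
  have "\<kappa> * real k ^ n * exp (real n * c) = (\<Sum>w\<in>words n. \<kappa> * exp (real n * c))" by (simp add: card_words)
  also have "\<dots> \<le> (\<Sum>w\<in>words n. \<Sum>x\<in>E w. 1 / jac w n x)"
  proof (rule sum_mono)
    fix w assume w: "w \<in> words n"
    show "\<kappa> * exp (real n * c) \<le> (\<Sum>x\<in>E w. 1 / jac w n x)"
      using \<kappa>[OF words_word[OF w], of "E w"] E[OF w] by simp
  qed
  also have "\<dots> = (\<Sum>(w, x)\<in>?D. 1 / jac w n x)" by (rule sum.Sigma) (use E in auto)
  also have "\<dots> = (\<Sum>p\<in>?D. exp (birkhoff_sum \<phi> n (?o p)))"
    by (rule sum.cong) (auto simp: exp_birkhoff_sum_orb)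
  also have "\<dots> = (\<Sum>xs\<in>?o ` ?D. exp (birkhoff_sum \<phi> n xs))"
    using sum.reindex[OF inj, of "\<lambda>xs. exp (birkhoff_sum \<phi> n xs)"] by simp
  finally have "ennreal (\<kappa> * real k ^ n * exp (real n * c)) \<le> (\<Sum>xs\<in>?o ` ?D. ennreal (exp (birkhoff_sum \<phi> n xs)))"
    by (subst sum_ennreal) (auto intro: ennreal_leI)
  also have "\<dots> = (\<Sum>\<^sub>\<infinity>xs\<in>?o ` ?D. ennreal (exp (birkhoff_sum \<phi> n xs)))"
    using finD by (intro infsum_finite[symmetric]) auto
  also have "\<dots> \<le> partition_sum e n"
    unfolding partition_sum_def by (rule SUP_upper[OF sep])
  finally show ?thesis .
qed

text \<open>\<open>K\<close> and \<kappa> depend on \<open>e\<close> but not on \<open>n\<close>, so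
  they drop out of the limsup. The bound \<open>r / 2\<close> makes room for the covering radius
  \<open>2 * e\<close>, and \<open>s\<close> keeps different words apart.\<close>

lemma limsup_partition_sum_bounds:
  assumes "\<eta> > 0"
  shows "\<exists>e0>0. \<forall>e. 0 < e \<longrightarrow> e < e0 \<longrightarrow>
    ereal (ln (real k) - \<eta>) \<le> limsup (\<lambda>n. ln_ennreal (partition_sum e n) / ereal (real n)) \<and>
    limsup (\<lambda>n. ln_ennreal (partition_sum e n) / ereal (real n)) \<le> ereal (ln (real k) + \<eta>)"
proof -
  obtain I C where I: "good_patches I C" using ex_good_patches by blast
  obtain r where r: "r > 0" "good_radius I \<eta> r" using ex_good_radius[OF I assms] by blast
  obtain s where s: "s > 0" "\<And>x y j j'. j \<in> {1..k} \<Longrightarrow> j' \<in> {1..k} \<Longrightarrow> j \<noteq> j' \<Longrightarrow> rdist x y < s \<Longrightarrow> \<not> rdist (f j x) (f j' y) < s"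
    using different_letters_separate by blast
  have "ereal (ln (real k) - \<eta>) \<le> limsup (\<lambda>n. ln_ennreal (partition_sum e n) / ereal (real n)) \<and>
    limsup (\<lambda>n. ln_ennreal (partition_sum e n) / ereal (real n)) \<le> ereal (ln (real k) + \<eta>)"
    if e: "0 < e" "e < min (r / 2) s" for e
  proof
    obtain K where K: "K > 0" "\<And>n w E. word n w \<Longrightarrow> finite E \<Longrightarrow>
        (\<forall>x\<in>E. \<forall>y\<in>E. x \<noteq> y \<longrightarrow> (\<exists>i\<le>n. rdist (traj f w i x) (traj f w i y) > e)) \<Longrightarrow>
        (\<Sum>x\<in>E. 1 / jac w n x) \<le> K * exp (real n * \<eta>)"
    proof -
      have "e \<le> 2 * r" using e r(1) by simp
      then show thesis using sum_inverse_jac_le[OF I r(2) e(1)] that by blast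
    qed
    have "partition_sum e n \<le> ennreal (K * real k ^ n * exp (real n * \<eta>))" for n
    proof (rule partition_sum_le)
      fix n w and E :: "'m set"
      assume *: "word n w" "finite E"
        "\<And>x y. x \<in> E \<Longrightarrow> y \<in> E \<Longrightarrow> x \<noteq> y \<Longrightarrow> \<exists>i\<le>n. rdist (traj f w i x) (traj f w i y) > e"
      show "(\<Sum>x\<in>E. 1 / jac w n x) \<le> K * exp (real n * \<eta>)"
        by (rule K(2)[OF *(1,2)]) (intro ballI impI *(3))
    qed
    then show "limsup (\<lambda>n. ln_ennreal (partition_sum e n) / ereal (real n)) \<le> ereal (ln (real k) + \<eta>)"
      by (rule limsup_growth_le[OF K(1) k_pos])
    have r2: "good_radius I \<eta> (2 * e)" using good_radius_mono[OF r(2)] e by simp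
    obtain \<kappa> where \<kappa>: "\<kappa> > 0" "\<And>n w E. word n w \<Longrightarrow> finite E \<Longrightarrow> (\<Union>x\<in>E. bowen w n x (2 * e)) = UNIV \<Longrightarrow>
        \<kappa> * exp (- real n * \<eta>) \<le> (\<Sum>x\<in>E. 1 / jac w n x)"
      using sum_inverse_jac_ge[OF I r2] by blast
    have "ennreal (\<kappa> * real k ^ n * exp (real n * - \<eta>)) \<le> partition_sum e n" for n
    proof (rule partition_sum_ge)
      show "rdist (f j x) (f j' y) > e" if "j \<in> {1..k}" "j' \<in> {1..k}" "j \<noteq> j'" "rdist x y \<le> e" for x y j j'
        using s(2)[OF that(1-3), of x y] that(4) e by fastforce
      show "\<kappa> * exp (real n * - \<eta>) \<le> (\<Sum>x\<in>E. 1 / jac w n x)"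
        if "word n w" "finite E" "(\<Union>x\<in>E. bowen w n x (2 * e)) = UNIV" for n w E
        using \<kappa>(2)[OF that] by simp
    qed (rule e(1))
    from limsup_growth_ge[OF \<kappa>(1) k_pos this]
    show "ereal (ln (real k) - \<eta>) \<le> limsup (\<lambda>n. ln_ennreal (partition_sum e n) / ereal (real n))" by simp
  qed
  then show ?thesis using r(1) s(1) by (intro exI[of _ "min (r / 2) s"]) auto
qed

lemma topological_pressure_eq: "topological_pressure rdist T \<phi> = ereal (ln (real k))"
proof -
  let ?L = "\<lambda>e. limsup (\<lambda>n. ln_ennreal (partition_sum e n) / ereal (real n))"
  have "(?L \<longlongrightarrow> ereal (ln (real k))) (at_right 0)"
  proof (rule order_tendstoI)
    fix a assume "a < ereal (ln (real k))"
    then obtain b where b: "a < ereal b" "b < ln (real k)" using ereal_dense2 by force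
    \<comment> \<open>The gap between \<open>b\<close> and \<open>ln k\<close> serves as
      \<eta>.\<close>
    obtain e0 where "e0 > 0" "\<forall>e. 0 < e \<longrightarrow> e < e0 \<longrightarrow> ereal (ln (real k) - (ln (real k) - b)) \<le> ?L e"
      using limsup_partition_sum_bounds[of "ln (real k) - b"] b(2) by auto
    then show "\<forall>\<^sub>F e in at_right 0. a < ?L e"
      using b(1) by (auto simp: eventually_at_right_field intro!: exI[of _ e0] elim: order_less_le_trans)
  next
    fix a assume "ereal (ln (real k)) < a"
    then obtain b where b: "ereal b < a" "ln (real k) < b" using ereal_dense2 by force
    obtain e0 where "e0 > 0" "\<forall>e. 0 < e \<longrightarrow> e < e0 \<longrightarrow> ?L e \<le> ereal (ln (real k) + (b - ln (real k)))"
      using limsup_partition_sum_bounds[of "b - ln (real k)"] b(2) by auto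
    then show "\<forall>\<^sub>F e in at_right 0. ?L e < a"
      using b(1) by (auto simp: eventually_at_right_field intro!: exI[of _ e0] elim: order_le_less_trans)
  qed
  then have "Lim (at_right 0) ?L = ereal (ln (real k))"
    by (intro tendsto_Lim) auto
  then show ?thesis by (simp add: topological_pressure_def partition_sum_def)
qed

end

text \<open>The case \<open>n = 1\<close> of expansion. Here the standing assumption on the constant
  enters: with a constant below 1 the factor of a single step might drop below 1.\<close>

lemma (in riemannian_manifold) expanding_noncontracting:
  assumes "expanding A g 1 f"
  shows "tnorm g (f x) (tangent_map A f x v) \<ge> tnorm g x v"
proof -
  obtain lam :: real where "lam > 1" and
    "\<forall>x v. \<forall>n::nat. tnorm g ((f ^^ n) x) (tangent_map A (f ^^ n) x v) \<ge> 1 * lam ^ n * tnorm g x v"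
    using assms by (auto simp: expanding_def)
  then have "tnorm g ((f ^^ 1) x) (tangent_map A (f ^^ 1) x v) \<ge> 1 * lam ^ 1 * tnorm g x v" by blast
  moreover have "1 * tnorm g x v \<le> lam * tnorm g x v"
    using \<open>lam > 1\<close> metric_nonneg by (intro mult_right_mono) (auto simp: tnorm_def)
  ultimately show ?thesis by simp
qed

theorem theoremA:
  fixes A :: "('m::t2_space, 'n::finite) chart set"
    and g :: "'m \<Rightarrow> real ^ 'n \<Rightarrow> real ^ 'n \<Rightarrow> real"
    and k :: nat
    and f :: "nat \<Rightarrow> 'm \<Rightarrow> 'm"
    and T :: "'m \<Rightarrow> 'm set"
    and \<phi> :: "'m \<times> 'm \<Rightarrow> real"
  assumes "closed_connected_oriented_riemannian_manifold A g"
    and "k \<ge> 1"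
    and "\<And>j. j \<in> {1..k} \<Longrightarrow> C_map 2 A (f j)"
    and "\<And>j. j \<in> {1..k} \<Longrightarrow> expanding A g 1 (f j)"
    and "\<And>j j'. j \<in> {1..k} \<Longrightarrow> j' \<in> {1..k} \<Longrightarrow> j \<noteq> j' \<Longrightarrow> {x. f j x = f j' x} = {}"
    and "\<And>x. T x = (\<lambda>j. f j x) ` {1..k}"
    and "\<And>x j. j \<in> {1..k} \<Longrightarrow> \<phi> (x, f j x) = - ln (Jac A g (f j) x)"
  shows "topological_pressure (riemannian_dist A g) T \<phi> = ereal (ln (real k))"
proof -
  interpret M: closed_connected_oriented_riemannian_manifold A g by (rule assms(1))
  have maps: "noncontracting_map A g 2 (f j)" if "j \<in> {1..k}" for j
    using assms(3)[OF that] M.expanding_noncontracting[OF assms(4)[OF that]] by unfold_locales auto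
  have "expanding_family A g k f"
    by (intro expanding_family.intro expanding_family_axioms.intro assms(1) maps) (use assms(5) in auto)
  then interpret expanding_correspondence A g k f T \<phi>
    by (rule expanding_correspondence.intro)
      (rule expanding_correspondence_axioms.intro[OF assms(2,6,7)])
  show ?thesis by (rule topological_pressure_eq)
qed

end
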